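(* Let $\mathbb{M}\subset\mathbb{R}^d$ be a bounded domain with Lipschitz boundary, $\mathcal X$ a Banach space, $\mathfrak B\subset\mathcal X$ a bounded, closed and convex subset, and $F:\mathfrak B\to L^1(\mathbb{M})$ an operator such that $F(u)\ge0$ a.e. for all $u\in\mathfrak B$ and such that, for some $s>\frac d2$, $F(\mathfrak B)$ is a bounded subset of $H^s(\mathbb{M})$. Let $u^\dagger\in\mathfrak B$, $g^\dagger:=F(u^\dagger)$, and $\sigma>0$. For $t>0$ let $\tilde G_t$ be a Poisson process on $\mathbb{M}$ with intensity $tg^\dagger$, $G_t:=\frac1t\tilde G_t$, and for $g\in F(\mathfrak B)$ define $$\mathcal S(G_t;g):=\int_{\mathbb{M}}g\,\mathrm dx-\int_{\mathbb{M}}\ln(g+\sigma)\,(\mathrm dG_t+\sigma\,\mathrm dx),$$ $$\mathcal T(g^\dagger;g):=\int_{\mathbb{M}}\left[g-g^\dagger-(g^\dagger+\sigma)\ln\frac{g+\sigma}{g^\dagger+\sigma}\right]\mathrm dx .$$ Let $\mathcal R:\mathcal X\to(-\infty,\infty]$ be a proper convex functional and suppose there exist $u^*\in\partial\mathcal R(u^\dagger)$, $\beta>0$ and an index function $\varphi$ such that $\varphi^2$ is concave and $$\beta\,\mathcal D_{\mathcal R}^{u^*}(u,u^\dagger)\le\mathcal R(u)-\mathcal R(u^\dagger)+\varphi\left(\mathcal T(g^\dagger;F(u))\right)\qquad\text{for all }u\in\mathfrak B.$$ Suppose that the functional $u\mapsto\mathcal S(G_t;F(u))+\alpha\mathcal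 R(u)$ has a global minimizer over $\mathfrak B$, and let $u_\alpha$ denote such a minimizer. If the regularization parameter $\alpha=\alpha(t)>0$ is chosen such that $$\frac1\alpha\in-\partial(-\varphi)\left(\frac1{\sqrt t}\right),$$ then $$\mathbf E\left[\mathcal D_{\mathcal R}^{u^*}(u_{\alpha(t)},u^\dagger)\right]=\mathcal O\left(\varphi\left(\frac1{\sqrt t}\right)\right),\qquad t\to\infty.$$
   Context: A Poisson process on $\mathbb{M}$ with intensity $h\in L^1(\mathbb{M})$, $h\ge0$, is a random finite sum of point masses $G=\sum_{i=1}^N\delta_{x_i}$ such that $\mathbf E[G(\mathbb{M}')]=\int_{\mathbb{M}'}h\,\mathrm dx$ for every measurable $\mathbb{M}'\subset\mathbb{M}$ and $G(\mathbb{M}'_1),\dots,G(\mathbb{M}'_m)$ are independent for disjoint measurable $\mathbb{M}'_1,\dots,\mathbb{M}'_m$. Thus $\int\psi\,\mathrm dG_t=\frac1t\sum_{i}\psi(x_i)$ with $x_i$ the points of $\tilde G_t$. Elements of $H^s(\mathbb{M})$, $s>d/2$, are identified with their continuous representatives. The minimizer $u_\alpha$ depends on $G_t$ and is assumed to be selected so that the expectation is defined (measurability). $u^*\in\partial\mathcal R(u^\dagger)\subset\mathcal X^*$ means $\mathcal R(u^\dagger)<\infty$ and $\mathcal R(u)\ge\mathcal R(u^\dagger)+\langle u^*,u-u^\dagger\rangle$ for all $u\in\mathcal X$; the Bregman distance is $\mathcal D_{\mathcal R}^{u^*}(u,u^\dagger):=\mathcal R(u)-\mathcal R(u^\dagger)-\langle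 u^*,u-u^\dagger\rangle$. An index function is a (finite) monotonically increasing function $\varphi:[0,\infty)\to[0,\infty)$ with $\varphi(0)=0$. One sets $\varphi(\tau):=-\infty$ for $\tau<0$; $\partial(-\varphi)$ is the convex subdifferential of the convex function $-\varphi$ on $\mathbb R$, and $-\partial(-\varphi)(s)=\{-v: v\in\partial(-\varphi)(s)\}$ (equal to $\{\varphi'(s)\}$ if $\varphi$ is differentiable at $s$).
   Formalization: The points of the Poisson process are additionally required to be almost surely distinct; mean and independence alone also admit compound Poisson processes (e.g. each point repeated about t times), for which the claimed rate fails. *)

theory Defs
  imports "HOL-Probability.Probability" "HOL-Library.Landau_Symbols"
begin

text \<open>Domains. Near each boundary point, and after a rotation of the coordinates, the set is the
  strict subgraph of a Lipschitz function defined on a hyperplane.\<close>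

definition lipschitz_boundary :: "'a::euclidean_space set \<Rightarrow> bool" where
  "lipschitz_boundary M \<longleftrightarrow>
     (\<forall>p\<in>frontier M. \<exists>U e \<gamma> L. open U \<and> p \<in> U \<and> norm e = 1 \<and>
        L-lipschitz_on {y. y \<bullet> e = 0} \<gamma> \<and>
        M \<inter> U = {x \<in> U. x \<bullet> e < \<gamma> (x - (x \<bullet> e) *\<^sub>R e)})"

definition bounded_lipschitz_domain :: "'a::euclidean_space set \<Rightarrow> bool" where
  "bounded_lipschitz_domain M \<longleftrightarrow>
     open M \<and> connected M \<and> M \<noteq> {} \<and> bounded M \<and> lipschitz_boundary M"

text \<open>The Fourier transform on \<open>L\<^sup>2\<close>, in the sense of Plancherel: the \<open>L\<^sup>2\<close>-limit of the Fourier
  integrals over balls of radius \<open>n\<close>. The nonnegative integral keeps the convergence meaningful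
  without any integrability side condition.\<close>

definition truncated_fourier :: "nat \<Rightarrow> ('a::euclidean_space \<Rightarrow> real) \<Rightarrow> 'a \<Rightarrow> complex" where
  "truncated_fourier n f \<xi> =
     of_real ((2 * pi) powr (- real DIM('a) / 2)) *
     (LINT x:cball 0 (real n)|lborel. of_real (f x) * cis (- (x \<bullet> \<xi>)))"

definition square_integrable :: "('a::euclidean_space \<Rightarrow> real) \<Rightarrow> bool" where
  "square_integrable f \<longleftrightarrow>
     f \<in> borel_measurable lborel \<and> integrable lborel (\<lambda>x. (f x)\<^sup>2)"

definition has_fourier_L2 ::
    "('a::euclidean_space \<Rightarrow> real) \<Rightarrow> ('a \<Rightarrow> complex) \<Rightarrow> bool" where
  "has_fourier_L2 f h \<longleftrightarrow>
     h \<in> borel_measurable lborel \<and>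
     (\<lambda>n. \<integral>\<^sup>+\<xi>. ennreal ((cmod (h \<xi> - truncated_fourier n f \<xi>))\<^sup>2) \<partial>lborel) \<longlonglongrightarrow> 0"

text \<open>Determined up to a null set.\<close>

definition fourier_L2 :: "('a::euclidean_space \<Rightarrow> real) \<Rightarrow> 'a \<Rightarrow> complex" where
  "fourier_L2 f = (SOME h. has_fourier_L2 f h)"

text \<open>The Sobolev (Bessel potential) space \<open>H\<^sup>s(\<real>\<^sup>d)\<close>, \<open>s \<ge> 0\<close>, as a space of real functions; the
  elements are Borel representatives. By Plancherel's theorem the condition that
  \<open>f\<close> have a Fourier transform is automatic.\<close>

definition sobolev :: "real \<Rightarrow> ('a::euclidean_space \<Rightarrow> real) set" where
  "sobolev s = {f. square_integrable f \<and> (\<exists>h. has_fourier_L2 f h) \<and>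
     integrable lborel (\<lambda>\<xi>. (1 + (norm \<xi>)\<^sup>2) powr s * (cmod (fourier_L2 f \<xi>))\<^sup>2)}"

definition sobolev_norm :: "real \<Rightarrow> ('a::euclidean_space \<Rightarrow> real) \<Rightarrow> real" where
  "sobolev_norm s f =
     sqrt (LINT \<xi>|lborel. (1 + (norm \<xi>)\<^sup>2) powr s * (cmod (fourier_L2 f \<xi>))\<^sup>2)"

text \<open>\<open>H\<^sup>s(M)\<close> consists of the restrictions to \<open>M\<close> of elements of \<open>H\<^sup>s(\<real>\<^sup>d)\<close>, with the quotient
  norm. On bounded Lipschitz domains this agrees, up to equivalence of norms, with the
  intrinsic (Sobolev-Slobodeckij) definition.\<close>

definition sobolev_extensions ::
    "real \<Rightarrow> 'a::euclidean_space set \<Rightarrow> ('a \<Rightarrow> real) \<Rightarrow> ('a \<Rightarrow> real) set" where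
  "sobolev_extensions s M g = {f \<in> sobolev s. AE x in lborel. x \<in> M \<longrightarrow> f x = g x}"

definition sobolev_on :: "real \<Rightarrow> 'a::euclidean_space set \<Rightarrow> ('a \<Rightarrow> real) set" where
  "sobolev_on s M = {g. sobolev_extensions s M g \<noteq> {}}"

definition sobolev_on_norm ::
    "real \<Rightarrow> 'a::euclidean_space set \<Rightarrow> ('a \<Rightarrow> real) \<Rightarrow> real" where
  "sobolev_on_norm s M g = (INF f\<in>sobolev_extensions s M g. sobolev_norm s f)"

definition sobolev_on_bounded ::
    "real \<Rightarrow> 'a::euclidean_space set \<Rightarrow> ('a \<Rightarrow> real) set \<Rightarrow> bool" where
  "sobolev_on_bounded s M \<G> \<longleftrightarrow>
     \<G> \<subseteq> sobolev_on s M \<and> (\<exists>K. \<forall>g\<in>\<G>. sobolev_on_norm s M g \<le> K)"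

text \<open>A finite sum of point masses \<open>\<delta>\<^bsub>x\<^esub>\<close> is represented by the multiset of its points \<open>x\<close>.\<close>

definition points_in :: "'a multiset \<Rightarrow> 'a set \<Rightarrow> nat" where
  "points_in X A = size (filter_mset (\<lambda>x. x \<in> A) X)"

text \<open>The points of a Poisson process are almost surely distinct. Without this condition the mean
  and independence conditions would also admit compound Poisson processes, such as one in
  which every point is counted twice.\<close>

definition poisson_process ::
    "'w measure \<Rightarrow> 'a::euclidean_space set \<Rightarrow> ('a \<Rightarrow> real) \<Rightarrow> ('w \<Rightarrow> 'a multiset) \<Rightarrow> bool" where
  "poisson_process P M h G \<longleftrightarrow>
     prob_space P \<and>
     set_integrable lborel M h \<and> (AE x in lborel. x \<in> M \<longrightarrow> 0 \<le> h x) \<and>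
     (\<forall>\<omega>\<in>space P. set_mset (G \<omega>) \<subseteq> M) \<and>
     (AE \<omega> in P. \<forall>x. count (G \<omega>) x \<le> 1) \<and>
     (\<forall>A\<in>sets borel. A \<subseteq> M \<longrightarrow>
        (\<lambda>\<omega>. points_in (G \<omega>) A) \<in> measurable P (count_space UNIV) \<and>
        integrable P (\<lambda>\<omega>. real (points_in (G \<omega>) A)) \<and>
        (LINT \<omega>|P. real (points_in (G \<omega>) A)) = (LINT x:A|lborel. h x)) \<and>
     (\<forall>\<A>. finite \<A> \<longrightarrow> \<A> \<subseteq> {A \<in> sets borel. A \<subseteq> M} \<longrightarrow> disjoint \<A> \<longrightarrow>
        prob_space.indep_vars P (\<lambda>_. count_space UNIV) (\<lambda>A \<omega>. points_in (G \<omega>) A) \<A>)"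

text \<open>Integration against \<open>G\<^sub>t = (1/t) \<Sum>\<^sub>i \<delta>\<^bsub>x\<^sub>i\<^esub>\<close>, where \<open>X\<close> collects the points \<open>x\<^sub>i\<close>.\<close>

definition scaled_integral :: "real \<Rightarrow> 'a multiset \<Rightarrow> ('a \<Rightarrow> real) \<Rightarrow> real" where
  "scaled_integral t X \<psi> = (1 / t) * (\<Sum>x\<in>#X. \<psi> x)"

definition data_misfit ::
    "'a::euclidean_space set \<Rightarrow> real \<Rightarrow> real \<Rightarrow> 'a multiset \<Rightarrow> ('a \<Rightarrow> real) \<Rightarrow> real" where
  "data_misfit M \<sigma> t X g =
     (LINT x:M|lborel. g x) -
     (scaled_integral t X (\<lambda>x. ln (g x + \<sigma>)) + \<sigma> * (LINT x:M|lborel. ln (g x + \<sigma>)))"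

definition KL_misfit ::
    "'a::euclidean_space set \<Rightarrow> real \<Rightarrow> ('a \<Rightarrow> real) \<Rightarrow> ('a \<Rightarrow> real) \<Rightarrow> real" where
  "KL_misfit M \<sigma> gd g =
     (LINT x:M|lborel. g x - gd x - (gd x + \<sigma>) * ln ((g x + \<sigma>) / (gd x + \<sigma>)))"

definition proper_functional :: "('x \<Rightarrow> ereal) \<Rightarrow> bool" where
  "proper_functional R \<longleftrightarrow> (\<forall>u. R u \<noteq> -\<infinity>) \<and> (\<exists>u. R u \<noteq> \<infinity>)"

definition convex_functional :: "('x::real_vector \<Rightarrow> ereal) \<Rightarrow> bool" where
  "convex_functional R \<longleftrightarrow>
     (\<forall>u v. \<forall>c\<in>{0..1::real}.
        R ((1 - c) *\<^sub>R u + c *\<^sub>R v) \<le> ereal (1 - c) * R u + ereal c * R v)"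

definition subdifferential ::
    "('x::real_normed_vector \<Rightarrow> ereal) \<Rightarrow> 'x \<Rightarrow> ('x \<Rightarrow>\<^sub>L real) set" where
  "subdifferential R u =
     {v. R u < \<infinity> \<and> (\<forall>w. R u + ereal (blinfun_apply v (w - u)) \<le> R w)}"

definition bregman_dist ::
    "('x::real_normed_vector \<Rightarrow> ereal) \<Rightarrow> ('x \<Rightarrow>\<^sub>L real) \<Rightarrow> 'x \<Rightarrow> 'x \<Rightarrow> ereal" where
  "bregman_dist R v w u = R w - R u - ereal (blinfun_apply v (w - u))"

definition index_function :: "(real \<Rightarrow> real) \<Rightarrow> bool" where
  "index_function \<phi> \<longleftrightarrow> \<phi> 0 = 0 \<and> mono_on {0..} \<phi>"

text \<open>Only the values of an index function on \<open>[0,\<infinity>)\<close> are relevant; the others are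
  replaced by \<open>-\<infinity>\<close>.\<close>

definition extended_index :: "(real \<Rightarrow> real) \<Rightarrow> real \<Rightarrow> ereal" where
  "extended_index \<phi> \<tau> = (if \<tau> < 0 then -\<infinity> else ereal (\<phi> \<tau>))"

definition real_subdifferential :: "(real \<Rightarrow> ereal) \<Rightarrow> real \<Rightarrow> real set" where
  "real_subdifferential f s = {v. f s < \<infinity> \<and> (\<forall>\<tau>. f s + ereal (v * (\<tau> - s)) \<le> f \<tau>)}"

definition is_tikhonov_minimizer ::
    "'a::euclidean_space set \<Rightarrow> real \<Rightarrow> ('x \<Rightarrow> 'a \<Rightarrow> real) \<Rightarrow> ('x \<Rightarrow> ereal) \<Rightarrow> 'x set \<Rightarrow>
     real \<Rightarrow> 'a multiset \<Rightarrow> real \<Rightarrow> 'x \<Rightarrow> bool" where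
  "is_tikhonov_minimizer M \<sigma> F R B t X \<alpha> u \<longleftrightarrow>
     u \<in> B \<and>
     (\<forall>v\<in>B. ereal (data_misfit M \<sigma> t X (F u)) + ereal \<alpha> * R u
           \<le> ereal (data_misfit M \<sigma> t X (F v)) + ereal \<alpha> * R v)"

text \<open>The expectation of a nonnegative extended random variable.\<close>

definition expected_value :: "'w measure \<Rightarrow> ('w \<Rightarrow> ereal) \<Rightarrow> ennreal" where
  "expected_value P X = (\<integral>\<^sup>+\<omega>. e2ennreal (X \<omega>) \<partial>P)"

end

theory Submission
  imports Defs
begin

text \<open>Comparing \<open>u\<^sub>\<alpha>\<close> with \<open>u\<^sup>\<dagger>\<close> in the Tikhonov functional, and using the source condition together with
  the subgradient inequality for \<open>-\<phi>\<close> at \<open>s = 1 / sqrt t\<close>, gives the pathwise bound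
  \<open>\<beta> D \<le> \<phi>(s) (1 + sqrt t U\<^sub>t)\<close>, where \<open>U\<^sub>t\<close> is the supremum over \<open>v \<in> B\<close> of
  \<open>\<integral> ln ((F(v) + \<sigma>) / (g\<^sup>\<dagger> + \<sigma>)) (dG\<^sub>t - g\<^sup>\<dagger> dx)\<close>. It remains to show \<open>E U\<^sub>t = O(1 / sqrt t)\<close>.

  Instead of a Sobolev bound for the nonlinear functions \<open>ln (F(v) + \<sigma>)\<close>, this uses random signs:
  on a fine partition the process becomes a vector of independent counts, symmetrization makes its
  coordinates random signs, and contraction removes the logarithm. The
  remaining linear process is controlled by the kernel of \<open>H\<^sup>s\<close>, which is finite on the diagonal
  because \<open>s > d/2\<close>; averaging over the signs leaves the root of the sum of squared counts. When the
  partition is refined this tends to the root of the number of points, whose mean is \<open>O(sqrt t)\<close>.\<close>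

section \<open>Gaussian kernels and the Fourier transform\<close>


text \<open>A supremum over the uncountable set \<open>B\<close> of random variables need not be
  measurable, and a sum over the points of a multiset has no fixed coordinates to symmetrize. Both
  obstacles disappear on a finite partition: the cell counts are independent integers, so every
  function of them is measurable, and the logarithm acts on one cell at a time, as contraction
  demands. The price is a discretization error, which can be removed only if all
  \<open>\<psi> v\<close> share a modulus of continuity; this comes from continuity at
  \<open>0\<close> of the same kernel that controls the linear process. The bound for a partition
  involves the kernel only through its value at \<open>0\<close>, so it does not deteriorate as the
  cells shrink, and the limit can be taken for fixed \<open>t\<close>. Coarse cells would not do: a
  count with mean of order t has a square with mean at least of order t^2, while in the limit every
  count is 0 or 1. The kernel estimate concerns point values, whereas the Fourier transform is given
  only as an L2 limit; smoothing by a Gaussian links the two before its width tends to 0.\<close>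

lemma
  fixes f :: "'a::euclidean_space \<Rightarrow> real \<Rightarrow> 'b::{real_normed_field,banach,second_countable_topology}"
  assumes f: "\<And>b. b \<in> Basis \<Longrightarrow> integrable lborel (f b)"
  shows integrable_lborel_prod: "integrable lborel (\<lambda>x. \<Prod>b\<in>Basis. f b (x \<bullet> b))"
    and integral_lborel_prod:
      "(LINT x|lborel. (\<Prod>b\<in>Basis. f b (x \<bullet> b))) = (\<Prod>b\<in>Basis. LINT t|lborel. f b t)"
proof -
  interpret product_sigma_finite "\<lambda>_::'a. lborel :: real measure" by standard
  have meas[measurable]: "f b \<in> borel_measurable borel" if "b \<in> Basis" for b
    using borel_measurable_integrable[OF f[OF that]] by simp
  have T[measurable]: "(\<lambda>g. \<Sum>b\<in>Basis. g b *\<^sub>R b) \<in> (\<Pi>\<^sub>M b\<in>Basis. lborel) \<rightarrow>\<^sub>M (borel :: 'a measure)"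
    by measurable
  have P[measurable]: "(\<lambda>x. \<Prod>b\<in>Basis. f b (x \<bullet> b)) \<in> borel_measurable (borel :: 'a measure)"
    by measurable
  have comp: "(\<Prod>b\<in>Basis. f b ((\<Sum>c\<in>Basis. g c *\<^sub>R c) \<bullet> b)) = (\<Prod>b\<in>Basis. f b (g b))" for g
    by (intro prod.cong) auto
  show "integrable lborel (\<lambda>x. \<Prod>b\<in>Basis. f b (x \<bullet> b))"
    unfolding lborel_eq[where 'a='a]
    by (subst integrable_distr_eq[OF T P]) (simp add: comp product_integrable_prod f)
  show "(LINT x|lborel. (\<Prod>b\<in>Basis. f b (x \<bullet> b))) = (\<Prod>b\<in>Basis. LINT t|lborel. f b t)"
    unfolding lborel_eq[where 'a='a]
    by (subst integral_distr[OF T P]) (simp add: comp product_integral_prod f)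
qed

lemma integral_cis_std_normal_density:
  "(LINT x|lborel. cis (t * x) * of_real (std_normal_density x)) = of_real (exp (- t\<^sup>2 / 2))"
proof -
  have "(LINT x|lborel. cis (t * x) * of_real (std_normal_density x)) =
      (LINT x|std_normal_distribution. cis (t * x))"
    by (subst integral_density) (auto simp: scaleR_conv_of_real mult.commute cis_conv_exp)
  also have "\<dots> = char std_normal_distribution t"
    unfolding char_def by (simp add: cis_conv_exp)
  finally show ?thesis
    by (simp add: char_std_normal_distribution)
qed

lemma integral_cis_gaussian_real:
  assumes "\<delta> > 0"
  shows "integrable lborel (\<lambda>x. cis (z * x) * of_real (exp (- (\<delta> * x)\<^sup>2 / 2)))" (is ?I)
    and "(LINT x|lborel. cis (z * x) * of_real (exp (- (\<delta> * x)\<^sup>2 / 2))) =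
      of_real (2 * pi * normal_density 0 \<delta> z)" (is ?E)
proof -
  \<comment> \<open>With \<delta> x as the variable the Gaussian becomes the standard normal
    density, so the integral is its characteristic function at \<open>z / \<delta>\<close>, up to
    the factor sqrt (2 pi) / \<delta>.\<close>
  have eq: "cis (z * x) * of_real (exp (- (\<delta> * x)\<^sup>2 / 2)) =
     of_real (sqrt (2 * pi)) * (cis (z / \<delta> * (\<delta> * x)) * of_real (std_normal_density (\<delta> * x)))" for x
    using assms by (simp add: std_normal_density_def)
  have int: "integrable lborel (\<lambda>x. cis (z / \<delta> * x) * complex_of_real (std_normal_density x))"
    by (rule Bochner_Integration.integrable_bound[OF integrable_normal_density[of 1 0]])
       (auto simp: norm_mult cis_conv_exp)
  have int2: "integrable lborel (\<lambda>x. cis (z / \<delta> * (\<delta> * x)) * complex_of_real (std_normal_density (\<delta> * x)))"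
    using lborel_integrable_real_affine[OF int, of \<delta> 0] assms by simp
  show ?I unfolding eq by (intro integrable_mult_right int2)
  have "(LINT x|lborel. cis (z / \<delta> * x) * complex_of_real (std_normal_density x))
     = \<bar>\<delta>\<bar> *\<^sub>R (LINT x|lborel. cis (z / \<delta> * (\<delta> * x)) * complex_of_real (std_normal_density (\<delta> * x)))"
    using lborel_integral_real_affine[of \<delta> "\<lambda>x. cis (z / \<delta> * x) * complex_of_real (std_normal_density x)" 0]
      assms by simp
  then have *: "of_real (exp (- (z / \<delta>)\<^sup>2 / 2)) =
     of_real \<delta> * (LINT x|lborel. cis (z / \<delta> * (\<delta> * x)) * complex_of_real (std_normal_density (\<delta> * x)))"
    using assms by (simp only: integral_cis_std_normal_density) (simp add: scaleR_conv_of_real)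
  have "(LINT x|lborel. cis (z * x) * of_real (exp (- (\<delta> * x)\<^sup>2 / 2))) =
     of_real (sqrt (2 * pi)) * (LINT x|lborel. cis (z / \<delta> * (\<delta> * x)) * complex_of_real (std_normal_density (\<delta> * x)))"
    unfolding eq by (rule integral_mult_right_zero)
  also have "\<dots> = of_real (sqrt (2 * pi) / \<delta>) * of_real (exp (- (z / \<delta>)\<^sup>2 / 2))"
    by (subst *) (use assms in simp)
  also have "\<dots> = of_real (2 * pi * normal_density 0 \<delta> z)"
  proof -
    have "sqrt (2 * pi) / \<delta> * exp (- (z / \<delta>)\<^sup>2 / 2) = 2 * pi * normal_density 0 \<delta> z"
      using assms real_sqrt_mult_self[of "2 * pi"]
      by (simp add: normal_density_def real_sqrt_mult power_divide field_simps)
    then show ?thesis by (metis of_real_mult)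
  qed
  finally show ?E .
qed

text \<open>The density of d independent centred normal variables with standard deviation
  \<open>\<delta>\<close>. The product form lets Fubini reduce its integrals to dimension one; the
  estimates use the radial form \<open>gauss_kernel_eq\<close>.\<close>

definition gauss_kernel :: "real \<Rightarrow> 'a::euclidean_space \<Rightarrow> real" where
  "gauss_kernel \<delta> x = (\<Prod>b\<in>Basis. normal_density 0 \<delta> (x \<bullet> b))"

lemma gauss_kernel_eq:
  assumes "\<delta> > 0"
  shows "gauss_kernel \<delta> (x::'a::euclidean_space) =
    (1 / sqrt (2 * pi * \<delta>\<^sup>2)) ^ DIM('a) * exp (- (norm x)\<^sup>2 / (2 * \<delta>\<^sup>2))"
proof -
  have "(\<Prod>b\<in>Basis. exp (- (x \<bullet> b)\<^sup>2 / (2 * \<delta>\<^sup>2))) = exp (\<Sum>b\<in>Basis. - (x \<bullet> b)\<^sup>2 / (2 * \<delta>\<^sup>2))"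
    by (simp add: exp_sum)
  also have "(\<Sum>b\<in>Basis. - (x \<bullet> b)\<^sup>2 / (2 * \<delta>\<^sup>2)) = - (norm x)\<^sup>2 / (2 * \<delta>\<^sup>2)"
    by (simp add: power2_norm_eq_inner euclidean_inner[of x x] sum_negf sum_divide_distrib
      flip: power2_eq_square)
  finally show ?thesis
    by (simp add: gauss_kernel_def normal_density_def prod.distrib prod_dividef power_one_over)
qed

lemma
  assumes "\<delta> > 0"
  shows gauss_kernel_integrable: "integrable lborel (gauss_kernel \<delta> :: 'a::euclidean_space \<Rightarrow> real)"
    and gauss_kernel_integral: "(LINT x|lborel. gauss_kernel \<delta> (x::'a)) = 1"
    and gauss_kernel_nonneg: "gauss_kernel \<delta> (x::'a) \<ge> 0"
  using integrable_lborel_prod[where 'a='a and f="\<lambda>_. normal_density 0 \<delta>"]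
    integral_lborel_prod[where 'a='a and f="\<lambda>_. normal_density 0 \<delta>"] assms
  by (auto simp: gauss_kernel_def[abs_def] intro!: prod_nonneg)

lemma gauss_kernel_measurable[measurable]: "gauss_kernel \<delta> \<in> borel_measurable borel"
  unfolding gauss_kernel_def[abs_def] by measurable

lemma cis_sum: "finite A \<Longrightarrow> cis (\<Sum>x\<in>A. f x) = (\<Prod>x\<in>A. cis (f x))"
  by (induction A rule: finite_induct) (auto simp: cis_mult[symmetric])

lemma
  fixes z :: "'a::euclidean_space"
  assumes "\<delta> > 0"
  shows integrable_cis_gaussian:
      "integrable lborel (\<lambda>\<xi>. cis (z \<bullet> \<xi>) * of_real (exp (- (\<delta> * norm \<xi>)\<^sup>2 / 2)))"
    and integral_cis_gaussian:
      "(LINT \<xi>|lborel. cis (z \<bullet> \<xi>) * of_real (exp (- (\<delta> * norm \<xi>)\<^sup>2 / 2))) =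
        of_real ((2 * pi) ^ DIM('a) * gauss_kernel \<delta> z)"
proof -
  have eq: "cis (z \<bullet> \<xi>) * of_real (exp (- (\<delta> * norm \<xi>)\<^sup>2 / 2)) =
     (\<Prod>b\<in>Basis. cis (z \<bullet> b * (\<xi> \<bullet> b)) * of_real (exp (- (\<delta> * (\<xi> \<bullet> b))\<^sup>2 / 2)))" for \<xi> :: 'a
  proof -
    have "(\<Prod>b\<in>Basis. exp (- (\<delta> * (\<xi> \<bullet> b))\<^sup>2 / 2)) = exp (\<Sum>b\<in>Basis. - (\<delta> * (\<xi> \<bullet> b))\<^sup>2 / 2)"
      by (simp add: exp_sum)
    also have "(\<Sum>b\<in>Basis. - (\<delta> * (\<xi> \<bullet> b))\<^sup>2 / 2) = - (\<delta> * norm \<xi>)\<^sup>2 / 2"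
      by (simp add: power_mult_distrib power2_norm_eq_inner euclidean_inner[of \<xi> \<xi>] sum_negf
        sum_divide_distrib sum_distrib_left flip: power2_eq_square)
    finally show ?thesis
      by (simp add: prod.distrib euclidean_inner[of z \<xi>] cis_sum flip: of_real_prod)
  qed
  show "integrable lborel (\<lambda>\<xi>. cis (z \<bullet> \<xi>) * of_real (exp (- (\<delta> * norm \<xi>)\<^sup>2 / 2)))"
    unfolding eq by (intro integrable_lborel_prod integral_cis_gaussian_real assms)
  show "(LINT \<xi>|lborel. cis (z \<bullet> \<xi>) * of_real (exp (- (\<delta> * norm \<xi>)\<^sup>2 / 2))) =
        of_real ((2 * pi) ^ DIM('a) * gauss_kernel \<delta> z)"
    unfolding eq
    by (subst integral_lborel_prod[OF integral_cis_gaussian_real(1)[OF assms]])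
       (simp only: integral_cis_gaussian_real(2)[OF assms],
        simp add: gauss_kernel_def prod.distrib power_mult_distrib)
qed

section \<open>Integrability of the Sobolev weight\<close>

lemma integrable_one_plus_square_powr:
  assumes "p > 1 / 2"
  shows "integrable lborel (\<lambda>x::real. (1 + x\<^sup>2) powr - p)"
proof -
  have 1: "((\<lambda>x. x powr (- 2 * p)) has_integral -(1 powr (- 2 * p + 1)) / (- 2 * p + 1)) {1..}"
    by (rule has_integral_powr_to_inf) (use assms in auto)
  have "(\<lambda>x::real. x powr (- 2 * p)) absolutely_integrable_on {1..}"
    using 1 by (intro nonnegative_absolutely_integrable_1) (auto simp: integrable_on_def)
  then have "integrable lborel (\<lambda>x::real. indicator {1..} x *\<^sub>R x powr (- 2 * p))"
    unfolding set_integrable_def by (subst (asm) integrable_completion) auto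
  then have R: "integrable lborel (\<lambda>x::real. indicator {1..} x * x powr (- 2 * p))" by simp
  have L: "integrable lborel (\<lambda>x::real. indicator {1..} (-x) * (-x) powr (- 2 * p))"
    using lborel_integrable_real_affine[OF R, of "-1" 0] by simp
  have C: "integrable lborel (\<lambda>x::real. indicator {-1..1} x :: real)"
    by (auto intro!: integrable_real_indicator)
  show ?thesis
  proof (rule Bochner_Integration.integrable_bound[OF Bochner_Integration.integrable_add[OF C
      Bochner_Integration.integrable_add[OF L R]]])
    show "AE x in lborel. norm ((1 + x\<^sup>2) powr - p) \<le> norm (indicator {-1..1} x +
      (indicator {1..} (-x) * (-x) powr (- 2 * p) + indicator {1..} x * x powr (- 2 * p)))"
    proof (intro AE_I2)
      fix x :: real
      have *: "(1 + y\<^sup>2) powr - p \<le> y powr (- 2 * p)" if "y \<ge> 1" for y :: real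
      proof -
        have "(1 + y\<^sup>2) powr - p \<le> (y\<^sup>2) powr - p"
          using that assms by (intro powr_mono2') auto
        also have "\<dots> = y powr (- 2 * p)"
          using that by (simp add: powr_powr flip: powr_numeral)
        finally show ?thesis .
      qed
      have "(1 + x\<^sup>2) powr - p \<le> 1"
        using powr_mono2'[of "-p" 1 "1 + x\<^sup>2"] assms by simp
      then show "norm ((1 + x\<^sup>2) powr - p) \<le> norm (indicator {-1..1} x +
      (indicator {1..} (-x) * (-x) powr (- 2 * p) + indicator {1..} x * x powr (- 2 * p)))"
        using *[of x] *[of "-x"] by (auto simp: indicator_def)
    qed
  qed auto
qed

text \<open>No coordinate of \<xi> exceeds its norm, so the radial weight is at most the product of
  d one-dimensional weights with exponent s / d, and Fubini takes the place of polar coordinates.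
  The condition s > d/2 says exactly that s / d > 1/2.\<close>

lemma integrable_bessel_weight:
  assumes "s > real DIM('a) / 2"
  shows "integrable lborel (\<lambda>\<xi>::'a::euclidean_space. (1 + (norm \<xi>)\<^sup>2) powr - s)"
proof -
  let ?d = "real DIM('a)"
  have d: "?d > 0" by simp
  have "integrable lborel (\<lambda>\<xi>::'a. \<Prod>b\<in>Basis. (1 + (\<xi> \<bullet> b)\<^sup>2) powr - (s / ?d))"
    using assms d by (intro integrable_lborel_prod integrable_one_plus_square_powr) (simp add: field_simps)
  then show ?thesis
  proof (rule Bochner_Integration.integrable_bound)
    show "AE \<xi>::'a in lborel. norm ((1 + (norm \<xi>)\<^sup>2) powr - s)
      \<le> norm (\<Prod>b\<in>Basis. (1 + (\<xi> \<bullet> b)\<^sup>2) powr - (s / ?d))"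
    proof (intro AE_I2)
      fix \<xi> :: 'a
      have "(1 + (norm \<xi>)\<^sup>2) powr - (s / ?d) \<le> (1 + (\<xi> \<bullet> b)\<^sup>2) powr - (s / ?d)" if "b \<in> Basis" for b
      proof (rule powr_mono2')
        have "\<bar>\<xi> \<bullet> b\<bar> \<le> norm \<xi>" using that by (rule Basis_le_norm)
        then show "1 + (\<xi> \<bullet> b)\<^sup>2 \<le> 1 + (norm \<xi>)\<^sup>2" using abs_le_square_iff[of "\<xi> \<bullet> b" "norm \<xi>"] by simp
        show "- (s / ?d) \<le> 0" using assms d by (auto simp: field_simps)
      qed (simp add: add_pos_nonneg)
      then have "(\<Prod>b\<in>(Basis::'a set). (1 + (norm \<xi>)\<^sup>2) powr - (s / ?d))
          \<le> (\<Prod>b\<in>Basis. (1 + (\<xi> \<bullet> b)\<^sup>2) powr - (s / ?d))"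
        by (intro prod_mono) auto
      moreover have "(\<Prod>b\<in>(Basis::'a set). (1 + (norm \<xi>)\<^sup>2) powr - (s / ?d)) = (1 + (norm \<xi>)\<^sup>2) powr - s"
      proof -
        have "1 + (norm \<xi>)\<^sup>2 > 0" by (simp add: add_pos_nonneg)
        then show ?thesis using d by (simp add: powr_powr flip: powr_realpow)
      qed
      moreover have "0 \<le> (\<Prod>b\<in>Basis. (1 + (\<xi> \<bullet> b)\<^sup>2) powr - (s / ?d))" by (intro prod_nonneg) auto
      ultimately show "norm ((1 + (norm \<xi>)\<^sup>2) powr - s)
        \<le> norm (\<Prod>b\<in>Basis. (1 + (\<xi> \<bullet> b)\<^sup>2) powr - (s / ?d))" by simp
    qed
  qed measurable
qed

section \<open>Square integrable functions against Gaussians\<close>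

lemma cis_measurable[measurable]: "cis \<in> borel_measurable borel"
  by (intro borel_measurable_continuous_onI continuous_on_cis continuous_on_id)

lemma gauss_kernel_uminus: "gauss_kernel \<delta> (- x) = gauss_kernel \<delta> x"
  by (simp add: gauss_kernel_def normal_density_def)

lemma integrable_lborel_translate:
  fixes f :: "'a::euclidean_space \<Rightarrow> 'b::{banach,second_countable_topology}"
  assumes "integrable lborel f"
  shows "integrable lborel (\<lambda>x. f (x - y))"
proof -
  have "integrable (distr lborel borel ((+) (- y))) f"
    using assms by (simp add: lborel_distr_plus)
  then have "integrable lborel (\<lambda>x. f (- y + x))"
    by (rule integrable_distr[rotated]) simp
  then show ?thesis by simp
qed

lemma integral_lborel_translate:
  fixes f :: "'a::euclidean_space \<Rightarrow> 'b::{banach,second_countable_topology}"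
  assumes [measurable]: "f \<in> borel_measurable borel"
  shows "(LINT x|lborel. f (x - y)) = (LINT x|lborel. f x)"
proof -
  have "(LINT x|lborel. f x) = (LINT x|distr lborel borel ((+) (- y)). f x)"
    by (simp add: lborel_distr_plus)
  also have "\<dots> = (LINT x|lborel. f (- y + x))"
    by (rule integral_distr) auto
  finally show ?thesis by simp
qed

lemma integrable_mult_of_square_integrable:
  fixes f g :: "'a \<Rightarrow> 'b::{real_normed_field,banach,second_countable_topology}"
  assumes [measurable]: "f \<in> borel_measurable M" "g \<in> borel_measurable M"
    and "integrable M (\<lambda>x. (norm (f x))\<^sup>2)" "integrable M (\<lambda>x. (norm (g x))\<^sup>2)"
  shows "integrable M (\<lambda>x. f x * g x)"
proof (rule Bochner_Integration.integrable_bound[OF Bochner_Integration.integrable_add[OF assms(3,4)]])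
  show "AE x in M. norm (f x * g x) \<le> norm ((norm (f x))\<^sup>2 + (norm (g x))\<^sup>2)"
  proof (intro AE_I2)
    fix x
    have "2 * (norm (f x) * norm (g x)) \<le> (norm (f x))\<^sup>2 + (norm (g x))\<^sup>2"
      using sum_squares_bound[of "norm (f x)" "norm (g x)"] by simp
    moreover have "0 \<le> norm (f x) * norm (g x)" by simp
    ultimately have "norm (f x) * norm (g x) \<le> (norm (f x))\<^sup>2 + (norm (g x))\<^sup>2" by linarith
    then show "norm (f x * g x) \<le> norm ((norm (f x))\<^sup>2 + (norm (g x))\<^sup>2)"
      by (simp add: norm_mult)
  qed
qed measurable

lemma gauss_kernel_le:
  assumes "\<delta> > 0"
  shows "gauss_kernel \<delta> (x::'a::euclidean_space) \<le> (1 / sqrt (2 * pi * \<delta>\<^sup>2)) ^ DIM('a)"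
  unfolding gauss_kernel_eq[OF assms] using assms by (intro mult_left_le) auto

lemma gauss_kernel_square_integrable:
  assumes "\<delta> > 0"
  shows "integrable lborel (\<lambda>x::'a::euclidean_space. (gauss_kernel \<delta> x)\<^sup>2)"
proof (rule Bochner_Integration.integrable_bound)
  show "integrable lborel (\<lambda>x::'a. (1 / sqrt (2 * pi * \<delta>\<^sup>2)) ^ DIM('a) * gauss_kernel \<delta> x)"
    by (intro integrable_mult_right gauss_kernel_integrable assms)
  show "AE x::'a in lborel. norm ((gauss_kernel \<delta> x)\<^sup>2)
      \<le> norm ((1 / sqrt (2 * pi * \<delta>\<^sup>2)) ^ DIM('a) * gauss_kernel \<delta> x)"
    using gauss_kernel_le[OF assms, where 'a='a] gauss_kernel_nonneg[OF assms, where 'a='a]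
    by (intro AE_I2) (auto simp: power2_eq_square abs_mult intro!: mult_right_mono)
qed measurable

lemma
  fixes f :: "'a::euclidean_space \<Rightarrow> real"
  assumes f: "square_integrable f" and \<delta>: "\<delta> > 0"
  shows integrable_mult_gauss_kernel: "integrable lborel (\<lambda>x. f x * gauss_kernel \<delta> (x - y))"
proof (rule integrable_mult_of_square_integrable)
  show "integrable lborel (\<lambda>x. (norm (gauss_kernel \<delta> (x - y)))\<^sup>2)"
    using integrable_lborel_translate[OF gauss_kernel_square_integrable[OF \<delta>], of y] by simp
qed (use f in \<open>auto simp: square_integrable_def\<close>)

text \<open>Pairing the transform with a modulated Gaussian undoes it up to a convolution. This replaces
  the inversion formula, and works directly with the \<open>L\<^sup>2\<close>-limit defining the transform.\<close>

lemma
  fixes f :: "'a::euclidean_space \<Rightarrow> real" and y :: 'a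
  assumes f: "square_integrable f" and h: "has_fourier_L2 f h"
    and h2: "integrable lborel (\<lambda>\<xi>. (cmod (h \<xi>))\<^sup>2)" and \<delta>: "\<delta> > 0"
  defines "\<Phi> \<equiv> \<lambda>\<xi>. cis (y \<bullet> \<xi>) * complex_of_real (exp (- (\<delta> * norm \<xi>)\<^sup>2 / 2))"
  shows fourier_L2_gauss_integrable: "integrable lborel (\<lambda>\<xi>. h \<xi> * \<Phi> \<xi>)"
    and fourier_L2_gauss: "(LINT \<xi>|lborel. h \<xi> * \<Phi> \<xi>) =
      of_real ((2 * pi) powr (real DIM('a) / 2) * (LINT x|lborel. f x * gauss_kernel \<delta> (x - y)))"
proof -
  let ?E = "\<lambda>\<xi>::'a. exp (- (\<delta> * norm \<xi>)\<^sup>2 / 2)"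
  define c where "c = (2 * pi) powr (- real DIM('a) / 2)"
  have c: "c \<ge> 0" by (simp add: c_def)
  have [measurable]: "f \<in> borel_measurable borel" "h \<in> borel_measurable borel"
    using f h by (auto simp: square_integrable_def has_fourier_L2_def)
  have f2: "integrable lborel (\<lambda>x. (f x)\<^sup>2)" using f by (simp add: square_integrable_def)
  have \<Phi>m[measurable]: "\<Phi> \<in> borel_measurable borel" unfolding \<Phi>_def by measurable
  have n\<Phi>: "cmod (\<Phi> \<xi>) = ?E \<xi>" for \<xi> by (simp add: \<Phi>_def norm_mult)
  have \<Phi>i: "integrable lborel \<Phi>" unfolding \<Phi>_def by (rule integrable_cis_gaussian[OF \<delta>])
  have Ei: "integrable lborel ?E" using integrable_norm[OF \<Phi>i] by (simp add: n\<Phi>)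
  have \<Phi>2: "integrable lborel (\<lambda>\<xi>. (cmod (\<Phi> \<xi>))\<^sup>2)"
  proof (rule Bochner_Integration.integrable_bound[OF Ei])
    show "AE \<xi> in lborel. norm ((cmod (\<Phi> \<xi>))\<^sup>2) \<le> norm (?E \<xi>)"
      by (intro AE_I2) (auto simp: n\<Phi> power2_eq_square intro!: mult_left_le)
  qed measurable
  show hi: "integrable lborel (\<lambda>\<xi>. h \<xi> * \<Phi> \<xi>)"
    by (rule integrable_mult_of_square_integrable) (auto simp: h2 \<Phi>2)
  \<comment> \<open>\<open>f\<close> is only square integrable; the cut-off to a ball makes it
    integrable, so that the oscillatory integral converges absolutely and Fubini applies.\<close>
  define fn where "fn n = (\<lambda>x. indicator (cball 0 (real n)) x * f x)" for n
  have [measurable]: "cball (0::'a) (real n) \<in> sets borel" for n by simp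
  have fnm[measurable]: "fn n \<in> borel_measurable borel" for n unfolding fn_def by measurable
  have fni: "integrable lborel (fn n)" for n
    unfolding fn_def
  proof (rule integrable_mult_of_square_integrable)
    show "integrable lborel (\<lambda>x::'a. (norm (indicator (cball 0 (real n)) x :: real))\<^sup>2)"
      using emeasure_lborel_cball_finite[of 0 "real n"]
      by (simp add: power2_eq_square integrable_indicator_iff flip: indicator_inter_arith)
    show "integrable lborel (\<lambda>x. (norm (f x))\<^sup>2)" using f2 by simp
  qed measurable
  have trunc: "truncated_fourier n f \<xi> = of_real c * (LINT x|lborel. of_real (fn n x) * cis (- (x \<bullet> \<xi>)))" for n \<xi>
    unfolding truncated_fourier_def set_lebesgue_integral_def c_def fn_def
    by (simp add: scaleR_conv_of_real mult.assoc)
  have Fm[measurable]: "truncated_fourier n f \<in> borel_measurable borel" for n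
    unfolding trunc[abs_def] by measurable
  have Fb: "cmod (truncated_fourier n f \<xi>) \<le> c * (LINT x|lborel. \<bar>fn n x\<bar>)" for n \<xi>
  proof -
    have "cmod (LINT x|lborel. of_real (fn n x) * cis (- (x \<bullet> \<xi>))) \<le> (LINT x|lborel. cmod (of_real (fn n x) * cis (- (x \<bullet> \<xi>))))"
      by (rule integral_norm_bound)
    then show ?thesis using c by (simp add: trunc norm_mult mult_left_mono)
  qed
  have Fi: "integrable lborel (\<lambda>\<xi>. truncated_fourier n f \<xi> * \<Phi> \<xi>)" for n
  proof (rule Bochner_Integration.integrable_bound[OF integrable_mult_right[OF Ei, of "c * (LINT x|lborel. \<bar>fn n x\<bar>)"]])
    show "AE \<xi> in lborel. norm (truncated_fourier n f \<xi> * \<Phi> \<xi>) \<le> norm ((c * (LINT x|lborel. \<bar>fn n x\<bar>)) * ?E \<xi>)"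
      using Fb[of n] c by (intro AE_I2) (auto simp: norm_mult n\<Phi> abs_mult intro!: mult_right_mono)
  qed measurable
  have Feq: "(LINT \<xi>|lborel. truncated_fourier n f \<xi> * \<Phi> \<xi>) =
     of_real (c * (2 * pi) ^ DIM('a) * (LINT x|lborel. fn n x * gauss_kernel \<delta> (x - y)))" for n
  proof -
    let ?K = "\<lambda>x \<xi>. of_real (fn n x) * cis (- (x \<bullet> \<xi>)) * \<Phi> \<xi>"
    have K: "integrable (lborel \<Otimes>\<^sub>M lborel) (case_prod ?K)"
    proof (rule lborel_pair.Fubini_integrable)
      show "integrable lborel (\<lambda>x. LINT \<xi>|lborel. norm (case_prod ?K (x, \<xi>)))"
        using fni[of n] by (simp add: norm_mult n\<Phi>)
      have "integrable lborel (\<lambda>\<xi>. ?K x \<xi>)" for x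
        by (rule Bochner_Integration.integrable_bound[OF integrable_mult_right[OF Ei, of "\<bar>fn n x\<bar>"]])
           (auto simp: norm_mult n\<Phi>)
      then show "AE x in lborel. integrable lborel (\<lambda>\<xi>. case_prod ?K (x, \<xi>))" by simp
    qed measurable
    have "(LINT \<xi>|lborel. truncated_fourier n f \<xi> * \<Phi> \<xi>) = of_real c * (LINT \<xi>|lborel. LINT x|lborel. ?K x \<xi>)"
      unfolding trunc integral_mult_left_zero
      by (subst integral_mult_right_zero[symmetric]) (simp only: mult.assoc)
    also have "(LINT \<xi>|lborel. LINT x|lborel. ?K x \<xi>) = (LINT x|lborel. LINT \<xi>|lborel. ?K x \<xi>)"
      by (rule lborel_pair.Fubini_integral[OF K])
    also have "\<dots> = (LINT x|lborel. of_real (fn n x * ((2 * pi) ^ DIM('a) * gauss_kernel \<delta> (x - y))))"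
    proof (rule Bochner_Integration.integral_cong[OF refl])
      fix x
      have cis_split: "cis ((y - x) \<bullet> \<xi>) = cis (- (x \<bullet> \<xi>)) * cis (y \<bullet> \<xi>)" for \<xi>
        by (simp add: inner_diff_left cis_mult)
      have "(LINT \<xi>|lborel. ?K x \<xi>) = of_real (fn n x) * (LINT \<xi>|lborel. cis ((y - x) \<bullet> \<xi>) * of_real (?E \<xi>))"
        by (simp only: \<Phi>_def cis_split mult.assoc integral_mult_right_zero)
      also have "\<dots> = of_real (fn n x) * of_real ((2 * pi) ^ DIM('a) * gauss_kernel \<delta> (y - x))"
        by (simp only: integral_cis_gaussian[OF \<delta>])
      finally show "(LINT \<xi>|lborel. ?K x \<xi>) = of_real (fn n x * ((2 * pi) ^ DIM('a) * gauss_kernel \<delta> (x - y)))"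
        using gauss_kernel_uminus[of \<delta> "x - y"] by simp
    qed
    also have "\<dots> = of_real (LINT x|lborel. (2 * pi) ^ DIM('a) * (fn n x * gauss_kernel \<delta> (x - y)))"
      by (subst integral_complex_of_real) (simp add: mult_ac)
    finally show ?thesis by simp
  qed
  have cc: "c * (2 * pi) ^ DIM('a) = (2 * pi) powr (real DIM('a) / 2)"
  proof -
    have "(2 * pi) ^ DIM('a) = (2 * pi) powr real DIM('a)" by (subst powr_realpow) auto
    then show ?thesis unfolding c_def by (simp only: powr_add[symmetric]) simp
  qed
  have lim1: "(\<lambda>n. LINT x|lborel. fn n x * gauss_kernel \<delta> (x - y)) \<longlonglongrightarrow> (LINT x|lborel. f x * gauss_kernel \<delta> (x - y))"
  proof (rule integral_dominated_convergence)
    show "integrable lborel (\<lambda>x. norm (f x * gauss_kernel \<delta> (x - y)))"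
      by (intro integrable_norm integrable_mult_gauss_kernel f \<delta>)
    show "AE x in lborel. (\<lambda>n. fn n x * gauss_kernel \<delta> (x - y)) \<longlonglongrightarrow> f x * gauss_kernel \<delta> (x - y)"
    proof (intro AE_I2 tendsto_eventually)
      fix x :: 'a
      obtain N where "norm x \<le> real N" using real_arch_simple by blast
      then show "\<forall>\<^sub>F n in sequentially. fn n x * gauss_kernel \<delta> (x - y) = f x * gauss_kernel \<delta> (x - y)"
        by (intro eventually_sequentiallyI[of N]) (auto simp: fn_def)
    qed
    show "AE x in lborel. norm (fn n x * gauss_kernel \<delta> (x - y)) \<le> norm (f x * gauss_kernel \<delta> (x - y))" for n
      by (intro AE_I2) (auto simp: fn_def indicator_def)
  qed measurable
  \<comment> \<open>The transforms of the cut-offs tend to \<open>h\<close> in L2 and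
    \<open>\<Phi>\<close> is square integrable, so Cauchy--Schwarz gives the limit. It is applied to
    nonnegative integrals because the single differences are not known to be square integrable;
    finiteness of \<open>J\<close> makes the product tend to 0.\<close>
  have lim2: "(\<lambda>n. LINT \<xi>|lborel. truncated_fourier n f \<xi> * \<Phi> \<xi>) \<longlonglongrightarrow> (LINT \<xi>|lborel. h \<xi> * \<Phi> \<xi>)"
  proof -
    define I where "I n = (\<integral>\<^sup>+\<xi>. ennreal ((cmod (h \<xi> - truncated_fourier n f \<xi>))\<^sup>2) \<partial>lborel)" for n
    define J where "J = (\<integral>\<^sup>+\<xi>. ennreal ((cmod (\<Phi> \<xi>))\<^sup>2) \<partial>lborel)"
    have J: "J < \<infinity>" unfolding J_def using \<Phi>2 by (simp add: integrable_iff_bounded)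
    have I: "I \<longlonglongrightarrow> 0" using h unfolding has_fourier_L2_def I_def by blast
    define D where "D n = cmod ((LINT \<xi>|lborel. h \<xi> * \<Phi> \<xi>) - (LINT \<xi>|lborel. truncated_fourier n f \<xi> * \<Phi> \<xi>))" for n
    have le: "ennreal ((D n)\<^sup>2) \<le> I n * J" for n
    proof -
      have "D n = cmod (LINT \<xi>|lborel. (h \<xi> - truncated_fourier n f \<xi>) * \<Phi> \<xi>)"
        unfolding D_def by (subst Bochner_Integration.integral_diff[OF hi Fi, symmetric]) (simp add: algebra_simps)
      then have "ennreal (D n) \<le> (\<integral>\<^sup>+\<xi>. ennreal (cmod ((h \<xi> - truncated_fourier n f \<xi>) * \<Phi> \<xi>)) \<partial>lborel)"
        using integral_norm_bound_ennreal[OF Bochner_Integration.integrable_diff[OF hi Fi[of n]]]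
        by (simp add: algebra_simps)
      also have "\<dots> = (\<integral>\<^sup>+\<xi>. ennreal (cmod (h \<xi> - truncated_fourier n f \<xi>)) * ennreal (cmod (\<Phi> \<xi>)) \<partial>lborel)"
        by (simp add: norm_mult ennreal_mult)
      finally have "(ennreal (D n))\<^sup>2 \<le> \<dots>\<^sup>2" by (intro power_mono) auto
      also have "\<dots> \<le> (\<integral>\<^sup>+\<xi>. (ennreal (cmod (h \<xi> - truncated_fourier n f \<xi>)))\<^sup>2 \<partial>lborel) * (\<integral>\<^sup>+\<xi>. (ennreal (cmod (\<Phi> \<xi>)))\<^sup>2 \<partial>lborel)"
        by (rule Cauchy_Schwarz_nn_integral) measurable
      also have "\<dots> = I n * J" by (simp add: I_def J_def ennreal_power)
      finally show ?thesis by (simp add: ennreal_power D_def)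
    qed
    have "(\<lambda>n. I n * J) \<longlonglongrightarrow> 0 * J"
      using J by (intro tendsto_mult_ennreal I tendsto_const) auto
    then have IJ: "(\<lambda>n. I n * J) \<longlonglongrightarrow> 0" by simp
    have "(\<lambda>n. ennreal ((D n)\<^sup>2)) \<longlonglongrightarrow> 0"
      by (rule tendsto_sandwich[where f="\<lambda>_. 0" and h="\<lambda>n. I n * J"])
         (simp_all only: le eventually_True zero_le IJ tendsto_const)
    then have "(\<lambda>n. ennreal ((D n)\<^sup>2)) \<longlonglongrightarrow> ennreal 0" by simp
    then have "(\<lambda>n. (D n)\<^sup>2) \<longlonglongrightarrow> 0"
      by (subst (asm) tendsto_ennreal_iff) auto
    then have "(\<lambda>n. sqrt ((D n)\<^sup>2)) \<longlonglongrightarrow> sqrt 0" by (rule tendsto_real_sqrt)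
    then have "D \<longlonglongrightarrow> 0" by (simp add: D_def[abs_def])
    then have "(\<lambda>n. (LINT \<xi>|lborel. h \<xi> * \<Phi> \<xi>) - (LINT \<xi>|lborel. truncated_fourier n f \<xi> * \<Phi> \<xi>)) \<longlonglongrightarrow> 0"
      unfolding D_def[abs_def] by (rule tendsto_norm_zero_cancel)
    from tendsto_diff[OF tendsto_const[of "LINT \<xi>|lborel. h \<xi> * \<Phi> \<xi>"] this] show ?thesis by simp
  qed
  have "(\<lambda>n. LINT \<xi>|lborel. truncated_fourier n f \<xi> * \<Phi> \<xi>) \<longlonglongrightarrow>
     of_real (c * (2 * pi) ^ DIM('a) * (LINT x|lborel. f x * gauss_kernel \<delta> (x - y)))"
    unfolding Feq by (intro tendsto_of_real tendsto_mult_left lim1)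
  from LIMSEQ_unique[OF lim2 this] show "(LINT \<xi>|lborel. h \<xi> * \<Phi> \<xi>) =
      of_real ((2 * pi) powr (real DIM('a) / 2) * (LINT x|lborel. f x * gauss_kernel \<delta> (x - y)))"
    by (simp only: cc)
qed

section \<open>Point evaluations on Sobolev spaces\<close>

text \<open>Half of the exponent is kept as a factor that vanishes with \<delta>; the other half,
  since \<delta> \<le> 1, is dominated by the exponent of the fixed kernel of width sqrt 2. A
  majorant of this form is wanted because far from the point the function to be smoothed is merely
  square integrable.\<close>

lemma gauss_kernel_tail:
  assumes \<delta>: "0 < \<delta>" "\<delta> \<le> 1" and r: "0 < r" "r \<le> norm (x::'a::euclidean_space)"
  shows "gauss_kernel \<delta> x \<le> (sqrt 2 / \<delta>) ^ DIM('a) * exp (- r\<^sup>2 / (4 * \<delta>\<^sup>2)) * gauss_kernel (sqrt 2) x"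
proof -
  have "r\<^sup>2 / (4 * \<delta>\<^sup>2) \<le> (norm x)\<^sup>2 / (4 * \<delta>\<^sup>2)"
    using r \<delta> by (intro divide_right_mono power_mono) auto
  moreover have "(norm x)\<^sup>2 / 4 \<le> (norm x)\<^sup>2 / (4 * \<delta>\<^sup>2)"
    using \<delta> power_le_one[of \<delta> 2] by (intro divide_left_mono) auto
  moreover have "(norm x)\<^sup>2 / (4 * \<delta>\<^sup>2) + (norm x)\<^sup>2 / (4 * \<delta>\<^sup>2) = (norm x)\<^sup>2 / (2 * \<delta>\<^sup>2)"
    by (simp add: field_simps)
  ultimately have "- (norm x)\<^sup>2 / (2 * \<delta>\<^sup>2) \<le> - r\<^sup>2 / (4 * \<delta>\<^sup>2) + - (norm x)\<^sup>2 / (2 * (sqrt 2)\<^sup>2)"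
    by (simp del: minus_add_distrib)
  then have "exp (- (norm x)\<^sup>2 / (2 * \<delta>\<^sup>2)) \<le> exp (- r\<^sup>2 / (4 * \<delta>\<^sup>2)) * exp (- (norm x)\<^sup>2 / (2 * (sqrt 2)\<^sup>2))"
    by (simp only: exp_add[symmetric] exp_le_cancel_iff)
  then have "(1 / sqrt (2 * pi * \<delta>\<^sup>2)) ^ DIM('a) * exp (- (norm x)\<^sup>2 / (2 * \<delta>\<^sup>2)) \<le>
      (1 / sqrt (2 * pi * \<delta>\<^sup>2)) ^ DIM('a) * (exp (- r\<^sup>2 / (4 * \<delta>\<^sup>2)) * exp (- (norm x)\<^sup>2 / (2 * (sqrt 2)\<^sup>2)))"
    by (rule mult_left_mono) (use \<delta> in simp)
  then have "gauss_kernel \<delta> x \<le> (1 / sqrt (2 * pi * \<delta>\<^sup>2)) ^ DIM('a) * (exp (- r\<^sup>2 / (4 * \<delta>\<^sup>2)) * exp (- (norm x)\<^sup>2 / (2 * (sqrt 2)\<^sup>2)))"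
    by (simp only: gauss_kernel_eq[OF \<delta>(1)])
  also have "1 / sqrt (2 * pi * \<delta>\<^sup>2) = sqrt 2 / \<delta> * (1 / sqrt (2 * pi * (sqrt 2)\<^sup>2))"
    using \<delta> by (simp add: real_sqrt_mult field_simps)
  finally show ?thesis
    by (simp only: gauss_kernel_eq[of "sqrt 2" x, OF real_sqrt_gt_zero[OF zero_less_numeral]] power_mult_distrib mult_ac)
qed

lemma gauss_tail_factor_tendsto_0:
  fixes r :: real
  assumes "r > 0"
  shows "((\<lambda>\<delta>. (sqrt 2 / \<delta>) ^ n * exp (- r\<^sup>2 / (4 * \<delta>\<^sup>2))) \<longlongrightarrow> 0) (at_right 0)"
proof -
  have "((\<lambda>x. (sqrt 2 * x) ^ n * exp (- r\<^sup>2 * x\<^sup>2 / 4)) \<longlongrightarrow> 0) at_top"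
    using assms by real_asymp
  then have "((\<lambda>\<delta>. (sqrt 2 * inverse \<delta>) ^ n * exp (- r\<^sup>2 * (inverse \<delta>)\<^sup>2 / 4)) \<longlongrightarrow> 0) (at_right 0)"
    by (rule filterlim_compose[OF _ filterlim_inverse_at_top_right])
  then show ?thesis by (simp add: field_simps)
qed

text \<open>Near \<open>y\<close> the function is almost everywhere within e/2 of
  \<open>g y\<close>, and the kernel has mass 1. Far from \<open>y\<close> the tail estimate bounds
  the contribution by the vanishing factor \<open>k \<delta>\<close> times the constant
  \<open>C\<close>. The limit is thus the value at each single point of \<open>M\<close>, although
  \<open>f\<close> matters only up to null sets.\<close>

lemma gauss_kernel_approximate_identity:
  fixes f g :: "'a::euclidean_space \<Rightarrow> real"
  assumes f: "square_integrable f" and M: "open M" "y \<in> M" and g: "continuous_on M g"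
    and eq: "AE x in lborel. x \<in> M \<longrightarrow> f x = g x"
  shows "((\<lambda>\<delta>. LINT x|lborel. f x * gauss_kernel \<delta> (x - y)) \<longlongrightarrow> g y) (at_right 0)"
proof (rule tendstoI)
  fix e :: real assume e: "e > 0"
  have [measurable]: "f \<in> borel_measurable borel" using f by (simp add: square_integrable_def)
  have "isCont g y" using g M by (simp add: continuous_on_eq_continuous_at)
  then obtain r1 where r1: "r1 > 0" "\<And>x. dist x y < r1 \<Longrightarrow> dist (g x) (g y) < e / 2"
    using e unfolding continuous_at_eps_delta by (meson half_gt_zero)
  obtain r2 where r2: "r2 > 0" "ball y r2 \<subseteq> M" using M by (auto simp: open_contains_ball)
  define r where "r = min r1 r2"
  have r: "r > 0" "\<And>x. dist x y < r \<Longrightarrow> x \<in> M \<and> \<bar>g x - g y\<bar> < e / 2"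
    using r1 r2 by (auto simp: r_def dist_commute dist_real_def)
  define k where "k \<delta> = (sqrt 2 / \<delta>) ^ DIM('a) * exp (- r\<^sup>2 / (4 * \<delta>\<^sup>2))" for \<delta>
  define C where "C = (LINT x|lborel. \<bar>f x - g y\<bar> * gauss_kernel (sqrt 2) (x - y))"
  have int: "integrable lborel (\<lambda>x. (f x - g y) * gauss_kernel \<delta> (x - y))" if "\<delta> > 0" for \<delta>
    using integrable_mult_gauss_kernel[OF f that, of y]
      integrable_lborel_translate[OF gauss_kernel_integrable[OF that], of y]
    by (simp add: left_diff_distrib)
  have eval: "(LINT x|lborel. (f x - g y) * gauss_kernel \<delta> (x - y)) = (LINT x|lborel. f x * gauss_kernel \<delta> (x - y)) - g y" if "\<delta> > 0" for \<delta>
    using integrable_mult_gauss_kernel[OF f that, of y]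
      integrable_lborel_translate[OF gauss_kernel_integrable[OF that], of y]
    by (simp add: left_diff_distrib integral_lborel_translate gauss_kernel_integral[OF that])
  have bound: "\<bar>(LINT x|lborel. f x * gauss_kernel \<delta> (x - y)) - g y\<bar> \<le> e / 2 + k \<delta> * C" if \<delta>: "0 < \<delta>" "\<delta> \<le> 1" for \<delta>
  proof -
    have C: "integrable lborel (\<lambda>x. \<bar>f x - g y\<bar> * gauss_kernel (sqrt 2) (x - y))"
      using integrable_abs[OF int[of "sqrt 2"]] gauss_kernel_nonneg[of "sqrt 2", where 'a='a]
      by (simp add: abs_mult)
    have G: "integrable lborel (\<lambda>x. gauss_kernel \<delta> (x - y))"
      by (intro integrable_lborel_translate gauss_kernel_integrable \<delta>)
    have k0: "k \<delta> \<ge> 0" using \<delta> by (simp add: k_def)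
    have "\<bar>LINT x|lborel. (f x - g y) * gauss_kernel \<delta> (x - y)\<bar> \<le> (LINT x|lborel. \<bar>(f x - g y) * gauss_kernel \<delta> (x - y)\<bar>)"
      by (rule integral_abs_bound)
    also have "\<dots> \<le> (LINT x|lborel. e / 2 * gauss_kernel \<delta> (x - y) + k \<delta> * (\<bar>f x - g y\<bar> * gauss_kernel (sqrt 2) (x - y)))"
    proof (rule integral_mono_AE)
      show "integrable lborel (\<lambda>x. \<bar>(f x - g y) * gauss_kernel \<delta> (x - y)\<bar>)"
        by (intro integrable_abs int \<delta>)
      show "integrable lborel (\<lambda>x. e / 2 * gauss_kernel \<delta> (x - y) + k \<delta> * (\<bar>f x - g y\<bar> * gauss_kernel (sqrt 2) (x - y)))"
        by (intro Bochner_Integration.integrable_add integrable_mult_right C G)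
      show "AE x in lborel. \<bar>(f x - g y) * gauss_kernel \<delta> (x - y)\<bar> \<le> e / 2 * gauss_kernel \<delta> (x - y) + k \<delta> * (\<bar>f x - g y\<bar> * gauss_kernel (sqrt 2) (x - y))"
        using eq
      proof eventually_elim
        case (elim x)
        have p: "gauss_kernel \<delta> (x - y) \<ge> 0" "gauss_kernel (sqrt 2) (x - y) \<ge> 0"
          using \<delta> by (auto intro: gauss_kernel_nonneg)
        show ?case
        proof (cases "dist x y < r")
          case True
          then have "\<bar>f x - g y\<bar> \<le> e / 2" using r(2)[OF True] elim by auto
          then have "\<bar>f x - g y\<bar> * gauss_kernel \<delta> (x - y) \<le> e / 2 * gauss_kernel \<delta> (x - y)"
            using p by (intro mult_right_mono)
          then show ?thesis using p k0 by (simp add: abs_mult add_increasing2)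
        next
          case False
          then have "gauss_kernel \<delta> (x - y) \<le> k \<delta> * gauss_kernel (sqrt 2) (x - y)"
            unfolding k_def using \<delta> r by (intro gauss_kernel_tail) (auto simp: dist_norm)
          then have "\<bar>f x - g y\<bar> * gauss_kernel \<delta> (x - y) \<le> \<bar>f x - g y\<bar> * (k \<delta> * gauss_kernel (sqrt 2) (x - y))"
            by (intro mult_left_mono) auto
          then show ?thesis using p e by (simp add: abs_mult mult_ac add_increasing)
        qed
      qed
    qed
    also have "\<dots> = e / 2 + k \<delta> * C"
      using C G by (simp add: C_def integral_lborel_translate gauss_kernel_integral \<delta>)
    finally show ?thesis by (simp add: eval \<delta>)
  qed
  have "((\<lambda>\<delta>. k \<delta> * C) \<longlongrightarrow> 0) (at_right 0)"
    unfolding k_def by (intro tendsto_mult_left_zero gauss_tail_factor_tendsto_0 r)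
  then have "\<forall>\<^sub>F \<delta> in at_right 0. k \<delta> * C < e / 2"
    using e by (intro order_tendstoD(2)) auto
  moreover have "\<forall>\<^sub>F \<delta> in at_right (0::real). 0 < \<delta> \<and> \<delta> < 1"
    by (rule eventually_at_rightI[of 0 1]) auto
  ultimately show "\<forall>\<^sub>F \<delta> in at_right 0. dist (LINT x|lborel. f x * gauss_kernel \<delta> (x - y)) (g y) < e"
  proof eventually_elim
    case (elim \<delta>)
    then show ?case using bound[of \<delta>] by (auto simp: dist_real_def)
  qed
qed

text \<open>Up to the factor (2 pi)^d this is the reproducing kernel of H^s, as a function of the
  difference of its arguments. The cosine replaces the complex exponential because the weight is
  even.\<close>

definition bessel_kernel :: "real \<Rightarrow> 'a::euclidean_space \<Rightarrow> real" where
  "bessel_kernel s z = (LINT \<xi>|lborel. (1 + (norm \<xi>)\<^sup>2) powr - s * cos (z \<bullet> \<xi>))"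

lemma integrable_bessel_kernel:
  assumes "s > real DIM('a) / 2"
  shows "integrable lborel (\<lambda>\<xi>::'a::euclidean_space. (1 + (norm \<xi>)\<^sup>2) powr - s * cos (z \<bullet> \<xi>))"
  by (rule Bochner_Integration.integrable_bound[OF integrable_bessel_weight[OF assms]])
     (auto simp: abs_mult intro!: mult_left_le)

text \<open>Continuity at the origin makes Sobolev balls equicontinuous: the oscillation of a
  function between x and y is governed by the difference of the kernel at 0 and at x - y.\<close>

lemma isCont_bessel_kernel_0:
  assumes "s > real DIM('a) / 2"
  shows "isCont (bessel_kernel s) (0::'a::euclidean_space)"
  unfolding continuous_at_sequentially bessel_kernel_def o_def
proof (intro allI impI integral_dominated_convergence)
    show "integrable lborel (\<lambda>\<xi>::'a. (1 + (norm \<xi>)\<^sup>2) powr - s)"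
      by (rule integrable_bessel_weight[OF assms])
    show "AE \<xi> in lborel. (\<lambda>n. (1 + (norm \<xi>)\<^sup>2) powr - s * cos (x n \<bullet> \<xi>))
        \<longlonglongrightarrow> (1 + (norm \<xi>)\<^sup>2) powr - s * cos (0 \<bullet> \<xi>)" if "x \<longlonglongrightarrow> 0" for x :: "nat \<Rightarrow> 'a"
      using that by (intro AE_I2 tendsto_intros)
qed (auto simp: abs_mult mult_left_le)

section \<open>Point evaluations and the kernel form\<close>

lemma cmod_sum_cis_square:
  fixes a :: "'i \<Rightarrow> real"
  assumes "finite I"
  shows "(cmod (\<Sum>i\<in>I. of_real (a i) * cis (\<theta> i)))\<^sup>2 = (\<Sum>i\<in>I. \<Sum>j\<in>I. a i * a j * cos (\<theta> i - \<theta> j))"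
proof -
  have "(cmod (\<Sum>i\<in>I. of_real (a i) * cis (\<theta> i)))\<^sup>2 = (\<Sum>i\<in>I. a i * cos (\<theta> i))\<^sup>2 + (\<Sum>i\<in>I. a i * sin (\<theta> i))\<^sup>2"
    by (simp add: cmod_power2)
  also have "\<dots> = (\<Sum>i\<in>I. \<Sum>j\<in>I. a i * a j * cos (\<theta> i - \<theta> j))"
    by (simp add: power2_eq_square sum_product cos_diff algebra_simps flip: sum.distrib)
  finally show ?thesis .
qed

text \<open>The form is the squared weighted L2 norm of a trigonometric polynomial; positive
  semidefiniteness of the kernel is read off from this integral.\<close>

lemma bessel_kernel_quadratic_form:
  fixes a :: "'i \<Rightarrow> real" and y :: "'i \<Rightarrow> 'a::euclidean_space"
  assumes s: "s > real DIM('a) / 2" and I: "finite I"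
  shows "integrable lborel (\<lambda>\<xi>. (1 + (norm \<xi>)\<^sup>2) powr - s * (cmod (\<Sum>i\<in>I. of_real (a i) * cis (y i \<bullet> \<xi>)))\<^sup>2)" (is ?A)
    and "(LINT \<xi>|lborel. (1 + (norm \<xi>)\<^sup>2) powr - s * (cmod (\<Sum>i\<in>I. of_real (a i) * cis (y i \<bullet> \<xi>)))\<^sup>2) =
     (\<Sum>i\<in>I. \<Sum>j\<in>I. a i * a j * bessel_kernel s (y i - y j))" (is ?B)
proof -
  have eq: "(1 + (norm \<xi>)\<^sup>2) powr - s * (cmod (\<Sum>i\<in>I. of_real (a i) * cis (y i \<bullet> \<xi>)))\<^sup>2 =
    (\<Sum>i\<in>I. \<Sum>j\<in>I. a i * a j * ((1 + (norm \<xi>)\<^sup>2) powr - s * cos ((y i - y j) \<bullet> \<xi>)))" for \<xi>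
    by (simp add: cmod_sum_cis_square[OF I] sum_distrib_left inner_diff_left mult_ac)
  show ?A unfolding eq
    by (intro Bochner_Integration.integrable_sum integrable_mult_right integrable_bessel_kernel s)
  show ?B unfolding eq bessel_kernel_def
    by (simp add: integrable_bessel_kernel[OF s])
qed

text \<open>A combination of point evaluations is, after Gaussian smoothing, a pairing of the
  transform of \<open>f\<close> with the trigonometric polynomial \<open>q\<close>. Cauchy--Schwarz
  with the weight split into its powers s/2 and -s/2 separates the Sobolev norm from the kernel
  form.\<close>

lemma sobolev_quadratic_form_bound:
  fixes f g :: "'a::euclidean_space \<Rightarrow> real" and a :: "'i \<Rightarrow> real"
  assumes s: "s > real DIM('a) / 2" and f: "f \<in> sobolev s"
    and M: "open M" and g: "continuous_on M g" and eq: "AE x in lborel. x \<in> M \<longrightarrow> f x = g x"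
    and I: "finite I" and y: "\<And>i. i \<in> I \<Longrightarrow> y i \<in> M"
  shows "(\<Sum>i\<in>I. a i * g (y i))\<^sup>2 \<le>
    (sobolev_norm s f)\<^sup>2 / (2 * pi) ^ DIM('a) * (\<Sum>i\<in>I. \<Sum>j\<in>I. a i * a j * bessel_kernel s (y i - y j))"
proof -
  define h where "h = fourier_L2 f"
  have f2: "square_integrable f" and "\<exists>h. has_fourier_L2 f h"
    and Wh: "integrable lborel (\<lambda>\<xi>. (1 + (norm \<xi>)\<^sup>2) powr s * (cmod (h \<xi>))\<^sup>2)"
    using f by (auto simp: sobolev_def h_def)
  then have h: "has_fourier_L2 f h" unfolding h_def fourier_L2_def by (metis someI_ex)
  then have [measurable]: "h \<in> borel_measurable borel" by (simp add: has_fourier_L2_def)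
  have s0: "s > 0" using s by (meson less_trans divide_pos_pos of_nat_0_less_iff DIM_positive zero_less_numeral)
  have W1: "1 \<le> (1 + (norm \<xi>)\<^sup>2) powr s" for \<xi> :: 'a
    using s0 by (intro ge_one_powr_ge_zero) auto
  have h2: "integrable lborel (\<lambda>\<xi>. (cmod (h \<xi>))\<^sup>2)"
    by (rule Bochner_Integration.integrable_bound[OF Wh])
       (use W1 mult_right_mono[OF W1] in \<open>auto simp: abs_mult\<close>)
  define q where "q \<xi> = (\<Sum>i\<in>I. of_real (a i) * cis (y i \<bullet> \<xi>))" for \<xi>
  have [measurable]: "q \<in> borel_measurable borel" unfolding q_def[abs_def] by measurable
  define c where "c = (2 * pi) powr (real DIM('a) / 2)"
  have c0: "c > 0" by (simp add: c_def)
  have c2: "c\<^sup>2 = (2 * pi) ^ DIM('a)"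
  proof -
    have "c\<^sup>2 = (2 * pi) powr real DIM('a)" unfolding c_def power2_eq_square powr_add[symmetric] by simp
    also have "\<dots> = (2 * pi) ^ DIM('a)" by (rule powr_realpow) simp
    finally show ?thesis .
  qed
  define Q where "Q = (LINT \<xi>|lborel. (1 + (norm \<xi>)\<^sup>2) powr - s * (cmod (q \<xi>))\<^sup>2)"
  define N where "N = (LINT \<xi>|lborel. (1 + (norm \<xi>)\<^sup>2) powr s * (cmod (h \<xi>))\<^sup>2)"
  have Qi: "integrable lborel (\<lambda>\<xi>. (1 + (norm \<xi>)\<^sup>2) powr - s * (cmod (q \<xi>))\<^sup>2)"
    unfolding q_def by (rule bessel_kernel_quadratic_form(1)[OF s I])
  have QN0: "Q \<ge> 0" "N \<ge> 0" unfolding Q_def N_def by (auto intro!: integral_nonneg_AE)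
  \<comment> \<open>The Gaussian factor has modulus at most 1 and is dropped, so the estimate for
    the smoothed values is uniform in \<open>\<delta>\<close> and survives the limit.\<close>
  have step: "c\<^sup>2 * (\<Sum>i\<in>I. a i * (LINT x|lborel. f x * gauss_kernel \<delta> (x - y i)))\<^sup>2 \<le> N * Q" if \<delta>: "\<delta> > 0" for \<delta>
  proof -
    let ?\<Phi> = "\<lambda>y \<xi>. cis (y \<bullet> \<xi>) * complex_of_real (exp (- (\<delta> * norm \<xi>)\<^sup>2 / 2))"
    let ?S = "c * (\<Sum>i\<in>I. a i * (LINT x|lborel. f x * gauss_kernel \<delta> (x - y i)))"
    have i: "integrable lborel (\<lambda>\<xi>. h \<xi> * ?\<Phi> z \<xi>)" for z
      by (rule fourier_L2_gauss_integrable[OF f2 h h2 \<delta>])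
    have "complex_of_real ?S = (\<Sum>i\<in>I. of_real (a i) * (LINT \<xi>|lborel. h \<xi> * ?\<Phi> (y i) \<xi>))"
      unfolding fourier_L2_gauss[OF f2 h h2 \<delta>]
      by (simp add: c_def sum_distrib_left mult_ac)
    also have "\<dots> = (LINT \<xi>|lborel. (\<Sum>i\<in>I. of_real (a i) * (h \<xi> * ?\<Phi> (y i) \<xi>)))"
      by (subst Bochner_Integration.integral_sum)
         (rule integrable_mult_right[OF i], simp only: integral_mult_right_zero)
    finally have S: "complex_of_real ?S = (LINT \<xi>|lborel. (\<Sum>i\<in>I. of_real (a i) * (h \<xi> * ?\<Phi> (y i) \<xi>)))" .
    have "ennreal \<bar>?S\<bar> = ennreal (cmod (LINT \<xi>|lborel. (\<Sum>i\<in>I. of_real (a i) * (h \<xi> * ?\<Phi> (y i) \<xi>))))"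
      unfolding S[symmetric] norm_of_real ..
    also have "\<dots> \<le> (\<integral>\<^sup>+\<xi>. ennreal (cmod (\<Sum>i\<in>I. of_real (a i) * (h \<xi> * ?\<Phi> (y i) \<xi>))) \<partial>lborel)"
      by (intro integral_norm_bound_ennreal Bochner_Integration.integrable_sum integrable_mult_right i)
    also have "\<dots> \<le> (\<integral>\<^sup>+\<xi>. ennreal (sqrt ((1 + (norm \<xi>)\<^sup>2) powr s) * cmod (h \<xi>)) * ennreal (sqrt ((1 + (norm \<xi>)\<^sup>2) powr - s) * cmod (q \<xi>)) \<partial>lborel)"
    proof (intro nn_integral_mono)
      fix \<xi> :: 'a
      have "(\<Sum>i\<in>I. of_real (a i) * (h \<xi> * ?\<Phi> (y i) \<xi>)) = of_real (exp (- (\<delta> * norm \<xi>)\<^sup>2 / 2)) * (h \<xi> * q \<xi>)"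
        by (simp add: q_def sum_distrib_left sum_distrib_right mult_ac)
      then have "cmod (\<Sum>i\<in>I. of_real (a i) * (h \<xi> * ?\<Phi> (y i) \<xi>)) = exp (- (\<delta> * norm \<xi>)\<^sup>2 / 2) * (cmod (h \<xi>) * cmod (q \<xi>))"
        by (simp add: norm_mult)
      also have "\<dots> \<le> 1 * (cmod (h \<xi>) * cmod (q \<xi>))"
        by (intro mult_right_mono) auto
      also have "1 = sqrt ((1 + (norm \<xi>)\<^sup>2) powr s) * sqrt ((1 + (norm \<xi>)\<^sup>2) powr - s)"
      proof -
        have "1 + (norm \<xi>)\<^sup>2 > 0" by (simp add: add_pos_nonneg)
        then show ?thesis unfolding real_sqrt_mult[symmetric] powr_add[symmetric] by simp
      qed
      finally show "ennreal (cmod (\<Sum>i\<in>I. of_real (a i) * (h \<xi> * ?\<Phi> (y i) \<xi>))) \<le>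
        ennreal (sqrt ((1 + (norm \<xi>)\<^sup>2) powr s) * cmod (h \<xi>)) * ennreal (sqrt ((1 + (norm \<xi>)\<^sup>2) powr - s) * cmod (q \<xi>))"
        by (simp add: ennreal_mult[symmetric] mult_ac)
    qed
    finally have "(ennreal \<bar>?S\<bar>)\<^sup>2 \<le> \<dots>\<^sup>2" by (intro power_mono) auto
    also have "\<dots> \<le> (\<integral>\<^sup>+\<xi>. (ennreal (sqrt ((1 + (norm \<xi>)\<^sup>2) powr s) * cmod (h \<xi>)))\<^sup>2 \<partial>lborel) *
        (\<integral>\<^sup>+\<xi>. (ennreal (sqrt ((1 + (norm \<xi>)\<^sup>2) powr - s) * cmod (q \<xi>)))\<^sup>2 \<partial>lborel)"
      by (rule Cauchy_Schwarz_nn_integral) measurable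
    also have "\<dots> = ennreal N * ennreal Q"
      unfolding N_def Q_def
      by (subst (1 2) nn_integral_eq_integral[symmetric])
         (auto simp: Wh Qi ennreal_power power_mult_distrib)
    finally have "ennreal (?S\<^sup>2) \<le> ennreal (N * Q)"
      using QN0 by (simp add: ennreal_power ennreal_mult)
    then show ?thesis using QN0 by (simp add: power_mult_distrib)
  qed
  have "((\<lambda>\<delta>. c\<^sup>2 * (\<Sum>i\<in>I. a i * (LINT x|lborel. f x * gauss_kernel \<delta> (x - y i)))\<^sup>2) \<longlongrightarrow> c\<^sup>2 * (\<Sum>i\<in>I. a i * g (y i))\<^sup>2) (at_right 0)"
    by (intro tendsto_intros gauss_kernel_approximate_identity[OF f2 M _ g eq] y)
  then have "c\<^sup>2 * (\<Sum>i\<in>I. a i * g (y i))\<^sup>2 \<le> N * Q"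
    by (rule tendsto_upperbound) (auto intro!: eventually_at_rightI[of 0 1] step)
  then have "(\<Sum>i\<in>I. a i * g (y i))\<^sup>2 \<le> N / c\<^sup>2 * Q"
    using c0 by (simp add: field_simps)
  also have "N = (sobolev_norm s f)\<^sup>2"
    using QN0 by (simp add: sobolev_norm_def N_def h_def)
  also have "Q = (\<Sum>i\<in>I. \<Sum>j\<in>I. a i * a j * bessel_kernel s (y i - y j))"
    unfolding Q_def q_def by (rule bessel_kernel_quadratic_form(2)[OF s I])
  finally show ?thesis by (simp only: c2)
qed

section \<open>Symmetrization and contraction\<close>

lemma ennreal_add_le: "ennreal (a + b) \<le> ennreal a + ennreal b"
proof (cases "0 \<le> a \<and> 0 \<le> b")
  case False
  then have "ennreal (a + b) \<le> ennreal a \<or> ennreal (a + b) \<le> ennreal b"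
    by (auto simp: not_le intro!: ennreal_leI)
  then show ?thesis by (auto intro: order_trans add_increasing add_increasing2)
qed auto

lemma ennreal_add_SUP_le:
  fixes a b :: "'v \<Rightarrow> ennreal"
  assumes "\<And>v v'. v \<in> V \<Longrightarrow> v' \<in> V \<Longrightarrow> a v + b v' \<le> X"
  shows "(SUP v\<in>V. a v) + (SUP v\<in>V. b v) \<le> X"
proof (cases "V = {}")
  case False
  have "(SUP v\<in>V. a v) + (SUP v\<in>V. b v) = (SUP v\<in>V. a v + (SUP v\<in>V. b v))"
    using False by (simp add: ennreal_SUP_add_left)
  also have "\<dots> = (SUP v\<in>V. SUP v'\<in>V. a v + b v')"
    using False by (simp add: ennreal_SUP_add_right)
  also have "\<dots> \<le> X" by (intro SUP_least assms)
  finally show ?thesis .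
qed (simp add: bot_ennreal)

text \<open>The one-coordinate step of the Ledoux--Talagrand contraction principle. Truncating at \<open>0\<close>
  is what requires \<open>|f v| \<le> |c v|\<close> in addition to the Lipschitz condition.\<close>

lemma SUP_contraction:
  fixes h f c :: "'v \<Rightarrow> real"
  assumes lip: "\<And>v v'. v \<in> V \<Longrightarrow> v' \<in> V \<Longrightarrow> \<bar>f v - f v'\<bar> \<le> \<bar>c v - c v'\<bar>"
    and le: "\<And>v. v \<in> V \<Longrightarrow> \<bar>f v\<bar> \<le> \<bar>c v\<bar>"
  shows "(SUP v\<in>V. ennreal (h v + f v)) + (SUP v\<in>V. ennreal (h v - f v))
    \<le> (SUP v\<in>V. ennreal (h v + c v)) + (SUP v\<in>V. ennreal (h v - c v))" (is "_ \<le> ?A + ?B")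
proof (rule ennreal_add_SUP_le)
  have AB: "ennreal (h v + c v) + ennreal (h v' - c v') \<le> ?A + ?B" if "v \<in> V" "v' \<in> V" for v v'
    using that by (intro add_mono SUP_upper)
  \<comment> \<open>Either of the two nonnegative summands may be discarded; the sign of
    \<open>c v\<close> decides which.\<close>
  have one: "ennreal (h v + \<bar>c v\<bar>) \<le> ?A + ?B" if "v \<in> V" for v
    using AB[OF that that] by (cases "c v \<ge> 0") (auto intro: order_trans[rotated] add_increasing add_increasing2)
  fix v v' assume v: "v \<in> V" "v' \<in> V"
  consider "h v + f v \<ge> 0" "h v' - f v' \<ge> 0" | "h v + f v < 0" | "h v' - f v' < 0" by linarith
  then show "ennreal (h v + f v) + ennreal (h v' - f v') \<le> ?A + ?B"
  proof cases
    case 1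
    then have "ennreal (h v + f v) + ennreal (h v' - f v') = ennreal (h v + h v' + (f v - f v'))"
      by (simp add: ennreal_plus[symmetric] algebra_simps del: ennreal_plus)
    also have "\<dots> \<le> ennreal (h v + h v' + \<bar>c v - c v'\<bar>)"
      using lip[OF v] by (intro ennreal_leI) linarith
    \<comment> \<open>The points \<open>v\<close> and \<open>v'\<close> may be exchanged between the
      two suprema, and this realizes the absolute value.\<close>
    also have "\<dots> \<le> ?A + ?B"
    proof (cases "c v \<ge> c v'")
      case True
      then have "ennreal (h v + h v' + \<bar>c v - c v'\<bar>) = ennreal ((h v + c v) + (h v' - c v'))"
        by (simp add: algebra_simps)
      then show ?thesis by (simp only: order_trans[OF ennreal_add_le AB[OF v]])
    next
      case False
      then have "ennreal (h v + h v' + \<bar>c v - c v'\<bar>) = ennreal ((h v' + c v') + (h v - c v))"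
        by (simp add: algebra_simps)
      then show ?thesis by (simp only: order_trans[OF ennreal_add_le AB[OF v(2,1)]])
    qed
    finally show ?thesis .
  next
    case 2
    then have "ennreal (h v + f v) + ennreal (h v' - f v') = ennreal (h v' - f v')"
      by (simp add: ennreal_neg)
    also have "\<dots> \<le> ennreal (h v' + \<bar>c v'\<bar>)" using le[OF v(2)] by (intro ennreal_leI) linarith
    also note one[OF v(2)]
    finally show ?thesis .
  next
    case 3
    then have "ennreal (h v + f v) + ennreal (h v' - f v') = ennreal (h v + f v)"
      by (simp add: ennreal_neg)
    also have "\<dots> \<le> ennreal (h v + \<bar>c v\<bar>)" using le[OF v(1)] by (intro ennreal_leI) linarith
    also note one[OF v(1)]
    finally show ?thesis .
  qed
qed

text \<open>Only the positive part of \<open>f\<close> counts on the right. This is the form in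
  which Jensen's inequality is applied to truncated suprema.\<close>

lemma ennreal_integral_le_nn_integral:
  fixes f :: "'a \<Rightarrow> real"
  assumes "integrable M f"
  shows "ennreal (integral\<^sup>L M f) \<le> (\<integral>\<^sup>+x. ennreal (f x) \<partial>M)"
proof -
  have fin: "(\<integral>\<^sup>+x. ennreal (f x) \<partial>M) < \<top>"
    using real_integrable_def[of M f] assms by (auto simp: less_top)
  have "integral\<^sup>L M f \<le> enn2real (\<integral>\<^sup>+x. ennreal (f x) \<partial>M)"
    using real_lebesgue_integral_def[OF assms] by simp
  then have "ennreal (integral\<^sup>L M f) \<le> ennreal (enn2real (\<integral>\<^sup>+x. ennreal (f x) \<partial>M))" by (rule ennreal_leI)
  then show ?thesis using fin by simp
qed

text \<open>Centring is replaced by random signs: write \<open>2 (h + f (x - m)) = (h + 2 f x) + (h - 2 f m)\<close> and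
  apply Jensen's inequality to the second term. No independent copy is needed.\<close>

lemma SUP_symmetrization_step:
  fixes h f c :: "'v \<Rightarrow> real" and D :: "nat measure"
  assumes D: "prob_space D" "sets D = UNIV" "integrable D real"
    and lip: "\<And>v v'. v \<in> V \<Longrightarrow> v' \<in> V \<Longrightarrow> \<bar>f v - f v'\<bar> \<le> \<bar>c v - c v'\<bar>"
    and le: "\<And>v. v \<in> V \<Longrightarrow> \<bar>f v\<bar> \<le> \<bar>c v\<bar>"
  shows "2 * (\<integral>\<^sup>+x. (SUP v\<in>V. ennreal (h v + f v * (real x - (LINT y|D. real y)))) \<partial>D) \<le>
    (\<integral>\<^sup>+x. (SUP v\<in>V. ennreal (h v + 2 * c v * real x)) \<partial>D) +
    (\<integral>\<^sup>+x. (SUP v\<in>V. ennreal (h v - 2 * c v * real x)) \<partial>D)"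
proof -
  interpret prob_space D by fact
  have spD: "space D = UNIV" using D(2) sets.top[of D] sets.sets_into_space[of UNIV D] by auto
  \<comment> \<open>On a discrete space every function is measurable, including suprema over an
    arbitrary \<open>V\<close>.\<close>
  have meas[measurable]: "g \<in> borel_measurable D" for g :: "nat \<Rightarrow> ennreal"
    using D(2) by (auto simp: measurable_def spD)
  define m where "m = (LINT y|D. real y)"
  let ?P = "\<lambda>x. SUP v\<in>V. ennreal (h v + 2 * f v * real x)"
  let ?N = "\<lambda>x. SUP v\<in>V. ennreal (h v - 2 * f v * real x)"
  have k: "(SUP v\<in>V. ennreal (h v - 2 * f v * m)) \<le> (\<integral>\<^sup>+x. ?N x \<partial>D)"
  proof (rule SUP_least)
    fix v assume v: "v \<in> V"
    have "h v - 2 * f v * m = (LINT x|D. h v - 2 * f v * real x)"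
      using D(3) prob_space by (simp add: m_def spD)
    then have "ennreal (h v - 2 * f v * m) \<le> (\<integral>\<^sup>+x. ennreal (h v - 2 * f v * real x) \<partial>D)"
      using ennreal_integral_le_nn_integral[of D "\<lambda>x. h v - 2 * f v * real x"] D(3) by simp
    also have "\<dots> \<le> (\<integral>\<^sup>+x. ?N x \<partial>D)" by (intro nn_integral_mono SUP_upper v)
    finally show "ennreal (h v - 2 * f v * m) \<le> (\<integral>\<^sup>+x. ?N x \<partial>D)" .
  qed
  have "2 * (\<integral>\<^sup>+x. (SUP v\<in>V. ennreal (h v + f v * (real x - m))) \<partial>D) =
    (\<integral>\<^sup>+x. 2 * (SUP v\<in>V. ennreal (h v + f v * (real x - m))) \<partial>D)"
    by (rule nn_integral_cmult[symmetric]) simp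
  also have "\<dots> \<le> (\<integral>\<^sup>+x. ?P x + (SUP v\<in>V. ennreal (h v - 2 * f v * m)) \<partial>D)"
  proof (intro nn_integral_mono)
    fix x
    have "2 * ennreal (h v + f v * (real x - m)) \<le> ?P x + (SUP v\<in>V. ennreal (h v - 2 * f v * m))" if v: "v \<in> V" for v
    proof -
      have "2 * ennreal (h v + f v * (real x - m)) = ennreal (2 * (h v + f v * (real x - m)))"
        by (subst ennreal_mult') auto
      also have "2 * (h v + f v * (real x - m)) = (h v + 2 * f v * real x) + (h v - 2 * f v * m)"
        by (simp add: algebra_simps)
      also have "ennreal \<dots> \<le> ennreal (h v + 2 * f v * real x) + ennreal (h v - 2 * f v * m)"
        by (rule ennreal_add_le)
      also have "\<dots> \<le> ?P x + (SUP v\<in>V. ennreal (h v - 2 * f v * m))"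
        using v by (intro add_mono SUP_upper)
      finally show ?thesis .
    qed
    then show "2 * (SUP v\<in>V. ennreal (h v + f v * (real x - m))) \<le> ?P x + (SUP v\<in>V. ennreal (h v - 2 * f v * m))"
      by (simp add: SUP_mult_left_ennreal SUP_least)
  qed
  also have "\<dots> = (\<integral>\<^sup>+x. ?P x \<partial>D) + (SUP v\<in>V. ennreal (h v - 2 * f v * m))"
    by (subst nn_integral_add) (auto simp: emeasure_space_1)
  also have "\<dots> \<le> (\<integral>\<^sup>+x. ?P x \<partial>D) + (\<integral>\<^sup>+x. ?N x \<partial>D)"
    by (intro add_left_mono k)
  also have "\<dots> = (\<integral>\<^sup>+x. ?P x + ?N x \<partial>D)" by (rule nn_integral_add[symmetric]) auto
  also have "\<dots> \<le> (\<integral>\<^sup>+x. (SUP v\<in>V. ennreal (h v + 2 * c v * real x)) + (SUP v\<in>V. ennreal (h v - 2 * c v * real x)) \<partial>D)"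
  proof (intro nn_integral_mono SUP_contraction)
    fix x v v' assume v: "v \<in> V" "v' \<in> V"
    have "\<bar>f v - f v'\<bar> * (2 * real x) \<le> \<bar>c v - c v'\<bar> * (2 * real x)"
      by (intro mult_right_mono lip v) auto
    moreover have "2 * p * real x - 2 * p' * real x = (p - p') * (2 * real x)" for p p'
      by (simp add: algebra_simps)
    ultimately show "\<bar>2 * f v * real x - 2 * f v' * real x\<bar> \<le> \<bar>2 * c v * real x - 2 * c v' * real x\<bar>"
      by (simp add: abs_mult)
  next
    fix x v assume "v \<in> V"
    then show "\<bar>2 * f v * real x\<bar> \<le> \<bar>2 * c v * real x\<bar>"
      using le[of v] by (simp add: abs_mult mult_right_mono)
  qed
  also have "\<dots> = (\<integral>\<^sup>+x. (SUP v\<in>V. ennreal (h v + 2 * c v * real x)) \<partial>D) +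
    (\<integral>\<^sup>+x. (SUP v\<in>V. ennreal (h v - 2 * c v * real x)) \<partial>D)" by (rule nn_integral_add) auto
  finally show ?thesis by (simp only: m_def)
qed

text \<open>A finite product of countable discrete spaces is discrete. This disposes of all
  measurability questions about suprema of functions of finitely many counts.\<close>

lemma measurable_PiM_nat:
  fixes D :: "'i \<Rightarrow> nat measure" and g :: "('i \<Rightarrow> nat) \<Rightarrow> 'b::topological_space"
  assumes "finite I" "\<And>i. i \<in> I \<Longrightarrow> sets (D i) = UNIV"
  shows "g \<in> borel_measurable (PiM I D)"
proof -
  have "sets (PiM I D) = sets (PiM I (\<lambda>_. count_space UNIV))"
    using assms(2) by (intro sets_PiM_cong) auto
  also have "\<dots> = sets (count_space (PiE I (\<lambda>_. UNIV)))"
    by (subst count_space_PiM_finite) (auto simp: assms(1))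
  finally have "borel_measurable (PiM I D) = (borel_measurable (count_space (PiE I (\<lambda>_. UNIV))) :: (('i \<Rightarrow> nat) \<Rightarrow> 'b) set)"
    by (rule measurable_cong_sets) (rule refl)
  then show ?thesis
    by (simp add: PiE_def Pi_def)
qed

text \<open>Induction on the coordinates, with \<open>h\<close> general so that it absorbs the
  coordinate already treated. A set \<open>S\<close> encodes the sign vector that is positive
  exactly on \<open>S\<close>; the power of 2 on the left turns the sum over \<open>S\<close> into
  an average over signs.\<close>

lemma SUP_symmetrization:
  fixes D :: "'i \<Rightarrow> nat measure" and f c :: "'v \<Rightarrow> 'i \<Rightarrow> real"
  assumes I: "finite I"
    and D: "\<And>i. prob_space (D i)" "\<And>i. sets (D i) = UNIV" "\<And>i. integrable (D i) real"
    and lip: "\<And>i v v'. v \<in> V \<Longrightarrow> v' \<in> V \<Longrightarrow> \<bar>f v i - f v' i\<bar> \<le> \<bar>c v i - c v' i\<bar>"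
    and le: "\<And>i v. v \<in> V \<Longrightarrow> \<bar>f v i\<bar> \<le> \<bar>c v i\<bar>"
  shows "2 ^ card I * (\<integral>\<^sup>+x. (SUP v\<in>V. ennreal (h v + (\<Sum>i\<in>I. f v i * (real (x i) - (LINT y|D i. real y))))) \<partial>PiM I D) \<le>
    (\<Sum>S\<in>Pow I. \<integral>\<^sup>+x. (SUP v\<in>V. ennreal (h v + (\<Sum>i\<in>I. (if i \<in> S then 2 else - 2) * c v i * real (x i)))) \<partial>PiM I D)"
  using I
proof (induction I arbitrary: h rule: finite_induct)
  case empty
  then show ?case by simp
next
  case (insert i I)
  interpret product_sigma_finite D
    by (rule product_sigma_finite.intro) (rule prob_space_imp_sigma_finite[OF D(1)])
  note meas = measurable_PiM_nat[where D=D and 'b=ennreal, OF _ D(2)]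
  have measi: "g \<in> borel_measurable (D i)" for g :: "nat \<Rightarrow> ennreal"
    using D(2)[of i] sets.sets_into_space[of UNIV "D i"] by (auto simp: measurable_def)
  note finI = \<open>finite I\<close> and iI = \<open>i \<notin> I\<close>
  have fin': "finite (insert i I)" using finI by simp
  define m where "m j = (LINT y|D j. real y)" for j
  define n where "n = card I"
  define T where "T v x = (\<Sum>j\<in>I. f v j * (real (x j) - m j))" for v x
  define U where "U S v x = (\<Sum>j\<in>I. (if j \<in> S then 2 else - 2) * c v j * real (x j))" for S v x
  have T_upd: "T v (x(i := y)) = T v x" for v x y
    unfolding T_def using iI by (intro sum.cong) auto
  have U_upd: "U S v (x(i := y)) = U S v x" "U (insert i S) v x = U S v x" for S v x y
    unfolding U_def using iI by (auto intro!: sum.cong)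
  \<comment> \<open>The order of integration is exchanged so that the induction hypothesis applies
    for each fixed value \<open>y\<close> of coordinate \<open>i\<close>, with offset
    \<open>h v + q * c v i * real y\<close>. The number \<open>q\<close> will be 2 or -2.\<close>
  have half: "2 ^ n * (\<integral>\<^sup>+x. \<integral>\<^sup>+y. (SUP v\<in>V. ennreal (h v + q * c v i * real y + T v x)) \<partial>D i \<partial>PiM I D) \<le>
     (\<Sum>S\<in>Pow I. \<integral>\<^sup>+x. (SUP v\<in>V. ennreal (h v + q * c v i * real (x i) + U S v x)) \<partial>PiM (insert i I) D)" for q
  proof -
    let ?G = "\<lambda>z. SUP v\<in>V. ennreal (h v + q * c v i * real (z i) + T v z)"
    have "(\<integral>\<^sup>+x. \<integral>\<^sup>+y. (SUP v\<in>V. ennreal (h v + q * c v i * real y + T v x)) \<partial>D i \<partial>PiM I D) =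
        (\<integral>\<^sup>+x. \<integral>\<^sup>+y. ?G (x(i := y)) \<partial>D i \<partial>PiM I D)"
      by (simp add: T_upd)
    also have "\<dots> = (\<integral>\<^sup>+y. \<integral>\<^sup>+x. ?G (x(i := y)) \<partial>PiM I D \<partial>D i)"
      by (subst product_nn_integral_insert[symmetric, OF finI iI meas[OF fin']])
         (rule product_nn_integral_insert_rev[OF finI iI meas[OF fin']])
    also have "\<dots> = (\<integral>\<^sup>+y. \<integral>\<^sup>+x. (SUP v\<in>V. ennreal (h v + q * c v i * real y + T v x)) \<partial>PiM I D \<partial>D i)"
      by (simp add: T_upd)
    finally have "2 ^ n * (\<integral>\<^sup>+x. \<integral>\<^sup>+y. (SUP v\<in>V. ennreal (h v + q * c v i * real y + T v x)) \<partial>D i \<partial>PiM I D) =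
      (\<integral>\<^sup>+y. 2 ^ n * (\<integral>\<^sup>+x. (SUP v\<in>V. ennreal (h v + q * c v i * real y + T v x)) \<partial>PiM I D) \<partial>D i)"
      by (simp add: nn_integral_cmult measi)
    also have "\<dots> \<le> (\<integral>\<^sup>+y. (\<Sum>S\<in>Pow I. \<integral>\<^sup>+x. (SUP v\<in>V. ennreal (h v + q * c v i * real y + U S v x)) \<partial>PiM I D) \<partial>D i)"
      unfolding n_def T_def U_def m_def by (intro nn_integral_mono insert.IH)
    also have "\<dots> = (\<Sum>S\<in>Pow I. \<integral>\<^sup>+y. \<integral>\<^sup>+x. (SUP v\<in>V. ennreal (h v + q * c v i * real y + U S v x)) \<partial>PiM I D \<partial>D i)"
      by (rule nn_integral_sum) (rule measi)
    also have "\<dots> = (\<Sum>S\<in>Pow I. \<integral>\<^sup>+x. (SUP v\<in>V. ennreal (h v + q * c v i * real (x i) + U S v x)) \<partial>PiM (insert i I) D)"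
      by (subst product_nn_integral_insert_rev[OF finI iI meas[OF fin']]) (simp add: U_upd)
    finally show ?thesis .
  qed
  have "2 ^ card (insert i I) * (\<integral>\<^sup>+x. (SUP v\<in>V. ennreal (h v + (\<Sum>i\<in>insert i I. f v i * (real (x i) - m i)))) \<partial>PiM (insert i I) D)
      = 2 ^ n * (2 * (\<integral>\<^sup>+x. \<integral>\<^sup>+y. (SUP v\<in>V. ennreal (h v + T v x + f v i * (real y - m i))) \<partial>D i \<partial>PiM I D))"
    by (subst product_nn_integral_insert[OF finI iI meas[OF fin']])
       (use finI iI in \<open>simp add: n_def T_upd T_def[symmetric] mult_ac add_ac del: fun_upd_apply add: fun_upd_same\<close>)
  also have "2 * (\<integral>\<^sup>+x. \<integral>\<^sup>+y. (SUP v\<in>V. ennreal (h v + T v x + f v i * (real y - m i))) \<partial>D i \<partial>PiM I D) =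
      (\<integral>\<^sup>+x. 2 * (\<integral>\<^sup>+y. (SUP v\<in>V. ennreal (h v + T v x + f v i * (real y - m i))) \<partial>D i) \<partial>PiM I D)"
    by (rule nn_integral_cmult[symmetric]) (rule meas[OF finI])
  also have "\<dots> \<le> (\<integral>\<^sup>+x. (\<integral>\<^sup>+y. (SUP v\<in>V. ennreal (h v + T v x + 2 * c v i * real y)) \<partial>D i) +
      (\<integral>\<^sup>+y. (SUP v\<in>V. ennreal (h v + T v x - 2 * c v i * real y)) \<partial>D i) \<partial>PiM I D)"
    unfolding m_def by (intro nn_integral_mono SUP_symmetrization_step D lip le)
  also have "\<dots> = (\<integral>\<^sup>+x. \<integral>\<^sup>+y. (SUP v\<in>V. ennreal (h v + 2 * c v i * real y + T v x)) \<partial>D i \<partial>PiM I D) +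
      (\<integral>\<^sup>+x. \<integral>\<^sup>+y. (SUP v\<in>V. ennreal (h v + (- 2) * c v i * real y + T v x)) \<partial>D i \<partial>PiM I D)"
    by (subst nn_integral_add) (auto intro!: meas[OF finI] simp: algebra_simps)
  also have "2 ^ n * \<dots> \<le>
     (\<Sum>S\<in>Pow I. \<integral>\<^sup>+x. (SUP v\<in>V. ennreal (h v + 2 * c v i * real (x i) + U S v x)) \<partial>PiM (insert i I) D) +
     (\<Sum>S\<in>Pow I. \<integral>\<^sup>+x. (SUP v\<in>V. ennreal (h v + (- 2) * c v i * real (x i) + U S v x)) \<partial>PiM (insert i I) D)"
    unfolding distrib_left by (intro add_mono half)
  \<comment> \<open>Sets that contain \<open>i\<close> give the positive sign at \<open>i\<close>,
    the others the negative one; the two sums are the two halves of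
    \<open>Pow (insert i I)\<close>.\<close>
  also have "\<dots> = (\<Sum>S\<in>Pow (insert i I). \<integral>\<^sup>+x. (SUP v\<in>V. ennreal (h v + (\<Sum>i\<in>insert i I. (if i \<in> S then 2 else - 2) * c v i * real (x i)))) \<partial>PiM (insert i I) D)"
    (is "?a + ?b = sum ?F _")
  proof -
    have "sum ?F (Pow (insert i I)) = sum ?F (Pow I) + sum ?F (insert i ` Pow I)"
      unfolding Pow_insert using finI iI by (intro sum.union_disjoint) auto
    also have "sum ?F (insert i ` Pow I) = (\<Sum>S\<in>Pow I. ?F (insert i S))"
      using iI by (subst sum.reindex) (auto simp: inj_on_def)
    also have "\<dots> = ?a"
    proof -
      have "(\<Sum>j\<in>insert i I. (if j \<in> insert i S then 2 else - 2) * c v j * real (x j)) = 2 * c v i * real (x i) + U (insert i S) v x" for S v x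
        unfolding U_def using finI iI by (subst sum.insert) auto
      then show ?thesis by (simp only: U_upd add.assoc)
    qed
    also have "sum ?F (Pow I) = ?b"
    proof (intro sum.cong refl)
      fix S assume "S \<in> Pow I"
      then have "i \<notin> S" using iI by auto
      then have "(\<Sum>j\<in>insert i I. (if j \<in> S then 2 else - 2) * c v j * real (x j)) = (- 2) * c v i * real (x i) + U S v x" for v x
        unfolding U_def using finI iI by (subst sum.insert) auto
      then show "?F S = (\<integral>\<^sup>+x. (SUP v\<in>V. ennreal (h v + (- 2) * c v i * real (x i) + U S v x)) \<partial>PiM (insert i I) D)"
        by (simp only: add.assoc)
    qed
    finally show ?thesis by (simp add: add_ac)
  qed
  finally show ?case unfolding m_def by (simp only: mult_left_mono zero_le)
qed

text \<open>Toggling the membership of \<open>i\<close> is an involution of \<open>Pow I\<close>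
  that changes the first sign and, as \<open>j\<close> differs from \<open>i\<close>, leaves the
  second one alone.\<close>

lemma sum_signs_orthogonal:
  assumes "finite I" "i \<in> I" "i \<noteq> j"
  shows "(\<Sum>S\<in>Pow I. (if i \<in> S then 1 else - 1) * (if j \<in> S then 1 else - 1)) = (0::real)" (is "?s = 0")
proof -
  define t where "t S = (if i \<in> S then S - {i} else insert i S)" for S
  have "?s = (\<Sum>S\<in>Pow I. - ((if i \<in> S then 1 else - 1) * (if j \<in> S then 1 else - 1)))"
    by (rule sum.reindex_bij_witness[of _ t t]) (use assms in \<open>auto simp: t_def\<close>)
  then have "?s = - ?s" by (simp only: sum_negf)
  then show ?thesis by simp
qed

lemma sum_signs_quadratic_form:
  fixes b :: "'i \<Rightarrow> real"
  assumes "finite I"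
  defines "e \<equiv> \<lambda>S i. if i \<in> S then 1 else - 1 :: real"
  shows "(\<Sum>S\<in>Pow I. \<Sum>i\<in>I. \<Sum>j\<in>I. (e S i * b i) * (e S j * b j) * K i j) = 2 ^ card I * (\<Sum>i\<in>I. (b i)\<^sup>2 * K i i)"
proof -
  have "(\<Sum>S\<in>Pow I. \<Sum>i\<in>I. \<Sum>j\<in>I. (e S i * b i) * (e S j * b j) * K i j) =
    (\<Sum>i\<in>I. \<Sum>j\<in>I. (\<Sum>S\<in>Pow I. e S i * e S j) * (b i * b j * K i j))"
    by (subst sum.swap, intro sum.cong refl, subst sum.swap, intro sum.cong refl)
       (simp add: sum_distrib_left mult_ac)
  also have "\<dots> = (\<Sum>i\<in>I. \<Sum>j\<in>I. if i = j then 2 ^ card I * ((b i)\<^sup>2 * K i i) else 0)"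
  proof (intro sum.cong refl)
    fix i j assume ij: "i \<in> I" "j \<in> I"
    have "e S i * e S i = 1" for S by (simp add: e_def)
    then have "(\<Sum>S\<in>Pow I. e S i * e S i) = 2 ^ card I" using assms by (simp add: card_Pow)
    then show "(\<Sum>S\<in>Pow I. e S i * e S j) * (b i * b j * K i j) = (if i = j then 2 ^ card I * ((b i)\<^sup>2 * K i i) else 0)"
      using sum_signs_orthogonal[OF assms(1) ij(1), of j] by (auto simp: e_def power2_eq_square)
  qed
  also have "\<dots> = 2 ^ card I * (\<Sum>i\<in>I. (b i)\<^sup>2 * K i i)"
    using assms by (simp add: sum_distrib_left)
  finally show ?thesis .
qed

text \<open>A family whose evaluations are controlled by a positive semidefinite kernel \<open>K\<close> is a ball of a
  reproducing kernel Hilbert space; averaging over signs only leaves the diagonal of \<open>K\<close>.\<close>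

lemma expected_SUP_le:
  fixes D :: "'i \<Rightarrow> nat measure" and f c :: "'v \<Rightarrow> 'i \<Rightarrow> real"
  assumes I: "finite I"
    and D: "\<And>i. prob_space (D i)" "\<And>i. sets (D i) = UNIV" "\<And>i. integrable (D i) real"
    and lip: "\<And>i v v'. v \<in> V \<Longrightarrow> v' \<in> V \<Longrightarrow> \<bar>f v i - f v' i\<bar> \<le> \<bar>c v i - c v' i\<bar>"
    and le: "\<And>i v. v \<in> V \<Longrightarrow> \<bar>f v i\<bar> \<le> \<bar>c v i\<bar>"
    and C: "C \<ge> 0" and \<kappa>: "\<And>i. i \<in> I \<Longrightarrow> K i i \<le> \<kappa>"
    and ker: "\<And>v b. v \<in> V \<Longrightarrow> (\<Sum>i\<in>I. b i * c v i)\<^sup>2 \<le> C\<^sup>2 * (\<Sum>i\<in>I. \<Sum>j\<in>I. b i * b j * K i j)"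
    and K0: "\<And>b. 0 \<le> (\<Sum>i\<in>I. \<Sum>j\<in>I. b i * b j * K i j)"
  shows "(\<integral>\<^sup>+x. (SUP v\<in>V. ennreal (\<Sum>i\<in>I. f v i * (real (x i) - (LINT y|D i. real y)))) \<partial>PiM I D) \<le>
    (\<integral>\<^sup>+x. ennreal (2 * C * sqrt \<kappa> * sqrt (\<Sum>i\<in>I. (real (x i))\<^sup>2)) \<partial>PiM I D)"
proof -
  define e where "e S i = (if i \<in> S then 1 else - 1 :: real)" for S :: "'i set" and i
  define Q where "Q S x = (\<Sum>i\<in>I. \<Sum>j\<in>I. (e S i * (2 * real (x i))) * (e S j * (2 * real (x j))) * K i j)" for S and x :: "'i \<Rightarrow> nat"
  note meas = measurable_PiM_nat[where D=D and 'b=ennreal, OF I D(2)]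
  define L where "L = (\<integral>\<^sup>+x. (SUP v\<in>V. ennreal (\<Sum>i\<in>I. f v i * (real (x i) - (LINT y|D i. real y)))) \<partial>PiM I D)"
  have Q0: "Q S x \<ge> 0" for S x
    unfolding Q_def using K0[of "\<lambda>i. e S i * (2 * real (x i))"] by simp
  have "2 ^ card I * L \<le>
    (\<Sum>S\<in>Pow I. \<integral>\<^sup>+x. (SUP v\<in>V. ennreal (\<Sum>i\<in>I. (if i \<in> S then 2 else - 2) * c v i * real (x i))) \<partial>PiM I D)"
    unfolding L_def using SUP_symmetrization[OF I D lip le, where h="\<lambda>_. 0"] by simp
  also have "\<dots> = (\<integral>\<^sup>+x. (\<Sum>S\<in>Pow I. (SUP v\<in>V. ennreal (\<Sum>i\<in>I. (if i \<in> S then 2 else - 2) * c v i * real (x i)))) \<partial>PiM I D)"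
    by (rule nn_integral_sum[symmetric]) (rule meas)
  also have "\<dots> \<le> (\<integral>\<^sup>+x. 2 ^ card I * ennreal (2 * C * sqrt \<kappa> * sqrt (\<Sum>i\<in>I. (real (x i))\<^sup>2)) \<partial>PiM I D)"
  proof (intro nn_integral_mono)
    fix x :: "'i \<Rightarrow> nat"
    \<comment> \<open>For a fixed sign vector the kernel bound, with the signed doubled counts as
      weights, holds for all \<open>v\<close> at once; the supremum is gone before the signs are
      averaged.\<close>
    have "(SUP v\<in>V. ennreal (\<Sum>i\<in>I. (if i \<in> S then 2 else - 2) * c v i * real (x i))) \<le> ennreal (C * sqrt (Q S x))" for S
    proof (intro SUP_least ennreal_leI)
      fix v assume v: "v \<in> V"
      have "(\<Sum>i\<in>I. (if i \<in> S then 2 else - 2) * c v i * real (x i)) = (\<Sum>i\<in>I. (e S i * (2 * real (x i))) * c v i)"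
        by (intro sum.cong) (auto simp: e_def)
      also have "\<dots> \<le> sqrt ((\<Sum>i\<in>I. (e S i * (2 * real (x i))) * c v i)\<^sup>2)" by simp
      also have "\<dots> \<le> sqrt (C\<^sup>2 * Q S x)"
        unfolding Q_def using ker[OF v] by (rule real_sqrt_le_mono)
      also have "\<dots> = C * sqrt (Q S x)" using C by (simp add: real_sqrt_mult)
      finally show "(\<Sum>i\<in>I. (if i \<in> S then 2 else - 2) * c v i * real (x i)) \<le> C * sqrt (Q S x)" .
    qed
    then have "(\<Sum>S\<in>Pow I. (SUP v\<in>V. ennreal (\<Sum>i\<in>I. (if i \<in> S then 2 else - 2) * c v i * real (x i)))) \<le>
      (\<Sum>S\<in>Pow I. ennreal (C * sqrt (Q S x)))" by (intro sum_mono)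
    also have "\<dots> = ennreal (C * (\<Sum>S\<in>Pow I. sqrt (Q S x)))"
      using C Q0 by (simp add: sum_distrib_left)
    also have "\<dots> \<le> ennreal (2 ^ card I * (2 * C * sqrt \<kappa> * sqrt (\<Sum>i\<in>I. (real (x i))\<^sup>2)))"
    proof (rule ennreal_leI)
      \<comment> \<open>Cauchy--Schwarz moves the average over signs under the root, where the cross
        terms of \<open>Q\<close> cancel.\<close>
      have "(\<Sum>S\<in>Pow I. sqrt (Q S x))\<^sup>2 \<le> (\<Sum>S\<in>Pow I. 1\<^sup>2) * (\<Sum>S\<in>Pow I. (sqrt (Q S x))\<^sup>2)"
        using Cauchy_Schwarz_ineq_sum[of "\<lambda>_. 1" "\<lambda>S. sqrt (Q S x)" "Pow I"] by simp
      also have "\<dots> = 2 ^ card I * (\<Sum>S\<in>Pow I. Q S x)" using I Q0 by (simp add: card_Pow)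
      also have "(\<Sum>S\<in>Pow I. Q S x) = 2 ^ card I * (\<Sum>i\<in>I. (2 * real (x i))\<^sup>2 * K i i)"
        unfolding Q_def e_def by (rule sum_signs_quadratic_form[OF I])
      also have "2 ^ card I * (2 ^ card I * (\<Sum>i\<in>I. (2 * real (x i))\<^sup>2 * K i i)) \<le> 2 ^ card I * (2 ^ card I * (\<Sum>i\<in>I. (2 * real (x i))\<^sup>2 * \<kappa>))"
        by (intro mult_left_mono sum_mono \<kappa>) auto
      also have "\<dots> = (2 ^ card I * 2)\<^sup>2 * (\<kappa> * (\<Sum>i\<in>I. (real (x i))\<^sup>2))"
        by (simp add: power2_eq_square sum_distrib_left mult_ac)
      finally have "sqrt ((\<Sum>S\<in>Pow I. sqrt (Q S x))\<^sup>2) \<le> sqrt ((2 ^ card I * 2)\<^sup>2 * (\<kappa> * (\<Sum>i\<in>I. (real (x i))\<^sup>2)))"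
        by (rule real_sqrt_le_mono)
      then have "(\<Sum>S\<in>Pow I. sqrt (Q S x)) \<le> 2 ^ card I * 2 * (sqrt \<kappa> * sqrt (\<Sum>i\<in>I. (real (x i))\<^sup>2))"
        by (simp add: real_sqrt_mult)
      then have "C * (\<Sum>S\<in>Pow I. sqrt (Q S x)) \<le> C * (2 ^ card I * 2 * (sqrt \<kappa> * sqrt (\<Sum>i\<in>I. (real (x i))\<^sup>2)))"
        by (rule mult_left_mono[OF _ C])
      then show "C * (\<Sum>S\<in>Pow I. sqrt (Q S x)) \<le> 2 ^ card I * (2 * C * sqrt \<kappa> * sqrt (\<Sum>i\<in>I. (real (x i))\<^sup>2))"
        by (simp only: mult_ac)
    qed
    also have "\<dots> = 2 ^ card I * ennreal (2 * C * sqrt \<kappa> * sqrt (\<Sum>i\<in>I. (real (x i))\<^sup>2))"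
      by (subst ennreal_mult') (auto simp flip: ennreal_power)
    finally show "(\<Sum>S\<in>Pow I. (SUP v\<in>V. ennreal (\<Sum>i\<in>I. (if i \<in> S then 2 else - 2) * c v i * real (x i)))) \<le>
      2 ^ card I * ennreal (2 * C * sqrt \<kappa> * sqrt (\<Sum>i\<in>I. (real (x i))\<^sup>2))" .
  qed
  also have "\<dots> = 2 ^ card I * (\<integral>\<^sup>+x. ennreal (2 * C * sqrt \<kappa> * sqrt (\<Sum>i\<in>I. (real (x i))\<^sup>2)) \<partial>PiM I D)"
    by (rule nn_integral_cmult) (rule meas)
  finally have "2 ^ card I * L \<le> 2 ^ card I * (\<integral>\<^sup>+x. ennreal (2 * C * sqrt \<kappa> * sqrt (\<Sum>i\<in>I. (real (x i))\<^sup>2)) \<partial>PiM I D)" .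
  moreover have "(2::ennreal) ^ card I = ennreal (2 ^ card I)" by (simp flip: ennreal_power)
  ultimately show ?thesis unfolding L_def
    by (simp add: ennreal_mult_le_mult_iff)
qed

section \<open>The empirical process of a Poisson process\<close>

text \<open>The cells are the atoms of a finite cover by balls: points share a cell when they lie in
  the same balls. They then have a common centre at distance below \<delta>/2.\<close>

lemma fine_borel_partition:
  fixes M :: "'a::euclidean_space set"
  assumes M: "bounded M" "M \<in> sets borel" and \<delta>: "\<delta> > 0"
  obtains \<A> where "finite \<A>" "partition_on M \<A>" "\<A> \<subseteq> sets borel"
    "\<And>A x y. A \<in> \<A> \<Longrightarrow> x \<in> A \<Longrightarrow> y \<in> A \<Longrightarrow> dist x y < \<delta>"
proof -
  have "compact (closure M)" using M by (simp add: compact_closure)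
  then obtain C where C: "finite C" "closure M \<subseteq> (\<Union>c\<in>C. ball c (\<delta> / 2))"
    using \<delta> unfolding compact_eq_totally_bounded by (meson half_gt_zero)
  define near where "near x = {c \<in> C. x \<in> ball c (\<delta> / 2)}" for x
  define cell where "cell T = {x \<in> M. near x = T}" for T
  define \<A> where "\<A> = cell ` near ` M"
  show ?thesis
  proof
    have "near ` M \<subseteq> Pow C" by (auto simp: near_def)
    then have "finite (near ` M)" using C(1) finite_subset by blast
    then show "finite \<A>" by (simp add: \<A>_def)
    show "partition_on M \<A>"
      by (rule partition_onI) (auto simp: \<A>_def cell_def disjnt_def)
    show "\<A> \<subseteq> sets borel"
    proof
      fix A assume "A \<in> \<A>"
      then obtain T where T: "A = cell T" "T \<subseteq> C" by (auto simp: \<A>_def near_def)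
      have "A = M - ((\<Union>c\<in>T. - ball c (\<delta> / 2)) \<union> (\<Union>c\<in>C - T. ball c (\<delta> / 2)))"
        using T by (auto simp: cell_def near_def)
      also have "\<dots> \<in> sets borel"
        using M T C(1) finite_subset[OF T(2) C(1)]
        by (intro sets.Diff sets.Un sets.finite_UN) auto
      finally show "A \<in> sets borel" .
    qed
    fix A x y assume A: "A \<in> \<A>" "x \<in> A" "y \<in> A"
    then have xy: "x \<in> M" "near x = near y" by (auto simp: \<A>_def cell_def)
    then obtain c where c: "c \<in> near x" using C(2) closure_subset[of M] by (auto simp: near_def)
    then have "dist c x < \<delta> / 2" "dist c y < \<delta> / 2" using xy by (auto simp: near_def)
    then show "dist x y < \<delta>" by (metis dist_commute dist_triangle_half_r)
  qed
qed

section \<open>Counting points of a multiset in cells\<close>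

lemma points_in_superset: "set_mset X \<subseteq> A \<Longrightarrow> points_in X A = size X"
  unfolding points_in_def by (metis filter_mset_True filter_mset_cong subsetD)

lemma sum_mset_step_function:
  "(\<Sum>x\<in>#X. \<Sum>A\<in>\<A>. c A * indicator A x) = (\<Sum>A\<in>\<A>. c A * real (points_in X A))"
proof (induction X)
  case (add x X)
  have "c A * real (points_in (add_mset x X) A) = c A * indicator A x + c A * real (points_in X A)" for A
    by (simp add: points_in_def indicator_def algebra_simps)
  then show ?case using add by (simp add: sum.distrib)
qed (simp add: points_in_def)

lemma sum_mset_abs_diff_le:
  fixes f g :: "'a \<Rightarrow> real"
  assumes "\<And>x. x \<in># X \<Longrightarrow> \<bar>f x - g x\<bar> \<le> e"
  shows "\<bar>(\<Sum>x\<in>#X. f x) - (\<Sum>x\<in>#X. g x)\<bar> \<le> e * real (size X)"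
  using assms
proof (induction X)
  case (add x X)
  have "\<bar>(\<Sum>x\<in>#X. f x) - (\<Sum>x\<in>#X. g x)\<bar> \<le> e * real (size X)" by (rule add.IH) (simp add: add.prems)
  moreover have "\<bar>f x - g x\<bar> \<le> e" by (rule add.prems) simp
  ultimately show ?case by (simp add: algebra_simps)
qed simp

lemma partition_indicator_sum:
  fixes c :: "'a set \<Rightarrow> real"
  assumes "finite \<A>" "partition_on M \<A>" "A \<in> \<A>" "x \<in> A"
  shows "(\<Sum>B\<in>\<A>. c B * indicator B x) = c A"
proof -
  have "c B * indicator B x = (if B = A then c A else 0)" if "B \<in> \<A>" for B
    using that assms partition_onD2[OF assms(2)] by (auto simp: indicator_def disjoint_def)
  then have "(\<Sum>B\<in>\<A>. c B * indicator B x) = (\<Sum>B\<in>\<A>. if B = A then c A else 0)"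
    by (intro sum.cong) auto
  then show ?thesis using assms by simp
qed

lemma sum_points_in_partition:
  assumes "finite \<A>" "partition_on M \<A>" "set_mset X \<subseteq> M"
  shows "(\<Sum>A\<in>\<A>. points_in X A) = size X"
proof -
  have "(\<Sum>A\<in>\<A>. 1 * real (points_in X A)) = (\<Sum>x\<in>#X. \<Sum>A\<in>\<A>. 1 * indicator A x)"
    by (rule sum_mset_step_function[symmetric])
  also have "\<dots> = (\<Sum>x\<in>#X. 1)"
  proof (intro arg_cong[where f=sum_mset] image_mset_cong)
    fix x assume "x \<in># X"
    then obtain A where "A \<in> \<A>" "x \<in> A" using assms partition_onD1[OF assms(2)] by blast
    then show "(\<Sum>A\<in>\<A>. 1 * indicator A x :: real) = 1" by (rule partition_indicator_sum[OF assms(1,2)])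
  qed
  finally show ?thesis by (simp flip: of_nat_sum)
qed

lemma points_in_small_set:
  assumes cnt: "\<And>x. count X x \<le> 1" and sep: "\<And>x y. x \<in># X \<Longrightarrow> y \<in># X \<Longrightarrow> x \<in> A \<Longrightarrow> y \<in> A \<Longrightarrow> x = y"
  shows "points_in X A \<le> 1"
proof -
  have "points_in X A = (\<Sum>x\<in>set_mset (filter_mset (\<lambda>x. x \<in> A) X). count X x)"
    unfolding points_in_def size_multiset_overloaded_eq by (intro sum.cong) auto
  also have "\<dots> \<le> (\<Sum>x\<in>set_mset (filter_mset (\<lambda>x. x \<in> A) X). 1)"
    by (intro sum_mono cnt)
  also have "\<dots> \<le> 1" using sep by (auto simp: card_le_Suc0_iff_eq)
  finally show ?thesis .
qed

lemma finite_set_separated: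
  fixes S :: "'a::metric_space set"
  assumes "finite S"
  obtains r where "r > 0" "\<And>x y. x \<in> S \<Longrightarrow> y \<in> S \<Longrightarrow> dist x y < r \<Longrightarrow> x = y"
proof -
  \<comment> \<open>The extra element 1 keeps \<open>Z\<close> nonempty when \<open>S\<close> has
    fewer than two points.\<close>
  define Z where "Z = insert 1 ((\<lambda>(x, y). dist x y) ` ((S \<times> S) \<inter> {(x, y). x \<noteq> y}))"
  have Z: "finite Z" "Z \<noteq> {}" using assms by (auto simp: Z_def)
  show ?thesis
  proof
    have "Min Z \<in> Z" using Z by (rule Min_in)
    then show "0 < Min Z" by (auto simp: Z_def)
    fix x y assume "x \<in> S" "y \<in> S" "dist x y < Min Z"
    show "x = y"
    proof (rule ccontr)
      assume "x \<noteq> y"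
      then have "dist x y \<in> Z" using \<open>x \<in> S\<close> \<open>y \<in> S\<close> by (auto simp: Z_def)
      then show False using Min_le[OF Z(1)] \<open>dist x y < Min Z\<close> by fastforce
    qed
  qed
qed

text \<open>Independence over disjoint cells identifies the joint law of the counts with the product
  of their laws, which moves expectations to the product space. Outside the partition
  \<open>D\<close> is the law of the count of the empty set, so that it is a probability measure
  with finite mean for every index, as \<open>expected_SUP_le\<close> asks.\<close>

lemma poisson_process_partition_product:
  fixes M :: "'a::euclidean_space set"
  assumes G: "poisson_process P M h G"
    and \<A>: "finite \<A>" "partition_on M \<A>" "\<A> \<subseteq> sets borel" "M \<noteq> {}"
  defines "D \<equiv> \<lambda>A. distr P (count_space UNIV) (\<lambda>\<omega>. points_in (G \<omega>) (if A \<in> \<A> then A else {}))"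
  shows "\<And>A. prob_space (D A)" "\<And>A. sets (D A) = UNIV" "\<And>A. integrable (D A) real"
    and "\<And>A. A \<in> \<A> \<Longrightarrow> (LINT y|D A. real y) = (LINT x:A|lborel. h x)"
    and "\<And>\<Phi> :: ('a set \<Rightarrow> nat) \<Rightarrow> ennreal.
      (\<integral>\<^sup>+x. \<Phi> x \<partial>PiM \<A> D) = (\<integral>\<^sup>+\<omega>. \<Phi> (\<lambda>A\<in>\<A>. points_in (G \<omega>) A) \<partial>P)"
proof -
  interpret prob_space P using G by (simp add: poisson_process_def)
  have sub: "A \<subseteq> M" if "A \<in> \<A>" for A using that partition_onD1[OF \<A>(2)] by auto
  let ?r = "\<lambda>A. if A \<in> \<A> then A else {}"
  have r: "?r A \<in> sets borel" "?r A \<subseteq> M" for A using sub \<A>(3) by auto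
  have meas: "(\<lambda>\<omega>. points_in (G \<omega>) A) \<in> measurable P (count_space UNIV)"
    and int: "integrable P (\<lambda>\<omega>. real (points_in (G \<omega>) A))"
    and ev: "(LINT \<omega>|P. real (points_in (G \<omega>) A)) = (LINT x:A|lborel. h x)"
    if "A \<in> sets borel" "A \<subseteq> M" for A
    using G that unfolding poisson_process_def by blast+
  show "prob_space (D A)" for A
    unfolding D_def by (rule prob_space_distr[OF meas[OF r]])
  show setsD: "sets (D A) = UNIV" for A by (simp add: D_def)
  show "integrable (D A) real" for A
    unfolding D_def using int[OF r] by (subst integrable_distr_eq[OF meas[OF r]]) simp_all
  show "(LINT y|D A. real y) = (LINT x:A|lborel. h x)" if "A \<in> \<A>" for A
    unfolding D_def by (subst integral_distr[OF meas[OF r]]) (use that ev[of A] \<A>(3) sub[of A] in auto)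
  have ne: "\<A> \<noteq> {}" using \<A>(2,4) partition_onD1 by fastforce
  have "indep_vars (\<lambda>_. count_space UNIV) (\<lambda>A \<omega>. points_in (G \<omega>) A) \<A>"
  proof -
    have "finite \<A> \<longrightarrow> \<A> \<subseteq> {A \<in> sets borel. A \<subseteq> M} \<longrightarrow> disjoint \<A> \<longrightarrow>
        indep_vars (\<lambda>_. count_space UNIV) (\<lambda>A \<omega>. points_in (G \<omega>) A) \<A>"
      using G unfolding poisson_process_def by (elim conjE) (erule spec)
    then show ?thesis using \<A> sub partition_onD2[OF \<A>(2)] by auto
  qed
  then have "distr P (\<Pi>\<^sub>M A\<in>\<A>. count_space UNIV) (\<lambda>\<omega>. \<lambda>A\<in>\<A>. points_in (G \<omega>) A) =
      (\<Pi>\<^sub>M A\<in>\<A>. distr P (count_space UNIV) (\<lambda>\<omega>. points_in (G \<omega>) A))"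
    using \<A>(3) sub by (subst (asm) indep_vars_iff_distr_eq_PiM'[OF ne]) (auto intro: meas)
  also have "\<dots> = PiM \<A> D" unfolding D_def by (intro PiM_cong) auto
  finally have eq: "PiM \<A> D = distr P (\<Pi>\<^sub>M A\<in>\<A>. count_space UNIV) (\<lambda>\<omega>. \<lambda>A\<in>\<A>. points_in (G \<omega>) A)" ..
  have X: "(\<lambda>\<omega>. \<lambda>A\<in>\<A>. points_in (G \<omega>) A) \<in> P \<rightarrow>\<^sub>M (\<Pi>\<^sub>M A\<in>\<A>. count_space UNIV)"
    using \<A>(3) sub by (intro measurable_restrict meas) auto
  show "(\<integral>\<^sup>+x. \<Phi> x \<partial>PiM \<A> D) = (\<integral>\<^sup>+\<omega>. \<Phi> (\<lambda>A\<in>\<A>. points_in (G \<omega>) A) \<partial>P)" for \<Phi> :: "('a set \<Rightarrow> nat) \<Rightarrow> ennreal"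
    unfolding eq by (rule nn_integral_distr[OF X]) (simp add: measurable_PiM_nat \<A>)
qed

text \<open>For a process without multiple points, the numbers of points in the cells of a sufficiently
  fine partition are all \<open>0\<close> or \<open>1\<close>, so that their squares add up to the number of points.\<close>

lemma poisson_expected_sup_le:
  fixes M :: "'a::euclidean_space set" and \<psi> g :: "'v \<Rightarrow> 'a \<Rightarrow> real" and \<kappa> :: "'a \<Rightarrow> real"
  assumes G: "poisson_process P M h G"
    and M: "open M" "bounded M" "M \<noteq> {}"
    and lip: "\<And>v v' x. v \<in> V \<Longrightarrow> v' \<in> V \<Longrightarrow> x \<in> M \<Longrightarrow> \<bar>\<psi> v x - \<psi> v' x\<bar> \<le> \<bar>g v x - g v' x\<bar>"
    and le: "\<And>v x. v \<in> V \<Longrightarrow> x \<in> M \<Longrightarrow> \<bar>\<psi> v x\<bar> \<le> \<bar>g v x\<bar>"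
    and C: "C \<ge> 0"
    and ker: "\<And>v (I :: 'a set set) b y. v \<in> V \<Longrightarrow> finite I \<Longrightarrow> y ` I \<subseteq> M \<Longrightarrow>
      (\<Sum>i\<in>I. b i * g v (y i))\<^sup>2 \<le> C\<^sup>2 * (\<Sum>i\<in>I. \<Sum>j\<in>I. b i * b j * \<kappa> (y i - y j))"
    and psd: "\<And>(I :: 'a set set) b y. finite I \<Longrightarrow> 0 \<le> (\<Sum>i\<in>I. \<Sum>j\<in>I. b i * b j * \<kappa> (y i - y j))"
    and eqc: "\<And>e. e > 0 \<Longrightarrow> \<exists>\<delta>>0. \<forall>v\<in>V. \<forall>x\<in>M. \<forall>y\<in>M. dist x y < \<delta> \<longrightarrow> \<bar>\<psi> v x - \<psi> v y\<bar> \<le> e"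
    and int: "\<And>v. v \<in> V \<Longrightarrow> set_integrable lborel M (\<lambda>x. \<psi> v x * h x)"
    and W: "\<And>\<omega>. \<omega> \<in> space P \<Longrightarrow> \<exists>v\<in>V. W \<omega> \<le> (\<Sum>x\<in>#G \<omega>. \<psi> v x) - (LINT x:M|lborel. \<psi> v x * h x)"
  shows "(\<integral>\<^sup>+\<omega>. ennreal (W \<omega>) \<partial>P) \<le>
    ennreal (2 * C * sqrt (\<kappa> 0)) * (\<integral>\<^sup>+\<omega>. ennreal (sqrt (real (points_in (G \<omega>) M))) \<partial>P)"
proof -
  interpret prob_space P using G by (simp add: poisson_process_def)
  have Mb: "M \<in> sets borel" using M by simp
  have hi: "set_integrable lborel M h" and h0: "AE x in lborel. x \<in> M \<longrightarrow> 0 \<le> h x"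
    and GM: "\<And>\<omega>. \<omega> \<in> space P \<Longrightarrow> set_mset (G \<omega>) \<subseteq> M" and simple: "AE \<omega> in P. \<forall>x. count (G \<omega>) x \<le> 1"
    using G by (auto simp: poisson_process_def)
  have Gmeas: "(\<lambda>\<omega>. points_in (G \<omega>) A) \<in> measurable P (count_space UNIV)"
    and Gint: "integrable P (\<lambda>\<omega>. real (points_in (G \<omega>) A))"
    and Gev: "(LINT \<omega>|P. real (points_in (G \<omega>) A)) = (LINT x:A|lborel. h x)"
    if "A \<in> sets borel" "A \<subseteq> M" for A
    using G that unfolding poisson_process_def by blast+
  define N where "N \<omega> = real (points_in (G \<omega>) M)" for \<omega>
  have Nmeas[measurable]: "N \<in> borel_measurable P" and Nint: "integrable P N"
    using Gint[OF Mb subset_refl] borel_measurable_integrable unfolding N_def[abs_def] by blast+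
  have N0: "N \<omega> \<ge> 0" for \<omega> by (simp add: N_def)
  define \<mu> where "\<mu> = (LINT x:M|lborel. h x)"
  have EN: "integral\<^sup>L P N = \<mu>" using Gev[OF Mb subset_refl] by (simp add: N_def[abs_def] \<mu>_def)
  have \<mu>0: "\<mu> \<ge> 0" unfolding \<mu>_def set_lebesgue_integral_def
    by (rule integral_nonneg_AE) (use h0 in \<open>auto elim!: eventually_mono simp: indicator_def\<close>)
  \<comment> \<open>The same \<open>e n\<close> bounds the diameter of a cell and the oscillation of
    every \<open>\<psi> v\<close> on it. The diameter serves to separate the points of a
    configuration, the oscillation to replace \<open>\<psi> v\<close> by a step function.\<close>
  define e where "e n = 1 / real (Suc n)" for n
  have e0: "e n > 0" for n by (simp add: e_def)
  have "\<exists>\<A>. finite \<A> \<and> partition_on M \<A> \<and> \<A> \<subseteq> sets borel \<and>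
      (\<forall>A\<in>\<A>. \<forall>x\<in>A. \<forall>y\<in>A. dist x y < e n \<and> (\<forall>v\<in>V. \<bar>\<psi> v x - \<psi> v y\<bar> \<le> e n))" for n
  proof -
    obtain \<delta> where \<delta>: "\<delta> > 0" "\<forall>v\<in>V. \<forall>x\<in>M. \<forall>y\<in>M. dist x y < \<delta> \<longrightarrow> \<bar>\<psi> v x - \<psi> v y\<bar> \<le> e n"
      using eqc[OF e0] by blast
    obtain \<A> where \<A>: "finite \<A>" "partition_on M \<A>" "\<A> \<subseteq> sets borel"
      "\<And>A x y. A \<in> \<A> \<Longrightarrow> x \<in> A \<Longrightarrow> y \<in> A \<Longrightarrow> dist x y < min \<delta> (e n)"
      using fine_borel_partition[OF M(2) Mb, of "min \<delta> (e n)"] \<delta>(1) e0 by (metis min_less_iff_conj)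
    have "A \<subseteq> M" if "A \<in> \<A>" for A using that partition_onD1[OF \<A>(2)] by auto
    then have "dist x y < e n \<and> (\<forall>v\<in>V. \<bar>\<psi> v x - \<psi> v y\<bar> \<le> e n)" if "A \<in> \<A>" "x \<in> A" "y \<in> A" for A x y
      using \<A>(4)[OF that] \<delta>(2) that by (meson min_less_iff_conj subsetD)
    with \<A>(1-3) show ?thesis by (intro exI[of _ \<A>]) simp
  qed
  then obtain \<A> where \<A>: "\<And>n. finite (\<A> n)" "\<And>n. partition_on M (\<A> n)" "\<And>n. \<A> n \<subseteq> sets borel"
    and fine: "\<And>n A x y. A \<in> \<A> n \<Longrightarrow> x \<in> A \<Longrightarrow> y \<in> A \<Longrightarrow> dist x y < e n"
    and osc: "\<And>n A x y v. A \<in> \<A> n \<Longrightarrow> x \<in> A \<Longrightarrow> y \<in> A \<Longrightarrow> v \<in> V \<Longrightarrow> \<bar>\<psi> v x - \<psi> v y\<bar> \<le> e n"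
    by metis
  have sub: "A \<subseteq> M" if "A \<in> \<A> n" for A n using that partition_onD1[OF \<A>(2)] by auto
  define Y where "Y A = (SOME x. x \<in> A)" for A :: "'a set"
  have Y: "Y A \<in> A" "Y A \<in> M" if "A \<in> \<A> n" for A n
  proof -
    have "A \<noteq> {}" using that partition_onD3[OF \<A>(2)] by auto
    then show "Y A \<in> A" unfolding Y_def by (simp add: some_in_eq)
    then show "Y A \<in> M" using sub[OF that] by auto
  qed
  define q where "q n \<omega> = sqrt (\<Sum>A\<in>\<A> n. (real (points_in (G \<omega>) A))\<^sup>2)" for n \<omega>
  have qmeas[measurable]: "q n \<in> borel_measurable P" for n
  proof -
    have "(\<lambda>\<omega>. real (points_in (G \<omega>) A)) \<in> borel_measurable P" if "A \<in> \<A> n" for A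
      using Gint[of A] that \<A>(3) sub[OF that] borel_measurable_integrable by blast
    then show ?thesis unfolding q_def[abs_def] by measurable
  qed
  have bound: "(\<integral>\<^sup>+\<omega>. ennreal (W \<omega>) \<partial>P) \<le> ennreal (e n * (2 * \<mu>)) + ennreal (2 * C * sqrt (\<kappa> 0)) * (\<integral>\<^sup>+\<omega>. ennreal (q n \<omega>) \<partial>P)" for n
  proof -
    define D where "D A = distr P (count_space UNIV) (\<lambda>\<omega>. points_in (G \<omega>) (if A \<in> \<A> n then A else {}))" for A
    note D = poisson_process_partition_product[OF G \<A>(1,2,3)[of n] M(3), folded D_def]
    \<comment> \<open>The value 0 off the partition is chosen because the Lipschitz conditions of
      \<open>expected_SUP_le\<close> range over all indices.\<close>
    define f where "f v A = (if A \<in> \<A> n then \<psi> v (Y A) else 0)" for v A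
    define c where "c v A = (if A \<in> \<A> n then g v (Y A) else 0)" for v A
    define Z where "Z x = (SUP v\<in>V. ennreal (\<Sum>A\<in>\<A> n. f v A * (real (x A) - (LINT y|D A. real y))))" for x
    have "(\<integral>\<^sup>+x. Z x \<partial>PiM (\<A> n) D) \<le> (\<integral>\<^sup>+x. ennreal (2 * C * sqrt (\<kappa> 0) * sqrt (\<Sum>A\<in>\<A> n. (real (x A))\<^sup>2)) \<partial>PiM (\<A> n) D)"
      unfolding Z_def
    proof (rule expected_SUP_le[where c = c and K = "\<lambda>A A'. \<kappa> (Y A - Y A')"])
      fix v b assume v: "v \<in> V"
      have "(\<Sum>A\<in>\<A> n. b A * c v A) = (\<Sum>A\<in>\<A> n. b A * g v (Y A))" by (intro sum.cong) (auto simp: c_def)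
      then show "(\<Sum>A\<in>\<A> n. b A * c v A)\<^sup>2 \<le> C\<^sup>2 * (\<Sum>A\<in>\<A> n. \<Sum>A'\<in>\<A> n. b A * b A' * \<kappa> (Y A - Y A'))"
        using ker[OF v \<A>(1)[of n], of Y b] Y(2) by auto
    qed (auto simp: D \<A>(1) C psd f_def c_def intro!: lip le Y(2))
    also have "\<dots> = (\<integral>\<^sup>+\<omega>. ennreal (2 * C * sqrt (\<kappa> 0)) * ennreal (q n \<omega>) \<partial>P)"
      unfolding D(5) q_def by (intro nn_integral_cong) (simp add: ennreal_mult'' sum_nonneg)
    also have "\<dots> = ennreal (2 * C * sqrt (\<kappa> 0)) * (\<integral>\<^sup>+\<omega>. ennreal (q n \<omega>) \<partial>P)"
      by (rule nn_integral_cmult) measurable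
    finally have Zle: "(\<integral>\<^sup>+\<omega>. Z (\<lambda>A\<in>\<A> n. points_in (G \<omega>) A) \<partial>P) \<le> ennreal (2 * C * sqrt (\<kappa> 0)) * (\<integral>\<^sup>+\<omega>. ennreal (q n \<omega>) \<partial>P)"
      unfolding D(5) .
    \<comment> \<open>The nonnegative integral of a sum is split below, which requires measurable
      summands; \<open>Z\<close> qualifies as a function of finitely many counts.\<close>
    have Zmeas: "(\<lambda>\<omega>. Z (\<lambda>A\<in>\<A> n. points_in (G \<omega>) A)) \<in> borel_measurable P"
    proof (rule measurable_compose[of "\<lambda>\<omega>. \<lambda>A\<in>\<A> n. points_in (G \<omega>) A" P "PiM (\<A> n) (\<lambda>_. count_space UNIV)" Z])
      show "(\<lambda>\<omega>. \<lambda>A\<in>\<A> n. points_in (G \<omega>) A) \<in> P \<rightarrow>\<^sub>M (\<Pi>\<^sub>M A\<in>\<A> n. count_space UNIV)"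
        using \<A>(3) sub by (intro measurable_restrict Gmeas) auto
      show "Z \<in> borel_measurable (\<Pi>\<^sub>M A\<in>\<A> n. count_space UNIV)"
        by (rule measurable_PiM_nat) (auto simp: \<A>(1))
    qed
    \<comment> \<open>Passing to the step function \<open>st\<close> costs at most
      \<open>e n\<close> for each point and \<open>e n * \<mu>\<close> in the integral; since
      \<open>N\<close> has mean \<open>\<mu>\<close>, this is \<open>e n * (2 * \<mu>)\<close> on
      average. What remains is linear in the centred counts and is one of the terms in the supremum
      \<open>Z\<close>.\<close>
    have pt: "ennreal (W \<omega>) \<le> ennreal (e n * (N \<omega> + \<mu>)) + Z (\<lambda>A\<in>\<A> n. points_in (G \<omega>) A)" if \<omega>: "\<omega> \<in> space P" for \<omega>
    proof -
      obtain v where v: "v \<in> V" "W \<omega> \<le> (\<Sum>x\<in>#G \<omega>. \<psi> v x) - (LINT x:M|lborel. \<psi> v x * h x)"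
        using W[OF \<omega>] by blast
      define st where "st x = (\<Sum>A\<in>\<A> n. \<psi> v (Y A) * indicator A x)" for x
      have st: "\<bar>\<psi> v x - st x\<bar> \<le> e n" if "x \<in> M" for x
      proof -
        have "x \<in> \<Union>(\<A> n)" using that partition_onD1[OF \<A>(2)[of n]] by auto
        then obtain A where A: "A \<in> \<A> n" "x \<in> A" by blast
        have "st x = \<psi> v (Y A)" unfolding st_def by (rule partition_indicator_sum[OF \<A>(1,2) A])
        then show ?thesis using osc[OF A Y(1)[OF A(1)] v(1)] by simp
      qed
      have 1: "\<bar>(\<Sum>x\<in>#G \<omega>. \<psi> v x) - (\<Sum>x\<in>#G \<omega>. st x)\<bar> \<le> e n * N \<omega>"
        unfolding N_def points_in_superset[OF GM[OF \<omega>]]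
        by (rule sum_mset_abs_diff_le) (use st GM[OF \<omega>] in auto)
      have ih: "set_integrable lborel A h" if "A \<in> \<A> n" for A
        using set_integrable_subset[OF hi _ sub[OF that]] that \<A>(3) by auto
      have sth: "indicator M x *\<^sub>R (st x * h x) = (\<Sum>A\<in>\<A> n. \<psi> v (Y A) * (indicator A x *\<^sub>R h x))" for x
      proof -
        have "indicator M x * (indicator A x :: real) = indicator A x" if "A \<in> \<A> n" for A
          using sub[OF that] by (auto simp: indicator_def)
        then have "(\<Sum>A\<in>\<A> n. \<psi> v (Y A) * ((indicator M x * indicator A x) * h x)) = (\<Sum>A\<in>\<A> n. \<psi> v (Y A) * (indicator A x *\<^sub>R h x))"
          by (intro sum.cong) auto
        then show ?thesis by (simp add: st_def sum_distrib_left sum_distrib_right mult_ac)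
      qed
      have sti: "set_integrable lborel M (\<lambda>x. st x * h x)"
        unfolding set_integrable_def sth
        by (intro Bochner_Integration.integrable_sum integrable_mult_right) (use ih in \<open>simp add: set_integrable_def\<close>)
      have steq: "(LINT x:M|lborel. st x * h x) = (\<Sum>A\<in>\<A> n. \<psi> v (Y A) * (LINT x:A|lborel. h x))"
        unfolding set_lebesgue_integral_def sth
        by (subst Bochner_Integration.integral_sum) (use ih in \<open>auto simp: set_integrable_def\<close>)
      have 2: "\<bar>(LINT x:M|lborel. \<psi> v x * h x) - (LINT x:M|lborel. st x * h x)\<bar> \<le> e n * \<mu>"
      proof -
        have "(LINT x:M|lborel. \<psi> v x * h x) - (LINT x:M|lborel. st x * h x) = (LINT x:M|lborel. (\<psi> v x - st x) * h x)"
          using int[OF v(1)] sti by (subst set_integral_diff(2)[symmetric]) (auto simp: algebra_simps)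
        also have "\<bar>\<dots>\<bar> \<le> (LINT x|lborel. \<bar>indicator M x *\<^sub>R ((\<psi> v x - st x) * h x)\<bar>)"
          unfolding set_lebesgue_integral_def by (rule integral_abs_bound)
        also have "\<dots> \<le> (LINT x|lborel. e n * (indicator M x *\<^sub>R h x))"
        proof (rule integral_mono_AE)
          have "set_integrable lborel M (\<lambda>x. (\<psi> v x - st x) * h x)"
            using set_integral_diff(1)[OF int[OF v(1)] sti] by (simp add: algebra_simps)
          then show "integrable lborel (\<lambda>x. \<bar>indicator M x *\<^sub>R ((\<psi> v x - st x) * h x)\<bar>)"
            unfolding set_integrable_def by (rule integrable_abs)
          show "integrable lborel (\<lambda>x. e n * (indicator M x *\<^sub>R h x))"
            using hi unfolding set_integrable_def by (rule integrable_mult_right)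
          show "AE x in lborel. \<bar>indicator M x *\<^sub>R ((\<psi> v x - st x) * h x)\<bar> \<le> e n * (indicator M x *\<^sub>R h x)"
            using h0
          proof eventually_elim
            case (elim x)
            then show ?case using st[of x] by (auto simp: indicator_def abs_mult intro!: mult_right_mono)
          qed
        qed
        also have "\<dots> = e n * \<mu>" by (simp add: \<mu>_def set_lebesgue_integral_def)
        finally show ?thesis .
      qed
      have z1: "(\<Sum>x\<in>#G \<omega>. st x) - (LINT x:M|lborel. st x * h x) =
        (\<Sum>A\<in>\<A> n. f v A * (real ((\<lambda>A\<in>\<A> n. points_in (G \<omega>) A) A) - (LINT y|D A. real y)))"
        unfolding steq unfolding st_def sum_mset_step_function
        by (subst sum_subtractf[symmetric]) (intro sum.cong, auto simp: f_def D(4) algebra_simps)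
      have z2: "ennreal (\<Sum>A\<in>\<A> n. f v A * (real ((\<lambda>A\<in>\<A> n. points_in (G \<omega>) A) A) - (LINT y|D A. real y)))
          \<le> Z (\<lambda>A\<in>\<A> n. points_in (G \<omega>) A)"
        unfolding Z_def by (intro SUP_upper v)
      have "W \<omega> \<le> e n * (N \<omega> + \<mu>) + ((\<Sum>x\<in>#G \<omega>. st x) - (LINT x:M|lborel. st x * h x))"
        using v(2) 1 2 by (simp add: algebra_simps)
      then have "ennreal (W \<omega>) \<le> ennreal (e n * (N \<omega> + \<mu>) + ((\<Sum>x\<in>#G \<omega>. st x) - (LINT x:M|lborel. st x * h x)))"
        by (rule ennreal_leI)
      also have "\<dots> \<le> ennreal (e n * (N \<omega> + \<mu>)) + ennreal ((\<Sum>x\<in>#G \<omega>. st x) - (LINT x:M|lborel. st x * h x))"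
        by (rule ennreal_add_le)
      also have "\<dots> \<le> ennreal (e n * (N \<omega> + \<mu>)) + Z (\<lambda>A\<in>\<A> n. points_in (G \<omega>) A)"
        unfolding z1 by (intro add_left_mono z2)
      finally show ?thesis .
    qed
    have "(\<integral>\<^sup>+\<omega>. ennreal (W \<omega>) \<partial>P) \<le> (\<integral>\<^sup>+\<omega>. ennreal (e n * (N \<omega> + \<mu>)) + Z (\<lambda>A\<in>\<A> n. points_in (G \<omega>) A) \<partial>P)"
      by (intro nn_integral_mono pt)
    also have "\<dots> = (\<integral>\<^sup>+\<omega>. ennreal (e n * (N \<omega> + \<mu>)) \<partial>P) + (\<integral>\<^sup>+\<omega>. Z (\<lambda>A\<in>\<A> n. points_in (G \<omega>) A) \<partial>P)"
      by (rule nn_integral_add) (auto intro: Zmeas)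
    also have "(\<integral>\<^sup>+\<omega>. ennreal (e n * (N \<omega> + \<mu>)) \<partial>P) = ennreal (LINT \<omega>|P. e n * (N \<omega> + \<mu>))"
      using Nint \<mu>0 less_imp_le[OF e0[of n]] by (intro nn_integral_eq_integral) (auto simp: N0)
    also have "(LINT \<omega>|P. e n * (N \<omega> + \<mu>)) = e n * (2 * \<mu>)"
      using Nint by (simp add: EN prob_space)
    also have "ennreal (e n * (2 * \<mu>)) + (\<integral>\<^sup>+\<omega>. Z (\<lambda>A\<in>\<A> n. points_in (G \<omega>) A) \<partial>P) \<le>
      ennreal (e n * (2 * \<mu>)) + ennreal (2 * C * sqrt (\<kappa> 0)) * (\<integral>\<^sup>+\<omega>. ennreal (q n \<omega>) \<partial>P)"
      by (intro add_left_mono Zle)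
    finally show ?thesis .
  qed
  \<comment> \<open>The Euclidean norm of the counts is at most their sum, so \<open>N\<close> is an
    integrable majorant for all partitions. Almost surely the sequence is eventually constant, once
    the mesh is below the least distance between distinct points.\<close>
  have lim: "(\<lambda>n. \<integral>\<^sup>+\<omega>. ennreal (q n \<omega>) \<partial>P) \<longlonglongrightarrow> (\<integral>\<^sup>+\<omega>. ennreal (sqrt (N \<omega>)) \<partial>P)"
  proof (rule nn_integral_dominated_convergence)
    show "(\<integral>\<^sup>+\<omega>. ennreal (N \<omega>) \<partial>P) < \<infinity>"
      using Nint by (simp add: integrable_iff_bounded N0)
    show "AE \<omega> in P. ennreal (q n \<omega>) \<le> ennreal (N \<omega>)" for n
    proof (intro AE_I2 ennreal_leI)
      fix \<omega> assume \<omega>: "\<omega> \<in> space P"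
      have "q n \<omega> \<le> (\<Sum>A\<in>\<A> n. real (points_in (G \<omega>) A))"
        unfolding q_def L2_set_def[symmetric] by (rule L2_set_le_sum) simp
      also have "\<dots> = N \<omega>"
        using sum_points_in_partition[OF \<A>(1,2) GM[OF \<omega>], of n] points_in_superset[OF GM[OF \<omega>]]
        by (simp add: N_def flip: of_nat_sum)
      finally show "q n \<omega> \<le> N \<omega>" .
    qed
    show "AE \<omega> in P. (\<lambda>n. ennreal (q n \<omega>)) \<longlonglongrightarrow> ennreal (sqrt (N \<omega>))"
      using simple AE_space
    proof eventually_elim
      case (elim \<omega>)
      obtain r where r: "r > 0" "\<And>x y. x \<in># G \<omega> \<Longrightarrow> y \<in># G \<omega> \<Longrightarrow> dist x y < r \<Longrightarrow> x = y"
        using finite_set_separated[OF finite_set_mset] by metis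
      obtain n0 where n0: "e n0 < r" using nat_approx_posE[OF r(1)] unfolding e_def by blast
      have "q n \<omega> = sqrt (N \<omega>)" if "n \<ge> n0" for n
      proof -
        have "e n \<le> e n0" using that by (simp add: e_def frac_le)
        then have en: "e n < r" using n0 by simp
        have "(real (points_in (G \<omega>) A))\<^sup>2 = real (points_in (G \<omega>) A)" if A: "A \<in> \<A> n" for A
        proof -
          have "points_in (G \<omega>) A \<le> 1"
          proof (rule points_in_small_set)
            fix x y assume "x \<in># G \<omega>" "y \<in># G \<omega>" "x \<in> A" "y \<in> A"
            then show "x = y" using fine[OF A, of x y] en by (intro r(2)) auto
          qed (use elim in auto)
          then have "points_in (G \<omega>) A = 0 \<or> points_in (G \<omega>) A = 1" by linarith
          then show ?thesis by auto
        qed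
        then have "q n \<omega> = sqrt (\<Sum>A\<in>\<A> n. real (points_in (G \<omega>) A))"
          unfolding q_def by (simp only: cong: sum.cong)
        also have "\<dots> = sqrt (N \<omega>)"
          using sum_points_in_partition[OF \<A>(1,2) GM[OF elim(2)], of n] points_in_superset[OF GM[OF elim(2)]]
          by (simp add: N_def flip: of_nat_sum)
        finally show ?thesis .
      qed
      then show ?case by (intro tendsto_eventually eventually_sequentiallyI[of n0]) simp
    qed
  qed measurable
  have e_lim: "(\<lambda>n. e n * (2 * \<mu>)) \<longlonglongrightarrow> 0"
    unfolding e_def by (intro tendsto_mult_left_zero LIMSEQ_Suc[OF lim_1_over_n])
  have "(\<lambda>n. ennreal (e n * (2 * \<mu>)) + ennreal (2 * C * sqrt (\<kappa> 0)) * (\<integral>\<^sup>+\<omega>. ennreal (q n \<omega>) \<partial>P)) \<longlonglongrightarrow>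
     ennreal 0 + ennreal (2 * C * sqrt (\<kappa> 0)) * (\<integral>\<^sup>+\<omega>. ennreal (sqrt (N \<omega>)) \<partial>P)"
    by (intro tendsto_add tendsto_ennrealI e_lim ennreal_tendsto_cmult lim) auto
  then have "(\<integral>\<^sup>+\<omega>. ennreal (W \<omega>) \<partial>P) \<le> ennreal 0 + ennreal (2 * C * sqrt (\<kappa> 0)) * (\<integral>\<^sup>+\<omega>. ennreal (sqrt (N \<omega>)) \<partial>P)"
    by (rule LIMSEQ_le_const) (auto intro: bound)
  then show ?thesis by (simp add: N_def)
qed

section \<open>Tikhonov regularization\<close>

text \<open>The set where \<open>g\<close> is negative is open and null, hence empty. Values at
  single points matter because the data term evaluates the logarithm at the points of the
  process.\<close>

lemma continuous_on_AE_nonneg: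
  fixes g :: "'a::euclidean_space \<Rightarrow> real"
  assumes M: "open M" and g: "continuous_on M g" and ae: "AE x in lborel. x \<in> M \<longrightarrow> 0 \<le> g x" and x: "x \<in> M"
  shows "0 \<le> g x"
proof (rule ccontr)
  assume "\<not> 0 \<le> g x"
  define S where "S = M \<inter> g -` {..<0}"
  have S: "open S" "x \<in> S"
    using M g x \<open>\<not> 0 \<le> g x\<close> unfolding S_def by (auto intro: continuous_open_preimage)
  have "AE x in lborel. x \<notin> S" using ae by eventually_elim (auto simp: S_def)
  then have "S \<in> null_sets lborel" using S by (subst AE_iff_null_sets) auto
  then have "negligible S" by (simp add: negligible_iff_null_sets null_sets_completionI)
  then show False using S open_not_negligible by blast
qed

text \<open>Here the shift by \<open>\<sigma>\<close> enters: it keeps the argument of the logarithm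
  away from 0 and so provides the Lipschitz constant for the contraction.\<close>

lemma abs_ln_diff_le:
  fixes a b \<sigma> :: real
  assumes "\<sigma> > 0" "a \<ge> \<sigma>" "b \<ge> \<sigma>"
  shows "\<bar>ln a - ln b\<bar> \<le> \<bar>a - b\<bar> / \<sigma>"
proof -
  have *: "ln x - ln y \<le> \<bar>x - y\<bar> / \<sigma>" if "x \<ge> \<sigma>" "y \<ge> \<sigma>" for x y
  proof -
    have "ln x - ln y \<le> (x - y) / y" using that assms by (intro ln_diff_le) auto
    also have "\<dots> \<le> \<bar>x - y\<bar> / y" using that assms by (intro divide_right_mono) auto
    also have "\<dots> \<le> \<bar>x - y\<bar> / \<sigma>" using that assms by (intro divide_left_mono) auto
    finally show ?thesis .
  qed
  show ?thesis using *[of a b] *[of b a] assms by (auto simp: abs_le_iff abs_minus_commute)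
qed

lemma set_integrable_bounded_mult:
  fixes f g :: "'a::euclidean_space \<Rightarrow> real"
  assumes M: "open M" and f: "continuous_on M f" "\<And>x. x \<in> M \<Longrightarrow> \<bar>f x\<bar> \<le> K" and g: "set_integrable lborel M g"
  shows "set_integrable lborel M (\<lambda>x. f x * g x)"
  unfolding set_integrable_def
proof (rule Bochner_Integration.integrable_bound)
  show "integrable lborel (\<lambda>x. K *\<^sub>R (indicator M x *\<^sub>R g x))"
    using g unfolding set_integrable_def by (rule integrable_scaleR_right)
  have [measurable]: "(\<lambda>x. indicator M x *\<^sub>R f x) \<in> borel_measurable borel"
    using M f by (intro borel_measurable_continuous_on_indicator) auto
  have [measurable]: "(\<lambda>x. indicator M x *\<^sub>R g x) \<in> borel_measurable borel"
    using g borel_measurable_integrable unfolding set_integrable_def by fastforce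
  have "(\<lambda>x. (indicator M x *\<^sub>R f x) * (indicator M x *\<^sub>R g x)) \<in> borel_measurable lborel" by measurable
  also have "(\<lambda>x. (indicator M x *\<^sub>R f x) * (indicator M x *\<^sub>R g x)) = (\<lambda>x. indicator M x *\<^sub>R (f x * g x))"
    by (auto simp: indicator_def)
  finally show "(\<lambda>x. indicator M x *\<^sub>R (f x * g x)) \<in> borel_measurable lborel" .
  show "AE x in lborel. norm (indicator M x *\<^sub>R (f x * g x)) \<le> norm (K *\<^sub>R (indicator M x *\<^sub>R g x))"
  proof (intro AE_I2)
    fix x show "norm (indicator M x *\<^sub>R (f x * g x)) \<le> norm (K *\<^sub>R (indicator M x *\<^sub>R g x))"
      using f(2)[of x] by (auto simp: indicator_def abs_mult intro!: mult_right_mono)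
  qed
qed

section \<open>Sobolev balls on the domain\<close>

lemma sobolev_on_quadratic_form_bound:
  fixes g :: "'a::euclidean_space \<Rightarrow> real" and b :: "'i \<Rightarrow> real"
  assumes s: "s > real DIM('a) / 2" and g: "g \<in> sobolev_on s M" "sobolev_on_norm s M g \<le> K"
    and M: "open M" "continuous_on M g" and I: "finite I" "\<And>i. i \<in> I \<Longrightarrow> y i \<in> M"
  shows "(\<Sum>i\<in>I. b i * g (y i))\<^sup>2 \<le>
    (\<bar>K\<bar> + 1)\<^sup>2 / (2 * pi) ^ DIM('a) * (\<Sum>i\<in>I. \<Sum>j\<in>I. b i * b j * bessel_kernel s (y i - y j))"
proof -
  have ne: "sobolev_extensions s M g \<noteq> {}" using g by (simp add: sobolev_on_def)
  \<comment> \<open>The quotient norm is an infimum, so some room is left for choosing an extension;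
    the absolute value gives a positive bound without a discussion of the sign of
    \<open>K\<close>.\<close>
  have "(INF f\<in>sobolev_extensions s M g. sobolev_norm s f) < \<bar>K\<bar> + 1"
    using g(2) unfolding sobolev_on_norm_def by linarith
  then obtain f where f: "f \<in> sobolev_extensions s M g" "sobolev_norm s f < \<bar>K\<bar> + 1"
    using cInf_lessD[of "sobolev_norm s ` sobolev_extensions s M g"] ne by auto
  have q0: "0 \<le> (\<Sum>i\<in>I. \<Sum>j\<in>I. b i * b j * bessel_kernel s (y i - y j))"
    unfolding bessel_kernel_quadratic_form(2)[OF s I(1), symmetric] by (rule integral_nonneg_AE) simp
  have n0: "0 \<le> sobolev_norm s f" unfolding sobolev_norm_def by (auto intro!: integral_nonneg_AE)
  have "(\<Sum>i\<in>I. b i * g (y i))\<^sup>2 \<le>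
    (sobolev_norm s f)\<^sup>2 / (2 * pi) ^ DIM('a) * (\<Sum>i\<in>I. \<Sum>j\<in>I. b i * b j * bessel_kernel s (y i - y j))"
    using f(1) by (intro sobolev_quadratic_form_bound[OF s _ M(1,2) _ I]) (auto simp: sobolev_extensions_def)
  also have "\<dots> \<le> (\<bar>K\<bar> + 1)\<^sup>2 / (2 * pi) ^ DIM('a) * (\<Sum>i\<in>I. \<Sum>j\<in>I. b i * b j * bessel_kernel s (y i - y j))"
    using f(2) n0 q0 by (intro mult_right_mono divide_right_mono power_mono) auto
  finally show ?thesis .
qed

lemma bessel_kernel_uminus: "bessel_kernel s (- z) = bessel_kernel s z"
  by (simp add: bessel_kernel_def)

text \<open>The quadratic form is tested with one point of weight 1, and with two points of weights
  1 and -1. The second choice yields a modulus of continuity common to the whole ball.\<close>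

lemma
  fixes g :: "'a::euclidean_space \<Rightarrow> real"
  assumes s: "s > real DIM('a) / 2" and g: "g \<in> sobolev_on s M" "sobolev_on_norm s M g \<le> K"
    and M: "open M" "continuous_on M g" and x: "x \<in> M"
  shows sobolev_on_point_bound: "(g x)\<^sup>2 \<le> (\<bar>K\<bar> + 1)\<^sup>2 / (2 * pi) ^ DIM('a) * bessel_kernel s (0::'a)"
    and sobolev_on_modulus: "y \<in> M \<Longrightarrow> (g x - g y)\<^sup>2 \<le>
      (\<bar>K\<bar> + 1)\<^sup>2 / (2 * pi) ^ DIM('a) * (2 * (bessel_kernel s (0::'a) - bessel_kernel s (x - y)))"
proof -
  show "(g x)\<^sup>2 \<le> (\<bar>K\<bar> + 1)\<^sup>2 / (2 * pi) ^ DIM('a) * bessel_kernel s (0::'a)"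
    using sobolev_on_quadratic_form_bound[OF s g M, of "{()}" "\<lambda>_. x" "\<lambda>_. 1"] x by simp
  show "(g x - g y)\<^sup>2 \<le> (\<bar>K\<bar> + 1)\<^sup>2 / (2 * pi) ^ DIM('a) * (2 * (bessel_kernel s (0::'a) - bessel_kernel s (x - y)))" if "y \<in> M"
  proof -
    have m: "(if i then x else y) \<in> M" for i using x that by simp
    show ?thesis
      using sobolev_on_quadratic_form_bound[OF s g M, of "{True, False}" "\<lambda>i. if i then x else y" "\<lambda>i. if i then 1 else - 1", OF _ m]
        bessel_kernel_uminus[of s "x - y"] by (simp add: algebra_simps)
  qed
qed

text \<open>Boundedness makes every term integrable, so both sides expand by linearity. The parts
  with \<open>\<sigma>\<close> agree; the two misfit differences are distinguished only by
  integrating \<open>\<psi>\<close> against the data or against the exact density \<open>gd\<close>,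
  and this discrepancy is the centred point sum divided by \<open>t\<close>.\<close>

lemma data_misfit_diff:
  fixes M :: "'a::euclidean_space set"
  assumes M: "open M" "bounded M" and \<sigma>: "\<sigma> > 0" and t: "t > 0"
    and g: "continuous_on M g" "\<And>x. x \<in> M \<Longrightarrow> 0 \<le> g x \<and> g x \<le> K"
    and gd: "continuous_on M gd" "\<And>x. x \<in> M \<Longrightarrow> 0 \<le> gd x \<and> gd x \<le> K"
    and X: "set_mset X \<subseteq> M"
  defines "\<psi> \<equiv> \<lambda>x. ln (g x + \<sigma>) - ln (gd x + \<sigma>)"
  shows "data_misfit M \<sigma> t X g - data_misfit M \<sigma> t X gd =
    KL_misfit M \<sigma> gd g - ((\<Sum>x\<in>#X. \<psi> x) - (LINT x:M|lborel. \<psi> x * (t * gd x))) / t"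
proof -
  have one: "set_integrable lborel M (\<lambda>x. 1 :: real)"
    using M emeasure_bounded_finite[OF M(2)]
    by (simp add: set_integrable_def integrable_indicator_iff)
  have bi: "set_integrable lborel M f" if "continuous_on M f" "\<And>x. x \<in> M \<Longrightarrow> \<bar>f x\<bar> \<le> K'" for f :: "'a \<Rightarrow> real" and K'
    using set_integrable_bounded_mult[OF M(1) that one] by simp
  have cln: "continuous_on M (\<lambda>x. ln (f x + \<sigma>))" if "continuous_on M f" "\<And>x. x \<in> M \<Longrightarrow> 0 \<le> f x" for f
    using that \<sigma> by (intro continuous_intros) (auto simp: add_nonneg_eq_0_iff dest: that(2))
  have bln: "\<bar>ln (f x + \<sigma>)\<bar> \<le> \<bar>ln \<sigma>\<bar> + \<bar>ln (K + \<sigma>)\<bar>" if "x \<in> M" "\<And>x. x \<in> M \<Longrightarrow> 0 \<le> f x \<and> f x \<le> K" for f x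
  proof -
    have "ln \<sigma> \<le> ln (f x + \<sigma>)" "ln (f x + \<sigma>) \<le> ln (K + \<sigma>)" using that(2)[OF that(1)] \<sigma> by (auto intro!: ln_mono)
    then show ?thesis by linarith
  qed
  have ig: "set_integrable lborel M g" and igd: "set_integrable lborel M gd"
    by (rule bi[of _ K], use g gd in auto)+
  have il: "set_integrable lborel M (\<lambda>x. ln (g x + \<sigma>))" and ild: "set_integrable lborel M (\<lambda>x. ln (gd x + \<sigma>))"
    by (rule bi[OF cln bln], use g gd in auto)+
  have c\<psi>: "continuous_on M \<psi>" unfolding \<psi>_def using g gd by (intro continuous_on_diff cln) auto
  have b\<psi>: "\<bar>\<psi> x\<bar> \<le> 2 * (\<bar>ln \<sigma>\<bar> + \<bar>ln (K + \<sigma>)\<bar>)" if "x \<in> M" for x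
    using bln[of x g, OF that g(2)] bln[of x gd, OF that gd(2)] unfolding \<psi>_def by simp
  have i\<psi>: "set_integrable lborel M \<psi>" by (rule bi[OF c\<psi> b\<psi>])
  have i\<psi>g: "set_integrable lborel M (\<lambda>x. \<psi> x * gd x)" by (rule set_integrable_bounded_mult[OF M(1) c\<psi> b\<psi> igd])
  have KL: "KL_misfit M \<sigma> gd g = (LINT x:M|lborel. g x) - (LINT x:M|lborel. gd x) - (LINT x:M|lborel. \<psi> x * gd x) - \<sigma> * (LINT x:M|lborel. \<psi> x)"
  proof -
    have "KL_misfit M \<sigma> gd g = (LINT x:M|lborel. g x - gd x - \<psi> x * gd x - \<sigma> * \<psi> x)"
      unfolding KL_misfit_def
    proof (rule set_lebesgue_integral_cong)
      show "M \<in> sets lborel" using M by simp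
      show "\<forall>x. x \<in> M \<longrightarrow> g x - gd x - (gd x + \<sigma>) * ln ((g x + \<sigma>) / (gd x + \<sigma>)) = g x - gd x - \<psi> x * gd x - \<sigma> * \<psi> x"
      proof (intro allI impI)
        fix x assume "x \<in> M"
        then have "g x + \<sigma> > 0" "gd x + \<sigma> > 0" using g(2) gd(2) \<sigma> by (auto simp: add_nonneg_pos)
        then have "ln ((g x + \<sigma>) / (gd x + \<sigma>)) = \<psi> x" by (simp add: ln_div \<psi>_def)
        then show "g x - gd x - (gd x + \<sigma>) * ln ((g x + \<sigma>) / (gd x + \<sigma>)) = g x - gd x - \<psi> x * gd x - \<sigma> * \<psi> x"
          by (simp add: algebra_simps)
      qed
    qed
    also have "\<dots> = (LINT x:M|lborel. g x) - (LINT x:M|lborel. gd x) - (LINT x:M|lborel. \<psi> x * gd x) - \<sigma> * (LINT x:M|lborel. \<psi> x)"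
      using ig igd i\<psi> i\<psi>g by (simp add: set_integral_diff)
    finally show ?thesis .
  qed
  have l\<psi>: "(LINT x:M|lborel. \<psi> x) = (LINT x:M|lborel. ln (g x + \<sigma>)) - (LINT x:M|lborel. ln (gd x + \<sigma>))"
    unfolding \<psi>_def using il ild by (rule set_integral_diff)
  have t\<psi>: "(LINT x:M|lborel. \<psi> x * (t * gd x)) = t * (LINT x:M|lborel. \<psi> x * gd x)"
    by (simp add: mult.left_commute)
  have s\<psi>: "(\<Sum>x\<in>#X. \<psi> x) = (\<Sum>x\<in>#X. ln (g x + \<sigma>)) - (\<Sum>x\<in>#X. ln (gd x + \<sigma>))"
    unfolding \<psi>_def by (induction X) auto
  show ?thesis
    unfolding KL t\<psi> s\<psi> l\<psi> data_misfit_def scaled_integral_def using t by (simp add: field_simps)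
qed

text \<open>The subgradient inequality for \<open>- \<phi>\<close> at \<open>s\<close>, evaluated at the Kullback--Leibler misfit and at \<open>0\<close>.\<close>

lemma tikhonov_bregman_bound:
  fixes R :: "'x::real_normed_vector \<Rightarrow> ereal"
  assumes R: "proper_functional R" and us: "us \<in> subdifferential R ud" and ud: "ud \<in> B" and v: "v \<in> B"
    and \<phi>: "\<phi> 0 = 0" and s: "s > 0" and \<alpha>: "\<alpha> > 0"
    and sub: "1 / \<alpha> \<in> uminus ` real_subdifferential (\<lambda>\<tau>. - extended_index \<phi> \<tau>) s"
    and src: "ereal \<beta> * bregman_dist R us v ud \<le> R v - R ud + extended_index \<phi> T" and \<beta>: "\<beta> > 0"
    and min: "ereal a + ereal \<alpha> * R v \<le> ereal b + ereal \<alpha> * R ud" and ab: "a - b = T - W"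
  shows "\<phi> s > 0" and "\<exists>d\<ge>0. bregman_dist R us v ud = ereal d \<and> \<beta> * d \<le> \<phi> s * (1 + max 0 W / s)"
proof -
  \<comment> \<open>\<open>R\<close> is finite at \<open>ud\<close> because a subgradient exists
    there and at \<open>v\<close> by minimality, so the remaining argument is real
    arithmetic.\<close>
  obtain r0 where r0: "R ud = ereal r0"
    using us R by (cases "R ud") (auto simp: subdifferential_def proper_functional_def)
  obtain r1 where r1: "R v = ereal r1"
    using min r0 \<alpha> R by (cases "R v") (auto simp: proper_functional_def)
  define d where "d = r1 - r0 - blinfun_apply us (v - ud)"
  have D: "bregman_dist R us v ud = ereal d" by (simp add: bregman_dist_def r0 r1 d_def)
  have "R ud + ereal (blinfun_apply us (v - ud)) \<le> R v" using us by (simp add: subdifferential_def)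
  then have d0: "d \<ge> 0" by (simp add: r0 r1 d_def)
  \<comment> \<open>For negative \<open>T\<close> the extended index function is minus infinity,
    which the finite left side of the source condition excludes.\<close>
  have T0: "T \<ge> 0"
    using src \<beta> by (rule_tac ccontr) (simp add: D r0 r1 extended_index_def)
  have src': "\<beta> * d \<le> r1 - r0 + \<phi> T"
    using src T0 by (simp add: D r0 r1 extended_index_def)
  have min': "\<alpha> * (r1 - r0) \<le> W - T"
    using min ab by (simp add: r0 r1 algebra_simps)
  have sg: "\<phi> \<tau> \<le> \<phi> s + 1 / \<alpha> * (\<tau> - s)" if "\<tau> \<ge> 0" for \<tau>
  proof -
    obtain w where w: "w \<in> real_subdifferential (\<lambda>\<tau>. - extended_index \<phi> \<tau>) s" "1 / \<alpha> = - w" using sub by auto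
    then have "- extended_index \<phi> s + ereal (w * (\<tau> - s)) \<le> - extended_index \<phi> \<tau>"
      by (simp add: real_subdifferential_def)
    then have "- \<phi> s + w * (\<tau> - s) \<le> - \<phi> \<tau>" using s that by (simp add: extended_index_def)
    then show ?thesis by (simp add: w(2))
  qed
  \<comment> \<open>At \<tau> = 0 the value \<open>\<phi> 0 = 0\<close> bounds 1 / \<alpha> by the
    secant slope, which removes \<alpha> from the final estimate and forces
    \<open>\<phi> s > 0\<close>.\<close>
  have p: "1 / \<alpha> \<le> \<phi> s / s" using sg[of 0] s \<phi> by (simp add: field_simps)
  then show ps: "\<phi> s > 0" using s \<alpha> by (smt (verit) divide_le_0_iff zero_less_divide_iff)
  have "r1 - r0 \<le> (W - T) / \<alpha>" using min' \<alpha> by (simp add: field_simps)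
  \<comment> \<open>The gain -T / \<alpha> from minimality cancels the growth T / \<alpha> of the
    affine majorant of \<open>\<phi>\<close>; the choice of \<alpha> is made for this.\<close>
  then have "\<beta> * d \<le> \<phi> s + (W - s) / \<alpha>"
    using src' sg[OF T0] by (simp add: diff_divide_distrib)
  also have "\<dots> \<le> \<phi> s + 1 / \<alpha> * max 0 W"
    using s \<alpha> by (simp add: divide_right_mono)
  also have "\<dots> \<le> \<phi> s + \<phi> s / s * max 0 W"
    using p by (intro add_left_mono mult_right_mono) auto
  finally show "\<exists>d\<ge>0. bregman_dist R us v ud = ereal d \<and> \<beta> * d \<le> \<phi> s * (1 + max 0 W / s)"
    using D d0 by (intro exI[of _ d]) (simp add: algebra_simps)
qed

text \<open>The inequality 2 sqrt (N t) \<le> N + t linearizes the root, so the mean of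
  \<open>N\<close> suffices. When that mean is proportional to \<open>t\<close>, the bound is of
  order sqrt t.\<close>

lemma nn_integral_sqrt_le:
  assumes "t > 0" "integrable P N" "\<And>\<omega>. N \<omega> \<ge> 0" "prob_space P"
  shows "(\<integral>\<^sup>+\<omega>. ennreal (sqrt (N \<omega>)) \<partial>P) \<le> ennreal (((LINT \<omega>|P. N \<omega>) / sqrt t + sqrt t) / 2)"
proof -
  interpret prob_space P by fact
  have "sqrt (N \<omega>) \<le> (N \<omega> / sqrt t + sqrt t) / 2" for \<omega>
  proof -
    have "2 * sqrt (N \<omega>) * sqrt t \<le> (sqrt (N \<omega>))\<^sup>2 + (sqrt t)\<^sup>2" by (rule sum_squares_bound)
    then have "2 * sqrt (N \<omega>) * sqrt t \<le> N \<omega> + sqrt t * sqrt t" using assms by simp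
    then show ?thesis using assms(1) by (simp add: field_simps)
  qed
  then have "(\<integral>\<^sup>+\<omega>. ennreal (sqrt (N \<omega>)) \<partial>P) \<le> (\<integral>\<^sup>+\<omega>. ennreal ((N \<omega> / sqrt t + sqrt t) / 2) \<partial>P)"
    by (intro nn_integral_mono ennreal_leI)
  also have "\<dots> = ennreal (LINT \<omega>|P. (N \<omega> / sqrt t + sqrt t) / 2)"
    using assms by (intro nn_integral_eq_integral) auto
  also have "(LINT \<omega>|P. (N \<omega> / sqrt t + sqrt t) / 2) = ((LINT \<omega>|P. N \<omega>) / sqrt t + sqrt t) / 2"
    using assms by (simp add: prob_space)
  finally show ?thesis .
qed

theorem theorem4p3:
  fixes M :: "'a::euclidean_space set"
    and B :: "'x::banach set"
    and F :: "'x \<Rightarrow> 'a \<Rightarrow> real"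
    and s \<sigma> \<beta> :: real
    and ud :: 'x
    and P :: "'w measure"
    and G :: "real \<Rightarrow> 'w \<Rightarrow> 'a multiset"
    and R :: "'x \<Rightarrow> ereal"
    and us :: "'x \<Rightarrow>\<^sub>L real"
    and \<phi> \<alpha> :: "real \<Rightarrow> real"
    and u :: "real \<Rightarrow> 'w \<Rightarrow> 'x"
  assumes "bounded_lipschitz_domain M"
    and "bounded B" and "closed B" and "convex B"
    and "\<And>v. v \<in> B \<Longrightarrow> set_integrable lborel M (F v)"
    and "\<And>v. v \<in> B \<Longrightarrow> AE x in lborel. x \<in> M \<longrightarrow> 0 \<le> F v x"
    and "s > real DIM('a) / 2"
    and "sobolev_on_bounded s M (F ` B)"
    and "\<And>v. v \<in> B \<Longrightarrow> continuous_on M (F v)"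
    and "ud \<in> B"
    and "\<sigma> > 0"
    and "prob_space P"
    and "\<And>t. t > 0 \<Longrightarrow> poisson_process P M (\<lambda>x. t * F ud x) (G t)"
    and "proper_functional R" and "convex_functional R"
    and "us \<in> subdifferential R ud"
    and "\<beta> > 0"
    and "index_function \<phi>"
    and "concave_on {0..} (\<lambda>\<tau>. (\<phi> \<tau>)\<^sup>2)"
    and "\<And>v. v \<in> B \<Longrightarrow>
           ereal \<beta> * bregman_dist R us v ud
             \<le> R v - R ud + extended_index \<phi> (KL_misfit M \<sigma> (F ud) (F v))"
    and "\<forall>\<^sub>F t in at_top. \<alpha> t > 0 \<and>
           1 / \<alpha> t \<in> uminus ` real_subdifferential (\<lambda>\<tau>. - extended_index \<phi> \<tau>) (1 / sqrt t)"
    and "\<forall>\<^sub>F t in at_top. \<forall>\<omega>\<in>space P.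
           is_tikhonov_minimizer M \<sigma> F R B t (G t \<omega>) (\<alpha> t) (u t \<omega>)"
    and "\<forall>\<^sub>F t in at_top. (\<lambda>\<omega>. bregman_dist R us (u t \<omega>) ud) \<in> borel_measurable P"
  shows "(\<forall>\<^sub>F t in at_top. expected_value P (\<lambda>\<omega>. bregman_dist R us (u t \<omega>) ud) < \<infinity>) \<and>
         (\<lambda>t. enn2real (expected_value P (\<lambda>\<omega>. bregman_dist R us (u t \<omega>) ud)))
           \<in> O[at_top](\<lambda>t. \<phi> (1 / sqrt t))"
proof -
  note M_dom = assms(1) and int_F = assms(5) and nonneg_F = assms(6) and s = assms(7)
    and sob = assms(8) and cont_F = assms(9) and ud = assms(10) and \<sigma> = assms(11)
    and P = assms(12) and poisson = assms(13) and R = assms(14) and us = assms(16) and \<beta> = assms(17)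
    and \<phi> = assms(18) and source = assms(20)
  interpret prob_space P by (rule P)
  have M: "open M" "bounded M" "M \<noteq> {}" using M_dom by (auto simp: bounded_lipschitz_domain_def)
  obtain K where K: "\<And>v. v \<in> B \<Longrightarrow> F v \<in> sobolev_on s M" "\<And>v. v \<in> B \<Longrightarrow> sobolev_on_norm s M (F v) \<le> K"
    using sob unfolding sobolev_on_bounded_def by blast
  define \<kappa> where "\<kappa> = (bessel_kernel s :: 'a \<Rightarrow> real)"
  \<comment> \<open>The kernel \<open>c0 * \<kappa>\<close> dominates the evaluations of all
    \<open>F v\<close>; the constant carries the radius of the Sobolev ball and the normalization of
    the Fourier transform.\<close>
  define c0 where "c0 = (\<bar>K\<bar> + 1)\<^sup>2 / (2 * pi) ^ DIM('a)"
  have c0: "c0 \<ge> 0" by (simp add: c0_def)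
  have F0: "0 \<le> F v x" if "v \<in> B" "x \<in> M" for v x
    using continuous_on_AE_nonneg[OF M(1) cont_F[OF that(1)] nonneg_F[OF that(1)] that(2)] .
  have Fsq: "(F v x)\<^sup>2 \<le> c0 * \<kappa> 0" if "v \<in> B" "x \<in> M" for v x
    unfolding c0_def \<kappa>_def by (intro sobolev_on_point_bound[where M = M] s K M(1) cont_F that)
  define b where "b = sqrt (c0 * \<kappa> 0)"
  have Fb: "F v x \<le> b" if "v \<in> B" "x \<in> M" for v x
    unfolding b_def using Fsq[OF that] by (rule real_le_rsqrt)
  have Fmod: "\<bar>F v x - F v y\<bar> \<le> sqrt (c0 * (2 * (\<kappa> 0 - \<kappa> (x - y))))" if "v \<in> B" "x \<in> M" "y \<in> M" for v x y
  proof -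
    have "(F v x - F v y)\<^sup>2 \<le> c0 * (2 * (\<kappa> 0 - \<kappa> (x - y)))"
      unfolding c0_def \<kappa>_def by (intro sobolev_on_modulus[where M = M] s K M(1) cont_F that)
    then have "sqrt ((F v x - F v y)\<^sup>2) \<le> sqrt (c0 * (2 * (\<kappa> 0 - \<kappa> (x - y))))" by (rule real_sqrt_le_mono)
    then show ?thesis by simp
  qed
  define gd where "gd = F ud"
  define \<psi> where "\<psi> v x = ln (F v x + \<sigma>) - ln (gd x + \<sigma>)" for v x
  \<comment> \<open>Subtracting the exact data makes \<open>\<psi>\<close> and \<open>g\<close>
    vanish at \<open>ud\<close>, so the Lipschitz bound against \<open>ud\<close> also yields the
    bound on absolute values. Division by \<open>\<sigma>\<close> absorbs the Lipschitz constant of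
    the logarithm.\<close>
  define g where "g v x = (F v x - gd x) / \<sigma>" for v x
  have lipF: "\<bar>\<psi> v x - \<psi> v' x\<bar> \<le> \<bar>g v x - g v' x\<bar>" if "v \<in> B" "v' \<in> B" "x \<in> M" for v v' x
  proof -
    have "\<bar>ln (F v x + \<sigma>) - ln (F v' x + \<sigma>)\<bar> \<le> \<bar>(F v x + \<sigma>) - (F v' x + \<sigma>)\<bar> / \<sigma>"
      using F0[of v x] F0[of v' x] that \<sigma> by (intro abs_ln_diff_le) auto
    moreover have "\<bar>g v x - g v' x\<bar> = \<bar>F v x - F v' x\<bar> / \<sigma>"
      using \<sigma> by (simp add: g_def flip: diff_divide_distrib)
    ultimately show ?thesis by (simp add: \<psi>_def)
  qed
  have \<psi>ud: "\<psi> ud x = 0" "g ud x = 0" for x by (simp_all add: \<psi>_def g_def gd_def)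
  have leF: "\<bar>\<psi> v x\<bar> \<le> \<bar>g v x\<bar>" if "v \<in> B" "x \<in> M" for v x
    using lipF[OF that(1) ud that(2)] by (simp add: \<psi>ud)
  \<comment> \<open>By (p - r)^2 \<le> 2 p^2 + 2 r^2, with both squares at most \<open>c0\<close>
    times the form, the squared constant for \<open>g v\<close> is 4 c0 / \<sigma>^2.\<close>
  define C where "C = 2 * sqrt c0 / \<sigma>"
  have C: "C \<ge> 0" using c0 \<sigma> by (simp add: C_def)
  have psd: "0 \<le> (\<Sum>i\<in>I. \<Sum>j\<in>I. b i * b j * \<kappa> (y i - y j))" if "finite I" for I :: "'a set set" and b y
    unfolding \<kappa>_def bessel_kernel_quadratic_form(2)[OF s that, symmetric] by (rule integral_nonneg_AE) simp
  have ker: "(\<Sum>i\<in>I. b i * g v (y i))\<^sup>2 \<le> C\<^sup>2 * (\<Sum>i\<in>I. \<Sum>j\<in>I. b i * b j * \<kappa> (y i - y j))"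
    if "v \<in> B" "finite I" "y ` I \<subseteq> M" for v b y and I :: "'a set set"
  proof -
    define Q where "Q = (\<Sum>i\<in>I. \<Sum>j\<in>I. b i * b j * \<kappa> (y i - y j))"
    have q: "(\<Sum>i\<in>I. b i * F w (y i))\<^sup>2 \<le> c0 * Q" if "w \<in> B" for w
      unfolding c0_def Q_def \<kappa>_def using \<open>finite I\<close> \<open>y ` I \<subseteq> M\<close>
      by (intro sobolev_on_quadratic_form_bound[where M = M] s K that M(1) cont_F) auto
    have "(\<Sum>i\<in>I. b i * g v (y i)) = ((\<Sum>i\<in>I. b i * F v (y i)) - (\<Sum>i\<in>I. b i * F ud (y i))) / \<sigma>"
      by (simp add: g_def gd_def sum_divide_distrib right_diff_distrib diff_divide_distrib sum_subtractf)
    then have "(\<Sum>i\<in>I. b i * g v (y i))\<^sup>2 = ((\<Sum>i\<in>I. b i * F v (y i)) - (\<Sum>i\<in>I. b i * F ud (y i)))\<^sup>2 / \<sigma>\<^sup>2"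
      by (simp add: power_divide)
    also have "\<dots> \<le> (2 * (\<Sum>i\<in>I. b i * F v (y i))\<^sup>2 + 2 * (\<Sum>i\<in>I. b i * F ud (y i))\<^sup>2) / \<sigma>\<^sup>2"
    proof (rule divide_right_mono)
      show "(p - r)\<^sup>2 \<le> 2 * p\<^sup>2 + 2 * r\<^sup>2" for p r :: real
        using zero_le_power2[of "p + r"] by (simp add: power2_eq_square algebra_simps)
    qed simp
    also have "\<dots> \<le> (2 * (c0 * Q) + 2 * (c0 * Q)) / \<sigma>\<^sup>2"
      using q[OF that(1)] q[OF ud] by (intro divide_right_mono add_mono mult_left_mono) auto
    also have "\<dots> = C\<^sup>2 * Q"
      using c0 by (simp add: C_def power_divide power_mult_distrib)
    finally show ?thesis unfolding Q_def .
  qed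
  \<comment> \<open>One radius serves all \<open>v\<close> because only the kernel enters. The
    tolerance \<sigma> e / 2 accounts for the Lipschitz constant 1 / \<sigma> and for the two
    logarithms in \<open>\<psi>\<close>.\<close>
  have eqc: "\<exists>\<delta>>0. \<forall>v\<in>B. \<forall>x\<in>M. \<forall>y\<in>M. dist x y < \<delta> \<longrightarrow> \<bar>\<psi> v x - \<psi> v y\<bar> \<le> e" if e: "e > 0" for e
  proof -
    have "isCont (\<lambda>z. sqrt (c0 * (2 * (\<kappa> 0 - \<kappa> z)))) 0"
      unfolding \<kappa>_def by (intro continuous_intros isCont_bessel_kernel_0 s)
    moreover have "\<sigma> * e / 2 > 0" using e \<sigma> by simp
    ultimately obtain \<delta> where \<delta>: "\<delta> > 0" "\<And>z. dist z 0 < \<delta> \<Longrightarrow> dist (sqrt (c0 * (2 * (\<kappa> 0 - \<kappa> z)))) (sqrt (c0 * (2 * (\<kappa> 0 - \<kappa> 0)))) < \<sigma> * e / 2"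
      unfolding continuous_at_eps_delta by blast
    have "\<bar>\<psi> v x - \<psi> v y\<bar> \<le> e" if v: "v \<in> B" and xy: "x \<in> M" "y \<in> M" "dist x y < \<delta>" for v x y
    proof -
      have m: "\<bar>F w x - F w y\<bar> \<le> \<sigma> * e / 2" if "w \<in> B" for w
      proof -
        have "\<bar>F w x - F w y\<bar> \<le> sqrt (c0 * (2 * (\<kappa> 0 - \<kappa> (x - y))))" by (rule Fmod[OF that xy(1,2)])
        also have "\<dots> \<le> \<sigma> * e / 2" using \<delta>(2)[of "x - y"] xy(3) by (simp add: dist_norm dist_real_def)
        finally show ?thesis .
      qed
      have l: "\<bar>ln (F w x + \<sigma>) - ln (F w y + \<sigma>)\<bar> \<le> e / 2" if w: "w \<in> B" for w
      proof -
        have "\<bar>ln (F w x + \<sigma>) - ln (F w y + \<sigma>)\<bar> \<le> \<bar>(F w x + \<sigma>) - (F w y + \<sigma>)\<bar> / \<sigma>"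
          using F0[OF w xy(1)] F0[OF w xy(2)] \<sigma> by (intro abs_ln_diff_le) auto
        also have "\<dots> \<le> (\<sigma> * e / 2) / \<sigma>" using m[OF w] \<sigma> by (intro divide_right_mono) auto
        finally show ?thesis using \<sigma> by simp
      qed
      show ?thesis using l[OF v] l[OF ud] unfolding \<psi>_def gd_def by linarith
    qed
    then show ?thesis using \<delta>(1) by blast
  qed
  have b\<psi>: "\<bar>\<psi> v x\<bar> \<le> b / \<sigma>" if "v \<in> B" "x \<in> M" for v x
  proof -
    have "\<bar>g v x\<bar> \<le> b / \<sigma>"
      using F0[OF that] F0[OF ud that(2)] Fb[OF that] Fb[OF ud that(2)] \<sigma>
      by (auto simp: g_def gd_def abs_divide intro!: divide_right_mono)
    then show ?thesis using leF[OF that] by linarith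
  qed
  have c\<psi>: "continuous_on M (\<psi> v)" if "v \<in> B" for v
  proof -
    have "F w x + \<sigma> \<noteq> 0" if "w \<in> B" "x \<in> M" for w x using F0[OF that] \<sigma> by simp
    then show ?thesis unfolding \<psi>_def gd_def
      using that ud by (intro continuous_intros cont_F) auto
  qed
  have i\<psi>: "set_integrable lborel M (\<lambda>x. \<psi> v x * (t * F ud x))" if "v \<in> B" for v t
    by (rule set_integrable_bounded_mult[OF M(1) c\<psi>[OF that] b\<psi>[OF that]])
       (use int_F[OF ud] in auto)
  define \<mu> where "\<mu> = (LINT x:M|lborel. F ud x)"
  have \<mu>0: "\<mu> \<ge> 0"
    unfolding \<mu>_def set_lebesgue_integral_def
    by (rule integral_nonneg_AE) (use F0[OF ud] in \<open>auto simp: indicator_def\<close>)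
  \<comment> \<open>The summand 1 belongs to the deterministic term of the pathwise bound; the rest
    is the mean bound for the empirical process, relative to its scale sqrt t.\<close>
  define A where "A = (1 + C * sqrt (\<kappa> 0) * (\<mu> + 1)) / \<beta>"
  have \<kappa>0: "\<kappa> 0 \<ge> 0" unfolding \<kappa>_def bessel_kernel_def by (rule integral_nonneg_AE) simp
  have A0: "A \<ge> 0" using C \<kappa>0 \<mu>0 \<beta> by (simp add: A_def)
  have main: "expected_value P (\<lambda>\<omega>. bregman_dist R us (u t \<omega>) ud) \<le> ennreal (A * \<phi> (1 / sqrt t)) \<and> \<phi> (1 / sqrt t) > 0"
    if t: "t > 0" and \<alpha>: "\<alpha> t > 0"
      and sub: "1 / \<alpha> t \<in> uminus ` real_subdifferential (\<lambda>\<tau>. - extended_index \<phi> \<tau>) (1 / sqrt t)"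
      and tik: "\<forall>\<omega>\<in>space P. is_tikhonov_minimizer M \<sigma> F R B t (G t \<omega>) (\<alpha> t) (u t \<omega>)"
      and meas: "(\<lambda>\<omega>. bregman_dist R us (u t \<omega>) ud) \<in> borel_measurable P" for t
  proof -
    define s0 where "s0 = 1 / sqrt t"
    have s0: "s0 > 0" using t by (simp add: s0_def)
    note pp = poisson[OF t]
    define E where "E v \<omega> = (\<Sum>x\<in>#G t \<omega>. \<psi> v x) - (LINT x:M|lborel. \<psi> v x * (t * F ud x))" for v \<omega>
    have GM: "set_mset (G t \<omega>) \<subseteq> M" if "\<omega> \<in> space P" for \<omega>
      using pp that by (auto simp: poisson_process_def)
    have uB: "u t \<omega> \<in> B" if "\<omega> \<in> space P" for \<omega>
      using tik that by (auto simp: is_tikhonov_minimizer_def)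
    have key: "\<phi> s0 > 0" "\<exists>d\<ge>0. bregman_dist R us (u t \<omega>) ud = ereal d \<and> \<beta> * d \<le> \<phi> s0 * (1 + max 0 (E (u t \<omega>) \<omega> / t) / s0)"
      if \<omega>: "\<omega> \<in> space P" for \<omega>
    proof -
      let ?v = "u t \<omega>"
      have diff: "data_misfit M \<sigma> t (G t \<omega>) (F ?v) - data_misfit M \<sigma> t (G t \<omega>) (F ud) =
         KL_misfit M \<sigma> (F ud) (F ?v) - E ?v \<omega> / t"
        unfolding E_def \<psi>_def gd_def
        by (rule data_misfit_diff[where K = b]) (use M \<sigma> t cont_F uB[OF \<omega>] ud F0 Fb GM[OF \<omega>] in auto)
      have min: "ereal (data_misfit M \<sigma> t (G t \<omega>) (F ?v)) + ereal (\<alpha> t) * R ?v \<le>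
          ereal (data_misfit M \<sigma> t (G t \<omega>) (F ud)) + ereal (\<alpha> t) * R ud"
        using tik \<omega> ud by (auto simp: is_tikhonov_minimizer_def)
      have "\<phi> 0 = 0" using \<phi> by (simp add: index_function_def)
      note tb = tikhonov_bregman_bound[OF R us ud uB[OF \<omega>] this s0 \<alpha> sub[folded s0_def] source[OF uB[OF \<omega>]] \<beta> min diff]
      show "\<phi> s0 > 0" by (rule tb(1))
      show "\<exists>d\<ge>0. bregman_dist R us ?v ud = ereal d \<and> \<beta> * d \<le> \<phi> s0 * (1 + max 0 (E ?v \<omega> / t) / s0)"
        by (rule tb(2))
    qed
    \<comment> \<open>The inequality is deterministic, but \<open>key\<close> yields it only at some
      point of the sample space, which is nonempty.\<close>
    have ps: "\<phi> s0 > 0" using key(1) not_empty by blast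
    have pb: "0 \<le> \<phi> s0 / \<beta>" using ps \<beta> by simp
    define d where "d \<omega> = real_of_ereal (bregman_dist R us (u t \<omega>) ud)" for \<omega>
    have [measurable]: "d \<in> borel_measurable P" unfolding d_def using meas by measurable
    have d: "d \<omega> \<ge> 0" "bregman_dist R us (u t \<omega>) ud = ereal (d \<omega>)"
      "\<beta> * d \<omega> \<le> \<phi> s0 * (1 + max 0 (E (u t \<omega>) \<omega> / t) / s0)" if "\<omega> \<in> space P" for \<omega>
      using key(2)[OF that] by (auto simp: d_def)
    \<comment> \<open>The supremum of the empirical process need not be measurable, and the integral is not
      subadditive on such functions; hence the detour through this rescaling of the Bregman distance.\<close>
    define W where "W \<omega> = sqrt t * (\<beta> * d \<omega> / \<phi> s0 - 1)" for \<omega>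
    have [measurable]: "W \<in> borel_measurable P" unfolding W_def by measurable
    have Wle: "\<exists>v\<in>B. W \<omega> \<le> E v \<omega>" if \<omega>: "\<omega> \<in> space P" for \<omega>
    proof -
      have "\<beta> * d \<omega> / \<phi> s0 - 1 \<le> max 0 (E (u t \<omega>) \<omega> / t) / s0"
        using d(3)[OF \<omega>] ps by (simp add: field_simps)
      then have "W \<omega> \<le> sqrt t * (max 0 (E (u t \<omega>) \<omega> / t) / s0)"
        unfolding W_def using t by (intro mult_left_mono) auto
      also have "\<dots> = t * max 0 (E (u t \<omega>) \<omega> / t)"
        using t by (simp add: s0_def)
      also have "\<dots> = max 0 (E (u t \<omega>) \<omega>)"
        using t by (simp add: max_def divide_le_0_iff zero_le_divide_iff)
      finally have "W \<omega> \<le> max 0 (E (u t \<omega>) \<omega>)" .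
      \<comment> \<open>\<open>ud\<close> is the witness that realizes the value 0 in the maximum,
        for the case that the process is negative at the minimizer.\<close>
      moreover have "E ud \<omega> = 0" by (simp add: E_def \<psi>ud set_lebesgue_integral_def)
      ultimately have "W \<omega> \<le> E (u t \<omega>) \<omega> \<or> W \<omega> \<le> E ud \<omega>" by linarith
      then show ?thesis using uB[OF \<omega>] ud by blast
    qed
    define N where "N \<omega> = real (points_in (G t \<omega>) M)" for \<omega>
    have Nint: "integrable P N" and EN: "integral\<^sup>L P N = t * \<mu>"
    proof -
      have "integrable P (\<lambda>\<omega>. real (points_in (G t \<omega>) M))"
        "(LINT \<omega>|P. real (points_in (G t \<omega>) M)) = (LINT x:M|lborel. t * F ud x)"
        using pp borel_open[OF M(1)] unfolding poisson_process_def by blast+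
      then show "integrable P N" "integral\<^sup>L P N = t * \<mu>" by (simp_all add: N_def[abs_def] \<mu>_def)
    qed
    have "(\<integral>\<^sup>+\<omega>. ennreal (W \<omega>) \<partial>P) \<le> ennreal (2 * C * sqrt (\<kappa> 0)) * (\<integral>\<^sup>+\<omega>. ennreal (sqrt (N \<omega>)) \<partial>P)"
      unfolding N_def
      by (rule poisson_expected_sup_le[OF pp M lipF leF C ker psd eqc i\<psi> Wle[unfolded E_def]])
    also have "\<dots> \<le> ennreal (2 * C * sqrt (\<kappa> 0)) * ennreal ((t * \<mu> / sqrt t + sqrt t) / 2)"
    proof (rule mult_left_mono)
      have "N \<omega> \<ge> 0" for \<omega> by (simp add: N_def)
      from nn_integral_sqrt_le[OF t Nint this P]
      show "(\<integral>\<^sup>+\<omega>. ennreal (sqrt (N \<omega>)) \<partial>P) \<le> ennreal ((t * \<mu> / sqrt t + sqrt t) / 2)"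
        by (simp only: EN)
    qed simp
    also have "\<dots> = ennreal (C * sqrt (\<kappa> 0) * (sqrt t * (\<mu> + 1)))"
    proof -
      have "t * \<mu> / sqrt t = sqrt t * \<mu>" using t real_div_sqrt[of t] by (simp add: field_simps)
      then have "2 * C * sqrt (\<kappa> 0) * ((t * \<mu> / sqrt t + sqrt t) / 2) = C * sqrt (\<kappa> 0) * (sqrt t * (\<mu> + 1))"
        by (simp add: algebra_simps)
      moreover have "2 * C * sqrt (\<kappa> 0) \<ge> 0" using C \<kappa>0 by simp
      ultimately show ?thesis by (simp only: ennreal_mult'[symmetric])
    qed
    finally have EW: "(\<integral>\<^sup>+\<omega>. ennreal (W \<omega>) \<partial>P) \<le> ennreal (C * sqrt (\<kappa> 0) * (sqrt t * (\<mu> + 1)))" .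
    have "expected_value P (\<lambda>\<omega>. bregman_dist R us (u t \<omega>) ud) = (\<integral>\<^sup>+\<omega>. ennreal (d \<omega>) \<partial>P)"
      unfolding expected_value_def by (intro nn_integral_cong) (simp add: d(2))
    also have "\<dots> \<le> (\<integral>\<^sup>+\<omega>. ennreal (\<phi> s0 / \<beta>) * (1 + ennreal s0 * ennreal (W \<omega>)) \<partial>P)"
    proof (intro nn_integral_mono)
      fix \<omega>
      \<comment> \<open>This inverts the definition of \<open>W\<close>, with s0 * sqrt t =
        1.\<close>
      have "d \<omega> = \<phi> s0 / \<beta> * (1 + s0 * W \<omega>)"
        using ps \<beta> t by (simp add: W_def s0_def field_simps)
      then have "ennreal (d \<omega>) = ennreal (\<phi> s0 / \<beta>) * ennreal (1 + s0 * W \<omega>)"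
        by (simp only: ennreal_mult'[OF pb])
      also have "\<dots> \<le> ennreal (\<phi> s0 / \<beta>) * (1 + ennreal s0 * ennreal (W \<omega>))"
        using ennreal_add_le[of 1 "s0 * W \<omega>"] s0 by (intro mult_left_mono) (auto simp: ennreal_mult')
      finally show "ennreal (d \<omega>) \<le> ennreal (\<phi> s0 / \<beta>) * (1 + ennreal s0 * ennreal (W \<omega>))" .
    qed
    also have "\<dots> = ennreal (\<phi> s0 / \<beta>) * (1 + ennreal s0 * (\<integral>\<^sup>+\<omega>. ennreal (W \<omega>) \<partial>P))"
      by (simp add: nn_integral_cmult nn_integral_add emeasure_space_1)
    also have "\<dots> \<le> ennreal (\<phi> s0 / \<beta>) * (1 + ennreal s0 * ennreal (C * sqrt (\<kappa> 0) * (sqrt t * (\<mu> + 1))))"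
      by (intro mult_left_mono add_left_mono EW) auto
    also have "\<dots> = ennreal (A * \<phi> s0)"
    proof -
      \<comment> \<open>The size sqrt t of the process is cancelled by \<open>s0\<close>, which is
        why the subgradient is taken at 1 / sqrt t.\<close>
      have "s0 * (C * sqrt (\<kappa> 0) * (sqrt t * (\<mu> + 1))) = C * sqrt (\<kappa> 0) * (\<mu> + 1)"
        using t by (simp add: s0_def)
      then have "ennreal s0 * ennreal (C * sqrt (\<kappa> 0) * (sqrt t * (\<mu> + 1))) = ennreal (C * sqrt (\<kappa> 0) * (\<mu> + 1))"
        by (simp only: ennreal_mult'[OF less_imp_le[OF s0], symmetric])
      moreover have "C * sqrt (\<kappa> 0) * (\<mu> + 1) \<ge> 0" using C \<kappa>0 \<mu>0 by simp
      ultimately have "1 + ennreal s0 * ennreal (C * sqrt (\<kappa> 0) * (sqrt t * (\<mu> + 1))) = ennreal (1 + C * sqrt (\<kappa> 0) * (\<mu> + 1))"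
        by simp
      moreover have "A * \<phi> s0 = \<phi> s0 / \<beta> * (1 + C * sqrt (\<kappa> 0) * (\<mu> + 1))"
        by (simp add: A_def)
      ultimately show ?thesis by (simp only: ennreal_mult'[OF pb])
    qed
    finally show ?thesis using ps by (simp add: s0_def)
  qed
  have ev: "\<forall>\<^sub>F t in at_top. expected_value P (\<lambda>\<omega>. bregman_dist R us (u t \<omega>) ud) \<le> ennreal (A * \<phi> (1 / sqrt t)) \<and> \<phi> (1 / sqrt t) > 0"
    using eventually_gt_at_top[of 0] assms(21,22,23)
    by eventually_elim (use main in blast)
  show ?thesis
  proof
    show "\<forall>\<^sub>F t in at_top. expected_value P (\<lambda>\<omega>. bregman_dist R us (u t \<omega>) ud) < \<infinity>"
      using ev by eventually_elim (auto intro: le_less_trans)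
    show "(\<lambda>t. enn2real (expected_value P (\<lambda>\<omega>. bregman_dist R us (u t \<omega>) ud))) \<in> O(\<lambda>t. \<phi> (1 / sqrt t))"
    proof (rule bigoI[of _ A])
      show "\<forall>\<^sub>F t in at_top. norm (enn2real (expected_value P (\<lambda>\<omega>. bregman_dist R us (u t \<omega>) ud))) \<le> A * norm (\<phi> (1 / sqrt t))"
        using ev
      proof eventually_elim
        case (elim t)
        then have "enn2real (expected_value P (\<lambda>\<omega>. bregman_dist R us (u t \<omega>) ud)) \<le> A * \<phi> (1 / sqrt t)"
          using A0 by (intro enn2real_leI) auto
        then show ?case using elim by simp
      qed
    qed
  qed
qed

end
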